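(* Let $0<\alpha<5\times10^{-6}$, $0\le\beta\le\alpha/25$, and $n\ge\alpha^{-1}$. If $G$ is a graph of order $n$ with $e(G)>(1/4-\beta)n^{2}$, then one of the following conditions holds: (i) $C_{t}\subset G$ for every integer $t\in\left[3,\left\lceil(1/2+\alpha)n\right\rceil\right]$; (ii) there exists a partition $V(G)=V_{0}\cup V_{1}\cup V_{2}$ such that $$|V_{0}|<2000\alpha n,$$ $$\left(\tfrac12-10\sqrt{\alpha+\beta}\right)n<|V_{1}|\le|V_{2}|<\left(\tfrac12+10\sqrt{\alpha+\beta}\right)n,$$ $$\delta(G-V_{0})\ge 2n/5,$$ and either $$E(G-V_{0})\subset V_{1}^{(2)}\cup V_{2}^{(2)}\quad\text{or}\quad E(G-V_{0})\subset V_{1}\times V_{2}.$$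
   Context: Graphs are finite, simple and undirected. $e(G)$ is the number of edges and $\delta(G)$ the minimum degree of $G$. $C_t$ is the cycle of length $t$, and $C_t\subset G$ means $G$ contains a (not necessarily induced) subgraph isomorphic to $C_t$. $G-V_0$ is $G$ with the vertices of $V_0$ deleted. The parts of the partition are pairwise disjoint; $V_0$ may be empty. For a set $A$, $A^{(2)}$ is the family of all $2$-element subsets of $A$; for disjoint vertex sets $A,B$, $A\times B$ denotes the set of all possible (unordered) edges joining a vertex of $A$ to a vertex of $B$. *)

theory Defs
  imports Complex_Main "HOL-Library.Ramsey"
begin

record 'v ugraph =
  uverts :: "'v set"
  uedges :: "'v set set"

definition simple_graph :: "'v ugraph \<Rightarrow> bool" where
  "simple_graph G \<longleftrightarrow> finite (uverts G) \<and> uedges G \<subseteq> [uverts G]\<^bsup>2\<^esup>"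

text \<open>Both sides are meant to be simple graphs, so that edges are two-element sets of vertices
  and are carried along by taking images.\<close>

definition graph_iso :: "'v ugraph \<Rightarrow> 'w ugraph \<Rightarrow> bool" where
  "graph_iso G H \<longleftrightarrow>
     (\<exists>f. bij_betw f (uverts G) (uverts H) \<and> uedges H = (\<lambda>e. f ` e) ` uedges G)"

definition usubgraph :: "'v ugraph \<Rightarrow> 'v ugraph \<Rightarrow> bool" where
  "usubgraph H G \<longleftrightarrow> simple_graph H \<and> uverts H \<subseteq> uverts G \<and> uedges H \<subseteq> uedges G"

text \<open>This is the cycle of length \<open>t\<close> only for \<open>t \<ge> 3\<close>.\<close>

definition cycle_graph :: "nat \<Rightarrow> nat ugraph" where
  "cycle_graph t =
     \<lparr>uverts = {..<t}, uedges = {{i, Suc i mod t} | i. i < t}\<rparr>"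

definition contains_cycle :: "'v ugraph \<Rightarrow> nat \<Rightarrow> bool" where
  "contains_cycle G t \<longleftrightarrow> (\<exists>H. usubgraph H G \<and> graph_iso (cycle_graph t) H)"

definition delete_verts :: "'v ugraph \<Rightarrow> 'v set \<Rightarrow> 'v ugraph" where
  "delete_verts G S =
     \<lparr>uverts = uverts G - S, uedges = {e \<in> uedges G. e \<inter> S = {}}\<rparr>"

definition vdegree :: "'v ugraph \<Rightarrow> 'v \<Rightarrow> nat" where
  "vdegree G v = card {e \<in> uedges G. v \<in> e}"

text \<open>Unspecified for the graph without vertices.\<close>

definition min_degree :: "'v ugraph \<Rightarrow> nat" where
  "min_degree G = Min (vdegree G ` uverts G)"

definition cross_edges :: "'v set \<Rightarrow> 'v set \<Rightarrow> 'v set set" where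
  "cross_edges A B = {{a, b} | a b. a \<in> A \<and> b \<in> B}"

end

theory Submission
  imports Defs
begin

text \<open>
  Delete, one at a time, vertices whose degree is below \<open>0.49 n\<close>.  Each deletion costs fewer than
  \<open>0.49 n\<close> edges, while a quarter of the squared order drops by nearly \<open>n / 2\<close>; so the surplus of
  edges over this quarter grows.  There are two outcomes.

  Many vertices go, about \<open>1999 \<alpha> n\<close>.  Then the graph left over has order \<open>m\<close> and so many more than
  \<open>m\<^sup>2 / 4\<close> edges that a cycle with at least \<open>(1/2 + \<alpha>) n\<close> vertices exists.  This is Woodall's bound
  \<open>woodall_bound\<close>: without a cycle longer than \<open>c\<close>, a graph of order \<open>s\<close> has at most as many edges as
  two cliques of orders \<open>c\<close> and \<open>s - c + 1\<close> that share a vertex.  It is proved with Kopylov's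
  method: in an edge-maximal 2-connected counterexample the set of vertices that survive the
  removal of small degrees is empty or a clique, because a longest path with non-adjacent ends in it would
  close up to a long cycle (\<open>cycle_from_path_ends\<close>, \<open>long_cycle_from_cores\<close>).  A graph with more than
  \<open>m\<^sup>2 / 4\<close> edges and one cycle longer than \<open>m / 2\<close> has all shorter cycles as well
  (\<open>weakly_pancyclic\<close>): vertices off a longest cycle have small degree and can be deleted, and a
  Hamiltonian graph with that many edges is pancyclic by Bondy's chord-counting argument.

  Few vertices go, and a graph \<open>S\<close> of minimum degree at least \<open>0.49 n\<close> remains.  If \<open>S\<close> falls apart
  after the removal of at most one vertex, it has two parts of order close to \<open>n / 2\<close>.  Either the
  larger one contains all the required cycles, by Dirac's and Bondy's theorems, or the sizes are
  those of the first kind of partition.  If \<open>S\<close> is bipartite, its number of edges forces balanced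
  sides, which is the second kind of partition.  In all other cases \<open>S\<close> contains all cycles up to
  length \<open>0.51 |S|\<close> by \<open>cycles_of_dense_two_connected\<close>.  For this, call two vertices related
  if they have a common neighbour.  If related vertices always had nearly the same neighbourhood, this would be an equivalence relation
  with at most two classes, and \<open>S\<close> would be disconnected or bipartite.  Hence some vertex \<open>x\<close> has
  two neighbours that together see so many vertices that a small reserved set provides, for every
  vertex \<open>p\<close>, a path of exactly three edges from \<open>p\<close> to \<open>x\<close>; closing the initial
  segments of one long path from \<open>x\<close> with these detours gives every cycle length.  The long path
  exists unless a small set of vertices disconnects \<open>S\<close>, and then \<open>S\<close> consists of
  two nearly complete halves joined by two disjoint edges, where cycles of every length can be
  built greedily.
\<close>

section \<open>Degrees, paths and cycles\<close>

definition nb :: "('a \<Rightarrow> 'a \<Rightarrow> bool) \<Rightarrow> 'a set \<Rightarrow> 'a \<Rightarrow> 'a set" where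
  "nb E S v = {u \<in> S. E v u}"

definition deg :: "('a \<Rightarrow> 'a \<Rightarrow> bool) \<Rightarrow> 'a set \<Rightarrow> 'a \<Rightarrow> nat" where
  "deg E S v = card (nb E S v)"

text \<open>Every edge is counted twice.\<close>
definition degsum :: "('a \<Rightarrow> 'a \<Rightarrow> bool) \<Rightarrow> 'a set \<Rightarrow> nat" where
  "degsum E S = (\<Sum>v\<in>S. deg E S v)"

definition is_path :: "('a \<Rightarrow> 'a \<Rightarrow> bool) \<Rightarrow> 'a set \<Rightarrow> 'a list \<Rightarrow> bool" where
  "is_path E S xs \<longleftrightarrow> xs \<noteq> [] \<and> distinct xs \<and> set xs \<subseteq> S \<and> successively E xs"

definition is_cycle :: "('a \<Rightarrow> 'a \<Rightarrow> bool) \<Rightarrow> 'a set \<Rightarrow> 'a list \<Rightarrow> bool" where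
  "is_cycle E S xs \<longleftrightarrow> 3 \<le> length xs \<and> is_path E S xs \<and> E (last xs) (hd xs)"

definition has_cycle :: "('a \<Rightarrow> 'a \<Rightarrow> bool) \<Rightarrow> 'a set \<Rightarrow> nat \<Rightarrow> bool" where
  "has_cycle E S t \<longleftrightarrow> (\<exists>xs. is_cycle E S xs \<and> length xs = t)"

definition separated :: "('a \<Rightarrow> 'a \<Rightarrow> bool) \<Rightarrow> 'a set \<Rightarrow> 'a set \<Rightarrow> bool" where
  "separated E A B \<longleftrightarrow> A \<inter> B = {} \<and> (\<forall>a\<in>A. \<forall>b\<in>B. \<not> E a b)"

definition conn :: "('a \<Rightarrow> 'a \<Rightarrow> bool) \<Rightarrow> 'a set \<Rightarrow> bool" where
  "conn E S \<longleftrightarrow> (\<forall>A B. A \<union> B = S \<longrightarrow> separated E A B \<longrightarrow> A = {} \<or> B = {})"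

definition twoconn :: "('a \<Rightarrow> 'a \<Rightarrow> bool) \<Rightarrow> 'a set \<Rightarrow> bool" where
  "twoconn E S \<longleftrightarrow> (\<forall>v\<in>S. conn E (S - {v}))"

lemma finite_nb [simp]: "finite S \<Longrightarrow> finite (nb E S v)"
  by (simp add: nb_def)

lemma nb_subset: "nb E S v \<subseteq> S"
  by (auto simp: nb_def)

lemma in_nb [simp]: "u \<in> nb E S v \<longleftrightarrow> u \<in> S \<and> E v u"
  by (auto simp: nb_def)

lemma deg_mono: "finite T \<Longrightarrow> S \<subseteq> T \<Longrightarrow> deg E S v \<le> deg E T v"
  unfolding deg_def by (intro card_mono) auto

lemma deg_disjoint_Un:
  "finite S \<Longrightarrow> finite T \<Longrightarrow> S \<inter> T = {} \<Longrightarrow> deg E (S \<union> T) v = deg E S v + deg E T v"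
proof -
  assume a: "finite S" "finite T" "S \<inter> T = {}"
  have "nb E (S \<union> T) v = nb E S v \<union> nb E T v" by auto
  moreover have "nb E S v \<inter> nb E T v = {}" using a by auto
  ultimately show ?thesis unfolding deg_def using a by (simp add: card_Un_disjoint)
qed

lemma deg_le_diff:
  assumes "finite V" "finite R"
  shows "deg E V v \<le> deg E (V - R) v + card R"
proof -
  have "nb E V v \<subseteq> nb E (V - R) v \<union> R" by auto
  then have "deg E V v \<le> card (nb E (V - R) v \<union> R)"
    unfolding deg_def using assms by (intro card_mono) auto
  also have "\<dots> \<le> deg E (V - R) v + card R" unfolding deg_def by (rule card_Un_le)
  finally show ?thesis .
qed

lemma deg_le_card: "finite S \<Longrightarrow> deg E S v \<le> card S"
  unfolding deg_def by (intro card_mono nb_subset)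

lemma is_path_single [simp]: "is_path E S [x] \<longleftrightarrow> x \<in> S"
  by (auto simp: is_path_def)

lemma is_path_mono: "is_path E S xs \<Longrightarrow> S \<subseteq> T \<Longrightarrow> is_path E T xs"
  by (auto simp: is_path_def)

lemma is_cycle_mono: "is_cycle E S xs \<Longrightarrow> S \<subseteq> T \<Longrightarrow> is_cycle E T xs"
  by (auto simp: is_cycle_def intro: is_path_mono)

lemma has_cycle_mono: "has_cycle E S t \<Longrightarrow> S \<subseteq> T \<Longrightarrow> has_cycle E T t"
  by (auto simp: has_cycle_def intro: is_cycle_mono)

lemma is_pathD:
  assumes "is_path E S xs"
  shows "xs \<noteq> []" "distinct xs" "set xs \<subseteq> S" "successively E xs"
    "hd xs \<in> S" "last xs \<in> S" "hd xs \<in> set xs" "last xs \<in> set xs"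
  using assms by (auto simp: is_path_def)

lemma is_path_append:
  assumes "is_path E S xs" "is_path E S ys" "E (last xs) (hd ys)" "set xs \<inter> set ys = {}"
  shows "is_path E S (xs @ ys)"
  using assms by (auto simp: is_path_def successively_append_iff)

lemma is_path_appendD1: "is_path E S (xs @ ys) \<Longrightarrow> xs \<noteq> [] \<Longrightarrow> is_path E S xs"
  by (auto simp: is_path_def successively_append_iff)

lemma is_path_appendD2: "is_path E S (xs @ ys) \<Longrightarrow> ys \<noteq> [] \<Longrightarrow> is_path E S ys"
  by (auto simp: is_path_def successively_append_iff)

lemma is_path_take: "is_path E S xs \<Longrightarrow> 0 < k \<Longrightarrow> is_path E S (take k xs)"
  using is_path_appendD1[of E S "take k xs" "drop k xs"] by (auto simp: is_path_def)

lemma is_path_drop: "is_path E S xs \<Longrightarrow> k < length xs \<Longrightarrow> is_path E S (drop k xs)"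
  using is_path_appendD2[of E S "take k xs" "drop k xs"] by auto

lemma last_take: "0 < k \<Longrightarrow> k \<le> length xs \<Longrightarrow> last (take k xs) = xs ! (k - 1)"
  by (subst last_conv_nth) (auto simp: min_def)

lemma is_path_nth: "is_path E S xs \<Longrightarrow> Suc i < length xs \<Longrightarrow> E (xs ! i) (xs ! Suc i)"
proof -
  assume a: "is_path E S xs" "Suc i < length xs"
  have "xs = take (Suc i) xs @ drop (Suc i) xs" by simp
  then have "successively E (take (Suc i) xs @ drop (Suc i) xs)" using a by (simp add: is_path_def)
  then have "E (last (take (Suc i) xs)) (hd (drop (Suc i) xs))"
    using a unfolding successively_append_iff by auto
  then show ?thesis using a by (simp add: last_take hd_drop_conv_nth)
qed

lemma is_path_card_le: "is_path E S xs \<Longrightarrow> finite S \<Longrightarrow> length xs \<le> card S"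
  by (metis card_mono distinct_card is_path_def)

lemma is_path_rotate:
  assumes "is_path E S xs" "E (last xs) (hd xs)"
  shows "is_path E S (rotate k xs) \<and> E (last (rotate k xs)) (hd (rotate k xs))"
proof -
  have one: "is_path E S (rotate1 ys) \<and> E (last (rotate1 ys)) (hd (rotate1 ys))"
    if "is_path E S ys" "E (last ys) (hd ys)" for ys
  proof (cases ys)
    case Nil then show ?thesis using that by (simp add: is_path_def)
  next
    case (Cons y zs)
    show ?thesis
    proof (cases zs)
      case Nil then show ?thesis using that Cons by simp
    next
      case (Cons z ws)
      then show ?thesis using that \<open>ys = y # zs\<close> successively_append_iff[of E "z # ws" "[y]"]
        by (auto simp: is_path_def)
    qed
  qed
  show ?thesis using assms by (induction k) (auto simp: one)
qed

lemma is_cycle_rotate: "is_cycle E S xs \<Longrightarrow> is_cycle E S (rotate k xs)"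
  unfolding is_cycle_def using is_path_rotate by auto

lemma path_slice:
  assumes "is_path E V P" "l \<le> a" "a < length P"
  shows "is_path E V (drop l (take (Suc a) P))" "hd (drop l (take (Suc a) P)) = P ! l"
    "last (drop l (take (Suc a) P)) = P ! a" "length (drop l (take (Suc a) P)) = Suc a - l"
    "set (drop l (take (Suc a) P)) = (!) P ` {l..a}"
proof -
  let ?Q = "drop l (take (Suc a) P)"
  show "is_path E V ?Q" using assms by (intro is_path_drop is_path_take) auto
  show "hd ?Q = P ! l" using assms by (simp add: hd_drop_conv_nth)
  show "last ?Q = P ! a" using assms by (simp add: last_take)
  show "length ?Q = Suc a - l" using assms by simp
  have "set ?Q = (\<lambda>k. ?Q ! k) ` {0..<length ?Q}" by (metis list.set_map map_nth set_upt)
  also have "\<dots> = (\<lambda>k. P ! (l + k)) ` {0..<Suc a - l}" using assms by (auto simp: min_def)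
  also have "\<dots> = (!) P ` ((+) l ` {0..<Suc a - l})" by (simp only: image_image)
  also have "(+) l ` {0..<Suc a - l} = {l..a}" using assms by (subst image_add_atLeastLessThan) auto
  finally show "set ?Q = (!) P ` {l..a}" .
qed

lemma ex_longest_list:
  assumes "P (xs0 :: 'a list)" "\<And>xs. P xs \<Longrightarrow> length xs \<le> N"
  shows "\<exists>xs. P xs \<and> (\<forall>ys. P ys \<longrightarrow> length ys \<le> length xs)"
  using ex_has_greatest_nat[of P xs0 length "Suc N"] assms le_imp_less_Suc by blast

lemma ex_longest_path:
  assumes "finite S" "v \<in> S"
  shows "\<exists>P. is_path E S P \<and> (\<forall>Q. is_path E S Q \<longrightarrow> length Q \<le> length P)"
  by (rule ex_longest_list[of _ "[v]" "card S"]) (use assms is_path_card_le in auto)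

lemma connD: "conn E S \<Longrightarrow> A \<union> B = S \<Longrightarrow> separated E A B \<Longrightarrow> A = {} \<or> B = {}"
  unfolding conn_def by (elim allE impE)

locale sgraph =
  fixes E :: "'a \<Rightarrow> 'a \<Rightarrow> bool"
  assumes sym: "E x y \<Longrightarrow> E y x" and irrefl: "\<not> E x x"
begin

lemma sym_iff: "E x y \<longleftrightarrow> E y x"
  using sym by blast

lemma is_path_rev: "is_path E S xs \<Longrightarrow> is_path E S (rev xs)"
  using sym by (auto simp: is_path_def successively_rev elim!: successively_mono)

lemma is_path_join:
  assumes "is_path E S xs" "is_path E S ys" "last xs = hd ys" "set xs \<inter> set ys = {hd ys}"
  shows "is_path E S (xs @ tl ys)" "last (xs @ tl ys) = last ys" "hd (xs @ tl ys) = hd xs"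
    "set (xs @ tl ys) = set xs \<union> set ys"
proof -
  obtain y zs where ys: "ys = y # zs" using assms by (cases ys) (auto simp: is_path_def)
  show "last (xs @ tl ys) = last ys" "hd (xs @ tl ys) = hd xs"
    using assms ys by (auto simp: is_path_def)
  show "set (xs @ tl ys) = set xs \<union> set ys" using assms(4) ys by auto
  show "is_path E S (xs @ tl ys)"
  proof (cases zs)
    case Nil then show ?thesis using ys assms by simp
  next
    case (Cons z ws)
    have "is_path E S zs" "E y z" "y \<notin> set zs" using assms(2) ys Cons by (auto simp: is_path_def)
    moreover from this have "set xs \<inter> set zs = {}"
      using assms(4) ys by auto
    ultimately have "is_path E S (xs @ zs)"
      using assms ys Cons by (intro is_path_append) auto
    then show ?thesis using ys by simp
  qed
qed

lemma is_cycle_glue: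
  assumes "is_path E S xs" "is_path E S ys" "hd xs = hd ys" "last xs = last ys"
    "set xs \<inter> set ys = {hd xs, last xs}" "3 \<le> length xs" "2 \<le> length ys"
  shows "has_cycle E S (length xs + length ys - 2)"
proof -
  define m where "m = tl (butlast ys)"
  obtain y zs where y1: "ys = y # zs" using assms by (cases ys) (auto simp: is_path_def)
  have "zs \<noteq> []" using assms y1 by auto
  then obtain ws z where y2: "zs = ws @ [z]" by (metis rev_exhaust)
  have m: "m = ws" using y1 y2 by (simp add: m_def)
  have ys: "ys = y # ws @ [z]" using y1 y2 by simp
  have hx: "hd xs = y" "last xs = z" using assms ys by auto
  have xs: "is_path E S xs" "xs \<noteq> []" using assms by (auto simp: is_path_def)
  show ?thesis
  proof (cases "ws = []")
    case True
    then have "E y z" using assms(2) ys by (auto simp: is_path_def)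
    then have "is_cycle E S xs" using assms hx sym by (auto simp: is_cycle_def)
    then show ?thesis using ys True by (auto simp: has_cycle_def)
  next
    case False
    have w: "is_path E S ws" "E y (hd ws)" "E (last ws) z" "y \<notin> set ws" "z \<notin> set ws"
      using assms(2) ys False by (auto simp: is_path_def successively_Cons successively_append_iff)
    have "set xs \<inter> set ws \<subseteq> {y, z}" using assms(5) ys hx by auto
    then have "set xs \<inter> set ws = {}" using w by auto
    then have "is_path E S (xs @ rev ws)"
      using xs w hx sym False by (intro is_path_append is_path_rev) (auto simp: hd_rev)
    moreover have "E (last (xs @ rev ws)) (hd (xs @ rev ws))"
      using w False hx xs sym by (auto simp: last_rev)
    ultimately have "is_cycle E S (xs @ rev ws)" using assms(6) by (auto simp: is_cycle_def)
    then show ?thesis using ys by (auto simp: has_cycle_def intro!: exI[of _ "xs @ rev ws"])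
  qed
qed

text \<open>The basic rotation: the final segment from position \<open>j\<close> on is traversed
  backwards after the edge from position \<open>i\<close> to the last vertex. Only the vertices strictly
  between \<open>i\<close> and \<open>j\<close> are lost.\<close>
lemma path_flip:
  assumes P: "is_path E S P" and ij: "i < j" "j < length P" and e: "E (last P) (P ! i)"
  shows "is_path E S (take (Suc i) P @ rev (drop j P))" "hd (take (Suc i) P @ rev (drop j P)) = hd P"
    "last (take (Suc i) P @ rev (drop j P)) = P ! j"
    "length (take (Suc i) P @ rev (drop j P)) = i + 1 + (length P - j)"
proof -
  have d: "distinct P" "P \<noteq> []" using P by (auto simp: is_path_def)
  show "is_path E S (take (Suc i) P @ rev (drop j P))"
  proof (rule is_path_append)
    show "is_path E S (take (Suc i) P)" using P by (intro is_path_take) auto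
    show "is_path E S (rev (drop j P))" using P ij by (intro is_path_rev is_path_drop) auto
    show "E (last (take (Suc i) P)) (hd (rev (drop j P)))"
      using ij sym[OF e] by (simp add: last_take hd_rev)
    show "set (take (Suc i) P) \<inter> set (rev (drop j P)) = {}"
      using d ij by (simp add: set_take_disj_set_drop_if_distinct)
  qed
  show "hd (take (Suc i) P @ rev (drop j P)) = hd P" using d by simp
  show "last (take (Suc i) P @ rev (drop j P)) = P ! j" using ij by (simp add: last_rev hd_drop_conv_nth)
  show "length (take (Suc i) P @ rev (drop j P)) = i + 1 + (length P - j)" using ij by simp
qed

lemma is_path_Cons: "is_path E V P \<Longrightarrow> z \<in> V \<Longrightarrow> z \<notin> set P \<Longrightarrow> E z (hd P) \<Longrightarrow> is_path E V (z # P)"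
  by (cases P) (auto simp: is_path_def)

lemma is_path_snoc: "is_path E V P \<Longrightarrow> z \<in> V \<Longrightarrow> z \<notin> set P \<Longrightarrow> E (last P) z \<Longrightarrow> is_path E V (P @ [z])"
  by (rule is_path_append) auto

lemma longest_path_end:
  assumes P: "is_path E S P" and longest: "\<And>Q. is_path E S Q \<Longrightarrow> length Q \<le> length P"
  shows "nb E S (hd P) \<subseteq> set P"
proof
  fix z assume z: "z \<in> nb E S (hd P)"
  show "z \<in> set P"
  proof (rule ccontr)
    assume "z \<notin> set P"
    then have "is_path E S (z # P)" using z P by (intro is_path_Cons) (auto intro: sym)
    then show False using longest[of "z # P"] by simp
  qed
qed

lemma separated_sym: "separated E A B \<Longrightarrow> separated E B A"
  using sym by (fastforce simp: separated_def)

lemma nb_self [simp]: "v \<notin> nb E S v"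
  using irrefl by auto

lemma deg_less_card: "finite S \<Longrightarrow> v \<in> S \<Longrightarrow> deg E S v < card S"
  unfolding deg_def using nb_subset[of E S v] nb_self[of v S] by (intro psubset_card_mono) auto

lemma deg_remove: "finite S \<Longrightarrow> w \<in> S \<Longrightarrow> deg E S v = deg E (S - {w}) v + (if E v w then 1 else 0)"
proof -
  assume a: "finite S" "w \<in> S"
  have "S = (S - {w}) \<union> {w}" using a by auto
  then have "deg E S v = deg E (S - {w}) v + deg E {w} v"
    using deg_disjoint_Un[of "S - {w}" "{w}" E v] a by auto
  moreover have "nb E {w} v = (if E v w then {w} else {})" by auto
  ultimately show ?thesis by (simp add: deg_def)
qed

lemma degsum_remove: "finite S \<Longrightarrow> w \<in> S \<Longrightarrow> degsum E S = degsum E (S - {w}) + 2 * deg E S w"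
proof -
  assume a: "finite S" "w \<in> S"
  have "degsum E S = deg E S w + (\<Sum>v\<in>S - {w}. deg E S v)"
    unfolding degsum_def using a by (simp add: sum.remove)
  also have "(\<Sum>v\<in>S - {w}. deg E S v) = degsum E (S - {w}) + (\<Sum>v\<in>S - {w}. if E v w then 1 else 0)"
    unfolding degsum_def using a by (simp add: deg_remove[of S w] sum.distrib)
  also have "(\<Sum>v\<in>S - {w}. if E v w then 1 else 0 :: nat) = card {v \<in> S - {w}. E v w}"
    using a by (simp add: sum.If_cases Int_def)
  also have "{v \<in> S - {w}. E v w} = nb E S w" using sym irrefl by auto
  finally show ?thesis by (simp add: deg_def)
qed

lemma degsum_le: "finite S \<Longrightarrow> degsum E S \<le> card S * (card S - 1)"
  unfolding degsum_def
  by (rule order.trans[OF sum_bounded_above[where K = "card S - 1"]])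
    (auto dest: deg_less_card simp: less_eq_Suc_le[symmetric] Suc_le_eq intro: Suc_leI)

lemma conn_sep: "\<not> conn E S \<Longrightarrow> \<exists>A B. A \<union> B = S \<and> separated E A B \<and> A \<noteq> {} \<and> B \<noteq> {}"
  by (auto simp: conn_def)

section \<open>Two disjoint paths alongside a given path\<close>

text \<open>The vertices that can be reached from \<open>U\<close> by a path that never returns to
  \<open>U\<close> and stops as soon as it meets \<open>W\<close> would be separated from the rest if no
  vertex of \<open>W\<close> were among them.\<close>
lemma conn_linking_path:
  assumes "conn E V" "U \<subseteq> V" "W \<subseteq> V" "U \<noteq> {}" "W \<noteq> {}" "U \<inter> W = {}"
  obtains z Q where "is_path E V (z # Q)" "Q \<noteq> []" "z \<in> U" "set Q \<inter> U = {}" "last Q \<in> W"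
    "set (butlast Q) \<inter> W = {}"
proof -
  define good where "good v z Q \<longleftrightarrow> is_path E V (z # Q) \<and> z \<in> U \<and> set Q \<inter> U = {} \<and> last (z # Q) = v
      \<and> set (butlast (z # Q)) \<inter> W = {}" for v z Q
  define T where "T = {v \<in> V. \<exists>z Q. good v z Q}"
  have UT: "U \<subseteq> T"
  proof
    fix u assume "u \<in> U"
    then have "good u u []" using assms by (auto simp: good_def)
    then show "u \<in> T" using \<open>u \<in> U\<close> assms by (auto simp: T_def)
  qed
  have "T \<inter> W \<noteq> {}"
  proof
    assume TW: "T \<inter> W = {}"
    have "\<not> E a b" if aT: "a \<in> T" and bT: "b \<in> V - T" for a b
    proof
      assume ab: "E a b"
      obtain z Q where g: "good a z Q" using aT unfolding T_def by blast
      have bU: "b \<notin> U" using UT bT by auto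
      show False
      proof (cases "b \<in> set (z # Q)")
        case True
        have "b \<noteq> z" using g bU by (auto simp: good_def)
        then have "b \<in> set Q" using True by simp
        then obtain pre post where Q: "Q = pre @ b # post" by (meson split_list)
        have p: "is_path E V ((z # pre @ [b]) @ post)" using g Q by (simp add: good_def)
        have "good b z (pre @ [b])"
          using g Q is_path_appendD1[OF p]
          by (auto simp: good_def butlast_append split: if_splits)
        then show False using bT by (auto simp: T_def)
      next
        case False
        have "a \<notin> W" using TW aT by auto
        have "is_path E V ((z # Q) @ [b])"
          using g False bT ab by (intro is_path_append) (auto simp: good_def)
        moreover have "set (z # Q) \<inter> W = {}"
        proof -
          have "z # Q = butlast (z # Q) @ [a]"
            using g by (metis append_butlast_last_id good_def list.distinct(1))
          then have "set (z # Q) = set (butlast (z # Q)) \<union> {a}"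
            by (metis list.set(1) list.simps(15) set_append)
          then show ?thesis using g \<open>a \<notin> W\<close> unfolding good_def by blast
        qed
        ultimately have "good b z (Q @ [b])"
          using g bU by (auto simp: good_def butlast_append)
        then show False using bT by (auto simp: T_def)
      qed
    qed
    then have "separated E T (V - T)" by (auto simp: separated_def)
    moreover have "T \<union> (V - T) = V" by (auto simp: T_def)
    ultimately have "T = {} \<or> V - T = {}" using assms(1) unfolding conn_def by blast
    then show False using UT TW assms by blast
  qed
  then obtain v z Q where v: "v \<in> W" "good v z Q" by (auto simp: T_def)
  then have Q: "Q \<noteq> []" using assms by (auto simp: good_def)
  show ?thesis
    by (rule that[of z Q]) (use v Q in \<open>auto simp: good_def split: if_splits\<close>)
qed

text \<open>An augmentation argument in the style of Menger's theorem. The two paths lead from the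
  initial segment up to position \<open>a\<close> to the final segment from position \<open>j\<close>
  on. It matters, and would not follow from Menger's theorem alone, that one of them starts exactly at
  \<open>P ! a\<close> and one ends exactly at \<open>P ! j\<close>: the cycle built in
  \<open>cycle_from_path_ends\<close> then covers all neighbours of both ends of \<open>P\<close>. When
  \<open>j\<close> grows by one, the path that ends at \<open>P ! j\<close> is extended along
  \<open>P\<close>. If the other path already ends at \<open>P ! Suc j\<close>, a path that avoids this
  vertex and leads beyond it is spliced into the last one of the old paths that it touches.\<close>
lemma two_disjoint_paths:
  assumes tc: "twoconn E V" and P: "is_path E V P"
    and ab: "1 \<le> a" "a \<le> j" "j + 1 < length P"
  shows "\<exists>X Y. is_path E V X \<and> is_path E V Y \<and> set X \<inter> set Y = {} \<and> P ! a \<in> {hd X, hd Y}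
    \<and> last X = P ! j \<and> last Y \<in> (!) P ` {j<..<length P}
    \<and> set X \<inter> (!) P ` {..a} = {hd X} \<and> set Y \<inter> (!) P ` {..a} = {hd Y}
    \<and> set X \<inter> (!) P ` {j..<length P} = {last X} \<and> set Y \<inter> (!) P ` {j..<length P} = {last Y}"
  using ab(2,3)
proof (induction j rule: dec_induct)
  case base
  let ?p = "length P"
  have inj: "P ! i = P ! k \<longleftrightarrow> i = k" if "i < ?p" "k < ?p" for i k
    using P that by (auto simp: is_path_def nth_eq_iff_index_eq)
  have PV: "P ! i \<in> V" if "i < ?p" for i using P that by (auto simp: is_path_def)
  define U where "U = (!) P ` {..<a}"
  define W where "W = (!) P ` {a<..<?p}"
  have "conn E (V - {P ! a})" using tc PV base by (auto simp: twoconn_def)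
  moreover have "U \<subseteq> V - {P ! a}" "W \<subseteq> V - {P ! a}" "U \<inter> W = {}"
    using base by (auto simp: U_def W_def inj PV)
  moreover have "P ! 0 \<in> U" "P ! Suc a \<in> W" using ab base by (auto simp: U_def W_def)
  then have "U \<noteq> {}" "W \<noteq> {}" by auto
  ultimately obtain z Q where Q: "is_path E (V - {P ! a}) (z # Q)" "Q \<noteq> []" "z \<in> U" "set Q \<inter> U = {}"
    "last Q \<in> W" "set (butlast Q) \<inter> W = {}"
    using conn_linking_path by metis
  have Pa: "P ! a \<notin> set (z # Q)" using Q(1) by (auto simp: is_path_def)
  have sQ: "set Q = set (butlast Q) \<union> {last Q}"
    using Q(2) by (metis append_butlast_last_id list.set(1) list.simps(15) set_append)
  have A: "(!) P ` {..a} = U \<union> {P ! a}"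
  proof -
    have "{..a} = insert a {..<a}" by auto
    then show ?thesis unfolding U_def by auto
  qed
  have B: "(!) P ` {a..<?p} = W \<union> {P ! a}"
  proof -
    have "{a..<?p} = insert a {a<..<?p}" using base by auto
    then show ?thesis unfolding W_def by auto
  qed
  have "is_path E V [P ! a]" "is_path E V (z # Q)"
    using Q PV base by (auto intro: is_path_mono)
  moreover have "set (z # Q) \<inter> (!) P ` {..a} = {z}"
    unfolding A using Q Pa by auto
  moreover have "set (z # Q) \<inter> (!) P ` {a..<?p} = {last Q}"
    unfolding B using Q(2-) Pa sQ \<open>U \<inter> W = {}\<close> by auto
  moreover have "{P ! a} \<inter> (!) P ` {..a} = {P ! a}" "{P ! a} \<inter> (!) P ` {a..<?p} = {P ! a}"
    using base by auto
  ultimately show ?case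
    using Q(2,5) Pa by (intro exI[of _ "[P ! a]"] exI[of _ "z # Q"]) (auto simp: W_def)
next
  case (step j)
  let ?p = "length P"
  have inj: "P ! i = P ! k \<longleftrightarrow> i = k" if "i < ?p" "k < ?p" for i k
    using P that by (auto simp: is_path_def nth_eq_iff_index_eq)
  have PV: "P ! i \<in> V" if "i < ?p" for i using P that by (auto simp: is_path_def)
  define A where "A = (!) P ` {..a}"
  define B where "B i = (!) P ` {i..<?p}" for i
  define inv where "inv i X Y \<longleftrightarrow> is_path E V X \<and> is_path E V Y \<and> set X \<inter> set Y = {} \<and>
    P ! a \<in> {hd X, hd Y} \<and> last X = P ! i \<and> last Y \<in> B (Suc i) \<and> set X \<inter> A = {hd X} \<and>
    set Y \<inter> A = {hd Y} \<and> set X \<inter> B i = {last X} \<and> set Y \<inter> B i = {last Y}" for i X Y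
  have BS: "(!) P ` {i<..<?p} = B (Suc i)" for i
    unfolding B_def by (simp add: atLeastSucLessThan_greaterThanLessThan)
  have "\<exists>X Y. inv j X Y" using step.IH step.prems unfolding inv_def BS[symmetric] A_def
    by (auto simp: B_def)
  then obtain X Y where XY: "inv j X Y" by blast
  have XP: "is_path E V X" "last X = P ! j" "set X \<inter> A = {hd X}" "set X \<inter> B j = {last X}"
    and YP: "is_path E V Y" "last Y \<in> B (Suc j)" "set Y \<inter> A = {hd Y}" "set Y \<inter> B j = {last Y}"
    and dis: "set X \<inter> set Y = {}" and heads: "P ! a \<in> {hd X, hd Y}"
    using XY unfolding inv_def by argo+
  have Bj: "B j = insert (P ! j) (B (Suc j))"
  proof -
    have "{j..<?p} = insert j {Suc j..<?p}" using step by auto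
    then show ?thesis unfolding B_def by simp
  qed
  have Bj1: "B (Suc j) = insert (P ! Suc j) (B (Suc (Suc j)))"
  proof -
    have "{Suc j..<?p} = insert (Suc j) {Suc (Suc j)..<?p}" using step by auto
    then show ?thesis unfolding B_def by simp
  qed
  have nj: "P ! j \<notin> B (Suc j)" "P ! Suc j \<notin> B (Suc (Suc j))"
    using step by (auto simp: B_def inj)
  have AB: "A \<inter> B (Suc j) = {}" using step by (auto simp: A_def B_def inj)
  have YB: "set Y \<inter> B (Suc j) = {last Y}"
  proof -
    have "set Y \<inter> B (Suc j) \<subseteq> {last Y}" using Bj unfolding YP(4)[symmetric] by blast
    moreover have "last Y \<in> set Y \<inter> B (Suc j)" using YP(1,2) unfolding is_path_def by simp
    ultimately show ?thesis by blast
  qed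
  have XB: "set X \<inter> B (Suc j) = {}"
  proof -
    have "set X \<inter> B (Suc j) \<subseteq> {P ! j}" using Bj XP(4) unfolding XP(2) by blast
    then show ?thesis using nj by blast
  qed
  have edge: "E (P ! j) (P ! Suc j)" using is_path_nth[OF P] step by simp
  have jV: "P ! Suc j \<in> V" using PV step by simp
  have extend: "is_path E V (Z @ [P ! Suc j]) \<and> hd (Z @ [P ! Suc j]) = hd Z
      \<and> set (Z @ [P ! Suc j]) \<inter> A = {hd Z} \<and> set (Z @ [P ! Suc j]) \<inter> B (Suc j) = {P ! Suc j}"
    if Z: "is_path E V Z" "last Z = P ! j" "set Z \<inter> A = {hd Z}" "set Z \<inter> B j = {P ! j}" for Z
  proof -
    have "P ! Suc j \<in> B (Suc j)" using Bj1 by auto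
    moreover have 1: "set Z \<inter> B (Suc j) = {}"
    proof (rule equals0I)
      fix x assume x: "x \<in> set Z \<inter> B (Suc j)"
      then have "x \<in> set Z \<inter> B j" using Bj by simp
      then have "x = P ! j" unfolding Z(4) by simp
      then show False using x nj by simp
    qed
    ultimately have "P ! Suc j \<notin> set Z" by auto
    then have "is_path E V (Z @ [P ! Suc j])"
      using Z edge jV by (intro is_path_append) auto
    moreover have "hd (Z @ [P ! Suc j]) = hd Z" using Z by (auto simp: is_path_def)
    moreover have "P ! Suc j \<notin> A" using AB Bj1 by auto
    ultimately show ?thesis using Z 1 Bj1 by auto
  qed
  have "\<exists>X Y. inv (Suc j) X Y"
  proof (cases "last Y = P ! Suc j")
    case False
    have "last Y \<in> B (Suc (Suc j))" using YP(2) False Bj1 by simp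
    moreover have "P ! Suc j \<notin> set Y"
    proof
      assume "P ! Suc j \<in> set Y"
      then have "P ! Suc j \<in> set Y \<inter> B (Suc j)" using Bj1 by simp
      then show False using False unfolding YB by simp
    qed
    ultimately have "inv (Suc j) (X @ [P ! Suc j]) Y"
      using XP YP dis heads YB extend[of X] unfolding inv_def by simp
    then show ?thesis by blast
  next
    case True
    define V' where "V' = V - {P ! Suc j}"
    define U where "U = (A \<union> set X \<union> set Y) - {P ! Suc j}"
    define W where "W = B (Suc (Suc j))"
    have YB1: "set Y \<inter> B (Suc j) = {P ! Suc j}" using YB True by simp
    have YB2: "set Y \<inter> B (Suc (Suc j)) = {}"
    proof -
      have "set Y \<inter> B (Suc (Suc j)) \<subseteq> {P ! Suc j}" using Bj1 unfolding YB1[symmetric] by blast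
      then show ?thesis using nj by blast
    qed
    have "conn E V'" using tc jV by (auto simp: twoconn_def V'_def)
    moreover have "U \<subseteq> V'"
      using XP(1) YP(1) step PV unfolding U_def V'_def A_def is_path_def by auto
    moreover have "W \<subseteq> V'" using nj step PV unfolding W_def V'_def by (auto simp: B_def inj)
    moreover have "U \<inter> W = {}" using AB XB YB2 Bj1 unfolding U_def W_def by blast
    moreover have "W \<noteq> {}" using step by (auto simp: W_def B_def)
    moreover have "U \<noteq> {}"
    proof -
      have "P ! a \<in> A" by (auto simp: A_def)
      moreover have "P ! a \<noteq> P ! Suc j" using step by (simp add: inj)
      ultimately show ?thesis by (auto simp: U_def)
    qed
    ultimately obtain z Q where Q: "is_path E V' (z # Q)" "Q \<noteq> []" "z \<in> U" "set Q \<inter> U = {}"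
      "last Q \<in> W" "set (butlast Q) \<inter> W = {}"
      using conn_linking_path by metis
    have Qj: "P ! Suc j \<notin> set (z # Q)" using Q(1) by (auto simp: is_path_def V'_def)
    have zQ: "is_path E V (z # Q)" using Q(1) by (auto simp: V'_def intro: is_path_mono)
    have Q': "is_path E V Q" "E z (hd Q)" "z \<notin> set Q"
      using zQ Q(2) by (auto simp: is_path_def successively_Cons)
    have sQ: "set Q = set (butlast Q) \<union> {last Q}"
      using Q(2) by (metis append_butlast_last_id list.set(1) list.simps(15) set_append)
    have QA: "set Q \<inter> A = {}" "set Q \<inter> set X = {}" "set Q \<inter> set Y = {}"
      using Q(4) Qj by (auto simp: U_def)
    have QB: "set Q \<inter> B (Suc j) = {last Q}"
    proof -
      have "set Q \<inter> B (Suc (Suc j)) = {last Q}" using Q(5,6) sQ unfolding W_def by blast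
      then show ?thesis using Qj Bj1 by auto
    qed
    have cut: "\<exists>Z'. is_path E V Z' \<and> hd Z' = hd Z \<and> last Z' = last Q \<and> set Z' \<subseteq> (set Z - {P ! Suc j}) \<union> set Q
         \<and> set Z' \<inter> A = {hd Z} \<and> set Z' \<inter> B (Suc j) = {last Q}"
      if Z: "is_path E V Z" "z \<in> set Z" "set Z \<inter> A = {hd Z}" "set Z \<inter> set Q = {}"
        "set Z \<inter> B (Suc j) = {} \<or> set Z \<inter> B (Suc j) = {P ! Suc j} \<and> last Z = P ! Suc j" for Z
    proof -
      obtain pre post where zz: "Z = pre @ z # post" using Z(2) by (meson split_list)
      have p: "is_path E V (pre @ [z])"
        using is_path_appendD1[of E V "pre @ [z]" post] Z(1) zz by simp
      have jn: "P ! Suc j \<notin> set (pre @ [z])"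
      proof
        assume in_pre: "P ! Suc j \<in> set (pre @ [z])"
        then have "P ! Suc j \<in> set Z" using zz by auto
        then have "last Z = P ! Suc j" using Z(5) Bj1 by auto
        moreover have "z \<noteq> P ! Suc j" using Qj by auto
        ultimately have "post \<noteq> []" "last post = P ! Suc j" using zz by (auto split: if_splits)
        then have "P ! Suc j \<in> set post" using last_in_set by metis
        then show False using in_pre Z(1) zz by (auto simp: is_path_def)
      qed
      have sub: "set (pre @ [z]) \<subseteq> set Z" using zz by auto
      have hd: "hd (pre @ [z]) = hd Z" using zz by (cases pre) auto
      have hdA: "hd Z \<in> A" using Z(3) by blast
      have hdin: "hd Z \<in> set (pre @ [z])" using hd by (metis hd_in_set snoc_eq_iff_butlast)
      show ?thesis
      proof (intro exI[of _ "(pre @ [z]) @ Q"] conjI)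
        show "is_path E V ((pre @ [z]) @ Q)"
          by (rule is_path_append[OF p Q'(1)]) (use Q' Z(4) zz in auto)
        show "hd ((pre @ [z]) @ Q) = hd Z" using hd by (cases pre) auto
        show "last ((pre @ [z]) @ Q) = last Q" using Q(2) by simp
        show "set ((pre @ [z]) @ Q) \<subseteq> set Z - {P ! Suc j} \<union> set Q" using sub jn by auto
        show "set ((pre @ [z]) @ Q) \<inter> A = {hd Z}"
          using sub Z(3) QA(1) hdin hdA unfolding set_append by blast
        have "set Z \<inter> B (Suc j) \<subseteq> {P ! Suc j}" using Z(5) by auto
        then have "set (pre @ [z]) \<inter> B (Suc j) = {}" using sub jn by blast
        then show "set ((pre @ [z]) @ Q) \<inter> B (Suc j) = {last Q}" using QB unfolding set_append by blast
      qed
    qed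
    have lastQ: "last Q \<in> B (Suc (Suc j))" using Q(5) by (simp add: W_def)
    (* The detour Q starts where it last leaves the two paths and the initial segment. *)
    consider "z \<in> set X" | "z \<in> set Y" | "z \<in> A" "z \<notin> set X" "z \<notin> set Y"
      using Q(3) by (auto simp: U_def)
    then show ?thesis
    proof cases
      case 1
      then obtain Z where Z: "is_path E V Z" "hd Z = hd X" "last Z = last Q"
        "set Z \<subseteq> (set X - {P ! Suc j}) \<union> set Q" "set Z \<inter> A = {hd X}" "set Z \<inter> B (Suc j) = {last Q}"
        using cut[of X] XP QA XB by (auto simp: Int_commute)
      have "set Y \<inter> set Z = {}" using Z(4) dis QA by blast
      then have "inv (Suc j) Y Z"
        using XP YP True Z YB1 lastQ heads unfolding inv_def by (simp add: disj_commute)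
      then show ?thesis by blast
    next
      case 2
      then obtain Z where Z: "is_path E V Z" "hd Z = hd Y" "last Z = last Q"
        "set Z \<subseteq> (set Y - {P ! Suc j}) \<union> set Q" "set Z \<inter> A = {hd Y}" "set Z \<inter> B (Suc j) = {last Q}"
        using cut[of Y] YP True QA YB1 by (auto simp: Int_commute)
      have "P ! Suc j \<notin> set Q" using Qj by simp
      then have "P ! Suc j \<notin> set Z" "set X \<inter> set Z = {}" using Z(4) dis QA by blast+
      then have "inv (Suc j) (X @ [P ! Suc j]) Z"
        using XP YP heads Z lastQ extend[of X] unfolding inv_def by simp
      then show ?thesis by blast
    next
      case 3
      have zQA: "set (z # Q) \<inter> A = {z}" using QA 3 by auto
      have "z \<notin> B (Suc j)" using AB 3 by auto
      then have zQB: "set (z # Q) \<inter> B (Suc j) = {last Q}" using QB by auto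
      show ?thesis
      proof (cases "hd Y = P ! a")
        case True
        have "inv (Suc j) Y (z # Q)"
          using YP \<open>last Y = P ! Suc j\<close> True zQ zQA zQB YB1 lastQ Q(2) 3 QA
          unfolding inv_def by (auto simp: Int_commute)
        then show ?thesis by blast
      next
        case False
        then have "hd X = P ! a" using heads by simp
        then have "inv (Suc j) (X @ [P ! Suc j]) (z # Q)"
          using XP zQ zQA zQB lastQ Q(2) 3 QA Qj extend[of X]
          unfolding inv_def by (simp add: Int_commute)
        then show ?thesis by blast
      qed
    qed
  qed
  then show ?case unfolding inv_def BS A_def B_def by blast
qed

end

section \<open>Long cycles from the ends of a path\<close>

lemma deg_eq_card_indices:
  assumes "distinct P"
  shows "deg E (set P) x = card {i. i < length P \<and> E x (P ! i)}"
proof -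
  have "nb E (set P) x = (!) P ` {i. i < length P \<and> E x (P ! i)}"
    by (auto simp: in_set_conv_nth)
  moreover have "inj_on ((!) P) {i. i < length P \<and> E x (P ! i)}"
    using assms by (auto simp: inj_on_def nth_eq_iff_index_eq)
  ultimately show ?thesis unfolding deg_def by (simp add: card_image)
qed

context sgraph
begin

text \<open>From position \<open>i\<close> walk back to the start of \<open>P\<close>, jump to its first
  neighbour beyond \<open>i\<close>, and continue to position \<open>a\<close>. The skipped vertices are
  no neighbours of the start.\<close>
lemma reroute_through_neighbours:
  assumes P: "is_path E V P" and ia: "i < a" "a < length P" and adj: "E (P ! 0) (P ! a)"
  shows "\<exists>Q. is_path E V Q \<and> hd Q = P ! i \<and> last Q = P ! a \<and> set Q \<subseteq> (!) P ` {..a} \<and>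
    insert (P ! 0) ((!) P ` {l. l \<le> a \<and> E (P ! 0) (P ! l)}) \<subseteq> set Q"
proof -
  have dP: "distinct P" "P \<noteq> []" using P by (auto simp: is_path_def)
  define l where "l = (LEAST l. i < l \<and> E (P ! 0) (P ! l))"
  have l: "i < l" "E (P ! 0) (P ! l)" and lmin: "\<And>k. i < k \<Longrightarrow> E (P ! 0) (P ! k) \<Longrightarrow> l \<le> k"
    using LeastI[of "\<lambda>l. i < l \<and> E (P ! 0) (P ! l)" a] ia adj
      Least_le[of "\<lambda>l. i < l \<and> E (P ! 0) (P ! l)"] unfolding l_def by auto
  have la: "l \<le> a" using lmin ia adj by simp
  define Q1 where "Q1 = rev (take (Suc i) P)"
  define Q2 where "Q2 = drop l (take (Suc a) P)"
  have Q1: "is_path E V Q1" "hd Q1 = P ! i" "last Q1 = P ! 0" "set Q1 = (!) P ` {..i}"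
  proof -
    show "is_path E V Q1" unfolding Q1_def by (intro is_path_rev is_path_take P) simp
    show "hd Q1 = P ! i" unfolding Q1_def using ia by (simp add: hd_rev last_take)
    show "last Q1 = P ! 0" unfolding Q1_def using ia dP by (simp add: last_rev hd_conv_nth)
    show "set Q1 = (!) P ` {..i}" unfolding Q1_def using ia
      by (simp add: nth_image[symmetric] lessThan_Suc_atMost atLeast0LessThan)
  qed
  have Q2: "is_path E V Q2" "hd Q2 = P ! l" "last Q2 = P ! a" "set Q2 = (!) P ` {l..a}"
    unfolding Q2_def by (rule path_slice[OF P la ia(2)])+
  have inj: "P ! k = P ! k' \<longleftrightarrow> k = k'" if "k < length P" "k' < length P" for k k'
    using dP that by (auto simp: nth_eq_iff_index_eq)
  have "set Q1 \<inter> set Q2 = {}" using Q1 Q2 l la ia by (auto simp: inj)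
  then have "is_path E V (Q1 @ Q2)" using Q1 Q2 l by (intro is_path_append) auto
  moreover have "hd (Q1 @ Q2) = P ! i" "last (Q1 @ Q2) = P ! a"
    using Q1 Q2 by (auto simp: is_path_def)
  moreover have "set (Q1 @ Q2) \<subseteq> (!) P ` {..a}" using Q1(4) Q2(4) ia by auto
  moreover have "insert (P ! 0) ((!) P ` {l. l \<le> a \<and> E (P ! 0) (P ! l)}) \<subseteq> set (Q1 @ Q2)"
  proof -
    have "P ! k \<in> set (Q1 @ Q2)" if "k \<le> a" "E (P ! 0) (P ! k)" for k
    proof (cases "k \<le> i")
      case True then show ?thesis using Q1(4) by auto
    next
      case False then show ?thesis using lmin[of k] that Q2(4) by auto
    qed
    moreover have "P ! 0 \<in> set (Q1 @ Q2)" using Q1(4) by auto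
    ultimately show ?thesis by auto
  qed
  ultimately show ?thesis by blast
qed

text \<open>A neighbour of the last vertex that precedes a neighbour of the first vertex gives a cycle
  that misses only the vertices between them. If the two are as close as possible, these missed vertices
  are neighbours of neither end, so the neighbours of one end and the predecessors of the neighbours of
  the other end are distinct and account for the length of the cycle.\<close>
lemma crossing_cycle:
  assumes P: "is_path E V P" "3 \<le> length P" and nadj: "\<not> E (hd P) (last P)"
    and cross: "E (last P) (P ! i0)" "E (hd P) (P ! j0)" "i0 < j0" "j0 < length P"
  shows "\<exists>t. has_cycle E V t \<and>
    (length P \<le> t \<or> deg E (set P) (hd P) + deg E (set P) (last P) \<le> t)"
proof -
  define p where "p = length P"
  define Ix where "Ix = {i. i < p \<and> E (hd P) (P ! i)}"
  define Iy where "Iy = {i. i < p \<and> E (last P) (P ! i)}"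
  have dP: "distinct P" "P \<noteq> []" using P by (auto simp: is_path_def)
  have hl: "hd P = P ! 0" "last P = P ! (p - 1)" using dP by (auto simp: hd_conv_nth last_conv_nth p_def)
  have Ixs: "Ix \<subseteq> {1..p-2}"
  proof
    fix l assume "l \<in> Ix"
    then have "l < p" "E (hd P) (P ! l)" by (auto simp: Ix_def)
    moreover from this have "l \<noteq> 0" "l \<noteq> p - 1" using nadj hl irrefl by metis+
    ultimately show "l \<in> {1..p-2}" by auto
  qed
  have Iys: "Iy \<subseteq> {1..p-2}"
  proof
    fix l assume "l \<in> Iy"
    then have "l < p" "E (last P) (P ! l)" by (auto simp: Iy_def)
    moreover from this have "l \<noteq> 0" "l \<noteq> p - 1" using nadj hl irrefl sym by metis+
    ultimately show "l \<in> {1..p-2}" by auto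
  qed
  define good where "good = (\<lambda>(i, j). i \<in> Iy \<and> j \<in> Ix \<and> i < j)"
  have "good (i0, j0)" using cross by (auto simp: good_def Ix_def Iy_def p_def)
  then obtain ij where ij: "good ij" "\<And>ij'. good ij' \<Longrightarrow> snd ij - fst ij \<le> snd ij' - fst ij'"
    using ex_has_least_nat[of good "(i0, j0)" "\<lambda>ij. snd ij - fst ij"] by blast
  obtain i j where "ij = (i, j)" by (cases ij)
  with ij have g: "i \<in> Iy" "j \<in> Ix" "i < j"
    and gmin: "\<And>i' j'. i' \<in> Iy \<Longrightarrow> j' \<in> Ix \<Longrightarrow> i' < j' \<Longrightarrow> j - i \<le> j' - i'"
    by (auto simp: good_def)
  define C where "C = take (Suc i) P @ rev (drop j P)"
  have jp: "j \<le> p - 2" "1 \<le> i" "j < p" using g Ixs Iys P by (auto simp: Ix_def)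
  have jl: "j < length P" "E (last P) (P ! i)" using jp g by (auto simp: p_def Iy_def)
  note C = path_flip[OF P(1) g(3) jl, folded C_def p_def]
  have "E (last C) (hd C)" using C(2,3) g(2) by (auto simp: Ix_def intro: sym)
  then have C: "has_cycle E V (i + 1 + (p - j))"
    using jp C(1,4) unfolding has_cycle_def is_cycle_def by (intro exI[of _ C]) auto
  show ?thesis
  proof (cases "j = Suc i")
    case True
    then show ?thesis using C jp by (auto simp: p_def)
  next
    case False
    define pre where "pre = (\<lambda>l. l - 1) ` Ix"
    have "inj_on (\<lambda>l. l - 1) Ix"
    proof (rule inj_onI)
      fix x y assume "x \<in> Ix" "y \<in> Ix" "x - 1 = y - 1"
      moreover from this have "1 \<le> x" "1 \<le> y" using Ixs by auto
      ultimately show "x = y" by simp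
    qed
    then have "card pre = card Ix" unfolding pre_def by (rule card_image)
    moreover have "pre \<inter> Iy = {}"
    proof (rule equals0I)
      fix q assume "q \<in> pre \<inter> Iy"
      then obtain l where "l \<in> Ix" "q = l - 1" "q \<in> Iy" by (auto simp: pre_def)
      then have "j - i \<le> l - (l - 1)" using gmin[of q l] Ixs by auto
      then show False using False g by auto
    qed
    moreover have "finite pre" "finite Iy" by (auto simp: pre_def Ix_def Iy_def)
    ultimately have "card Ix + card Iy = card (pre \<union> Iy)" by (simp add: card_Un_disjoint)
    also have "\<dots> \<le> card ({0..i} \<union> {j-1..p-2})"
    proof (rule card_mono)
      show "pre \<union> Iy \<subseteq> {0..i} \<union> {j-1..p-2}"
      proof
        fix q assume "q \<in> pre \<union> Iy"
        then consider l where "l \<in> Ix" "q = l - 1" | "q \<in> Iy" by (auto simp: pre_def)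
        then show "q \<in> {0..i} \<union> {j-1..p-2}"
        proof cases
          case 1
          have "l \<le> i \<or> j \<le> l" using gmin[of i l] g 1 by (cases "i < l") auto
          then show ?thesis using 1 subsetD[OF Ixs 1(1)] by auto
        next
          case 2
          have "q \<le> i \<or> j \<le> q" using gmin[of q j] g 2 by (cases "q < j") auto
          then show ?thesis using subsetD[OF Iys 2] by auto
        qed
      qed
    qed auto
    also have "\<dots> \<le> (i + 1) + (p - j)"
      by (rule order.trans[OF card_Un_le]) (use jp in auto)
    finally have "card Ix + card Iy \<le> i + 1 + (p - j)" by simp
    moreover have "deg E (set P) (hd P) = card Ix" "deg E (set P) (last P) = card Iy"
      using dP by (auto simp: deg_eq_card_indices Ix_def Iy_def p_def)
    ultimately show ?thesis using C by auto
  qed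
qed

text \<open>The lemma of Dirac, Posa and Kopylov. If no pair of neighbours crosses, all neighbours of
  the first vertex come before those of the last vertex. Two disjoint paths between these two regions
  are completed, inside each region, by a path through all the neighbours there.\<close>
lemma cycle_from_path_ends:
  assumes tc: "twoconn E V" and P: "is_path E V P" "3 \<le> length P" and nadj: "\<not> E (hd P) (last P)"
  shows "\<exists>t. has_cycle E V t \<and>
    (length P \<le> t \<or> deg E (set P) (hd P) + deg E (set P) (last P) \<le> t)"
proof (cases "\<exists>i j. E (last P) (P ! i) \<and> E (hd P) (P ! j) \<and> i < j \<and> j < length P")
  case True
  then show ?thesis using crossing_cycle[OF P nadj] by blast
next
  case False
  define p where "p = length P"
  define Ix where "Ix = {i. i < p \<and> E (hd P) (P ! i)}"
  define Iy where "Iy = {i. i < p \<and> E (last P) (P ! i)}"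
  have dP: "distinct P" "P \<noteq> []" using P by (auto simp: is_path_def)
  have hl: "hd P = P ! 0" "last P = P ! (p - 1)" using dP by (auto simp: hd_conv_nth last_conv_nth p_def)
  have inj: "P ! k = P ! k' \<longleftrightarrow> k = k'" if "k < p" "k' < p" for k k'
    using dP that by (auto simp: nth_eq_iff_index_eq p_def)
  have fin: "finite Ix" "finite Iy" by (auto simp: Ix_def Iy_def)
  have "E (P ! 0) (P ! 1)" using is_path_nth[OF P(1), of 0] P(2) by simp
  then have "1 \<in> Ix" using P(2) hl by (auto simp: Ix_def p_def)
  have "Suc (p - 2) = p - 1" using P(2) by (simp add: p_def)
  then have "E (P ! (p - 2)) (P ! (p - 1))" using is_path_nth[OF P(1), of "p - 2"] P(2) by (simp add: p_def)
  then have "p - 2 \<in> Iy" using P(2) hl sym by (auto simp: Iy_def p_def)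
  define a where "a = Max Ix"
  define b where "b = Min Iy"
  have ne: "Ix \<noteq> {}" "Iy \<noteq> {}" using \<open>1 \<in> Ix\<close> \<open>p - 2 \<in> Iy\<close> by auto
  have ab: "a \<in> Ix" "b \<in> Iy" "\<And>l. l \<in> Ix \<Longrightarrow> l \<le> a" "\<And>l. l \<in> Iy \<Longrightarrow> b \<le> l"
    unfolding a_def b_def by (simp_all add: fin ne)
  have a1: "1 \<le> a" using ab(3) \<open>1 \<in> Ix\<close> by blast
  have b2: "b \<le> p - 2" using ab(4) \<open>p - 2 \<in> Iy\<close> by blast
  have "a \<le> b"
  proof (rule ccontr)
    assume "\<not> a \<le> b"
    then have "b < a" "E (last P) (P ! b)" "E (hd P) (P ! a)" "a < length P"
      using ab(1,2) by (auto simp: Ix_def Iy_def p_def)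
    then show False using False by blast
  qed
  have p3: "3 \<le> p" using P by (simp add: p_def)
  define A where "A = (!) P ` {..a}"
  define B where "B = (!) P ` {b..<p}"
  have AB: "A \<inter> B \<subseteq> {P ! b}" "a < b \<Longrightarrow> A \<inter> B = {}"
    using \<open>a \<le> b\<close> b2 p3 by (auto simp: A_def B_def inj)
  obtain X Y where XP: "is_path E V X" "last X = P ! b" "set X \<inter> A = {hd X}" "set X \<inter> B = {last X}"
    and YP: "is_path E V Y" "last Y \<in> (!) P ` {b<..<p}" "set Y \<inter> A = {hd Y}" "set Y \<inter> B = {last Y}"
    and dis: "set X \<inter> set Y = {}" and heads: "P ! a \<in> {hd X, hd Y}"
  proof -
    have "b + 1 < length P" using b2 p3 by (simp add: p_def)
    from two_disjoint_paths[OF tc P(1) a1 \<open>a \<le> b\<close> this]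
    show ?thesis
      by (elim exE conjE) (rule that[unfolded A_def B_def p_def]; assumption)
  qed
  obtain j where j: "last Y = P ! j" "b < j" "j < p" using YP(2) by auto
  have bp: "b < p" using b2 p3 by simp
  have alpha: "\<exists>Q. is_path E V Q \<and> hd Q = P ! i \<and> last Q = P ! a \<and> set Q \<subseteq> A \<and>
      insert (hd P) ((!) P ` Ix) \<subseteq> set Q" if "i < a" for i
  proof -
    have "Ix = {l. l \<le> a \<and> E (P ! 0) (P ! l)}"
      using ab hl unfolding Ix_def by auto
    then show ?thesis
      using reroute_through_neighbours[OF P(1) that] ab(1) hl unfolding A_def
      by (auto simp: Ix_def p_def)
  qed
  (* The mirror image of alpha at the other end of the path. *)
  have beta: "\<exists>Q. is_path E V Q \<and> hd Q = P ! b \<and> last Q = P ! j \<and> set Q \<subseteq> B \<and>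
      insert (last P) ((!) P ` Iy) \<subseteq> set Q"
  proof -
    let ?P = "rev P"
    have rn: "?P ! l = P ! (p - 1 - l)" if "l < p" for l using that by (simp add: rev_nth p_def)
    have rP: "is_path E V ?P" using P(1) by (rule is_path_rev)
    have EP: "E (?P ! 0) (?P ! (p - 1 - b))" using ab(2) bp hl rn[of 0] rn[of "p - 1 - b"] p3
      by (auto simp: Iy_def)
    have "p - 1 - j < p - 1 - b" "p - 1 - b < length ?P" using j bp by (auto simp: p_def)
    note rer = reroute_through_neighbours[OF rP this EP]
    obtain Q where Q: "is_path E V Q" "hd Q = ?P ! (p - 1 - j)" "last Q = ?P ! (p - 1 - b)"
      "set Q \<subseteq> (!) ?P ` {..p - 1 - b}"
      "insert (?P ! 0) ((!) ?P ` {l. l \<le> p - 1 - b \<and> E (?P ! 0) (?P ! l)}) \<subseteq> set Q"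
      using rer by (elim exE conjE) (rule that; assumption)
    have "hd Q = P ! j" "last Q = P ! b" using Q j bp rn by auto
    moreover have "set Q \<subseteq> B"
    proof
      fix y assume "y \<in> set Q"
      then obtain l where "l \<le> p - 1 - b" "y = ?P ! l" using Q(4) by auto
      then have "y = P ! (p - 1 - l)" "p - 1 - l \<in> {b..<p}" using rn[of l] bp by auto
      then show "y \<in> B" by (auto simp: B_def)
    qed
    moreover have "insert (last P) ((!) P ` Iy) \<subseteq> set Q"
    proof -
      have "P ! l \<in> set Q" if "l \<in> Iy" for l
      proof -
        have l: "b \<le> l" "l < p" "E (last P) (P ! l)" using ab that by (auto simp: Iy_def)
        then have "P ! l = ?P ! (p - 1 - l)" using rn[of "p - 1 - l"] by auto
        then have "P ! l \<in> (!) ?P ` {l. l \<le> p - 1 - b \<and> E (?P ! 0) (?P ! l)}"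
          using l rn[of 0] hl by (intro image_eqI[of _ _ "p - 1 - l"]) auto
        then show ?thesis using Q(5) by auto
      qed
      moreover have "last P \<in> set Q" using Q(5) rn[of 0] hl p3 by auto
      ultimately show ?thesis by auto
    qed
    ultimately show ?thesis using is_path_rev[OF Q(1)] Q(1)
      by (intro exI[of _ "rev Q"]) (auto simp: hd_rev last_rev is_path_def)
  qed
  obtain be where be: "is_path E V be" "hd be = P ! b" "last be = P ! j" "set be \<subseteq> B"
    "insert (last P) ((!) P ` Iy) \<subseteq> set be" using beta by blast
  have enough: "deg E (set P) (hd P) + deg E (set P) (last P) + 1 \<le> length Q"
    if Q: "is_path E V Q" "insert (hd P) ((!) P ` Ix) \<subseteq> set Q" "insert (last P) ((!) P ` Iy) \<subseteq> set Q" for Q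
  proof -
    define S where "S = (!) P ` insert 0 Ix"
    define T where "T = (!) P ` insert (p - 1) Iy"
    have "0 \<notin> Ix" using hl irrefl by (auto simp: Ix_def)
    moreover have "p - 1 \<notin> Iy" using hl irrefl by (auto simp: Iy_def)
    moreover have "inj_on ((!) P) (insert 0 Ix)" "inj_on ((!) P) (insert (p - 1) Iy)"
      using p3 by (auto simp: inj_on_def Ix_def Iy_def inj)
    ultimately have "card S = card Ix + 1" "card T = card Iy + 1"
      using fin by (auto simp: S_def T_def card_image)
    moreover have "card (S \<inter> T) \<le> 1"
    proof -
      have "S \<subseteq> A" unfolding S_def A_def using ab(3) by (intro image_mono) auto
      moreover have "T \<subseteq> B" unfolding T_def B_def using ab(4) bp by (intro image_mono) (auto simp: Iy_def)
      ultimately have "S \<inter> T \<subseteq> {P ! b}" using AB by blast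
      then show ?thesis using card_mono[of "{P ! b}" "S \<inter> T"] by simp
    qed
    moreover have "card S + card T = card (S \<union> T) + card (S \<inter> T)"
      using fin by (intro card_Un_Int) (auto simp: S_def T_def)
    moreover have "card (S \<union> T) \<le> length Q"
    proof -
      have "S \<union> T \<subseteq> set Q" using Q(2,3) hl by (auto simp: S_def T_def)
      then have "card (S \<union> T) \<le> card (set Q)" by (intro card_mono) auto
      also have "\<dots> \<le> length Q" by (rule card_length)
      finally show ?thesis .
    qed
    moreover have "deg E (set P) (hd P) = card Ix" "deg E (set P) (last P) = card Iy"
      using dP by (auto simp: deg_eq_card_indices Ix_def Iy_def p_def)
    ultimately show ?thesis by linarith
  qed
  have pos: "2 \<le> deg E (set P) (hd P) + deg E (set P) (last P)"
  proof -
    have "card Ix \<noteq> 0" "card Iy \<noteq> 0" using fin ab by auto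
    moreover have "deg E (set P) (hd P) = card Ix" "deg E (set P) (last P) = card Iy"
      using dP by (auto simp: deg_eq_card_indices Ix_def Iy_def p_def)
    ultimately show ?thesis by linarith
  qed
  have close: ?thesis
    if Q: "is_path E V Q" "is_path E V Z" "hd Q = hd Z" "last Q = last Z"
      "set Q \<inter> set Z = {hd Q, last Q}" "hd Z \<noteq> last Z"
      "insert (hd P) ((!) P ` Ix) \<subseteq> set Q" "insert (last P) ((!) P ` Iy) \<subseteq> set Q" for Q Z
  proof -
    have "2 \<le> length Z" using Q(2,6) by (cases Z; cases "tl Z") (auto simp: is_path_def)
    moreover note e = enough[OF Q(1,7,8)]
    ultimately have "has_cycle E V (length Q + length Z - 2)"
      using is_cycle_glue[OF Q(1-5)] pos by linarith
    then show ?thesis using e \<open>2 \<le> length Z\<close> by (intro exI[of _ "length Q + length Z - 2"]) auto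
  qed
  (* Z is the path that starts at position a; it may be the one that ends at position b or the other one. *)
  have weave: ?thesis
    if Z: "is_path E V Z" "hd Z = P ! a" "set Z \<inter> A = {hd Z}" "set Z \<inter> B = {last Z}"
      and Z': "is_path E V Z'" "set Z' \<inter> A = {hd Z'}" "set Z' \<inter> B = {last Z'}"
      and dis: "set Z \<inter> set Z' = {}" and ne: "hd Z' \<noteq> last Z'"
      and b: "is_path E V bt" "set bt = set be" "hd bt = last Z" "last bt = last Z'"
      and AB: "A \<inter> B \<subseteq> {last Z}" for Z Z' bt
  proof -
    have "hd Z' \<noteq> hd Z" using dis is_pathD(7)[OF Z(1)] is_pathD(7)[OF Z'(1)] by auto
    moreover obtain i where i: "i \<le> a" "hd Z' = P ! i" using Z'(2) by (auto simp: A_def)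
    ultimately have "i < a" using Z(2) by (cases "i = a") auto
    then obtain al where al: "is_path E V al" "hd al = P ! i" "last al = P ! a" "set al \<subseteq> A"
      "insert (hd P) ((!) P ` Ix) \<subseteq> set al" using alpha by blast
    have mem: "P ! a \<in> set al" "P ! i \<in> set al" "last Z \<in> set Z" "last Z \<in> set bt"
      "last Z' \<in> set bt" "P ! i \<in> set Z'" "last Z' \<in> set Z'" "hd Z \<in> set Z"
      using al Z(1) Z'(1) b i is_pathD(7,8) by metis+
    have bB: "set bt \<subseteq> B" unfolding b(2) by (rule be(4))
    have "set al \<inter> set Z = {hd Z}"
    proof
      show "set al \<inter> set Z \<subseteq> {hd Z}" using al(4) Z(3) by blast
      show "{hd Z} \<subseteq> set al \<inter> set Z" using Z(2) mem by simp
    qed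
    note j1 = is_path_join[OF al(1) Z(1) al(3)[folded Z(2)] this]
    define Q where "Q = al @ tl Z"
    have Q: "is_path E V Q" "last Q = last Z" "hd Q = P ! i" "set Q = set al \<union> set Z"
      unfolding Q_def using j1 al(2) by (simp_all only:)
    have "set Q \<inter> set bt = {hd bt}"
    proof
      have "set al \<inter> set bt \<subseteq> {last Z}"
        using Int_mono[OF al(4) bB] AB by (rule order.trans)
      moreover have "set Z \<inter> set bt \<subseteq> {last Z}" using bB Z(4) by blast
      ultimately show "set Q \<inter> set bt \<subseteq> {hd bt}"
        unfolding Q(4) b(3) Int_Un_distrib2 by (rule Un_least)
      show "{hd bt} \<subseteq> set Q \<inter> set bt" using Q(4) mem b(3) by simp
    qed
    note j2 = is_path_join[OF Q(1) b(1) Q(2)[folded b(3)] this]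
    define W where "W = Q @ tl bt"
    have W: "is_path E V W" "last W = last Z'" "hd W = P ! i" "set W = set al \<union> set Z \<union> set bt"
      unfolding W_def using j2 Q b(4) by (simp_all only:)
    have "set W \<inter> set Z' = {P ! i, last Z'}"
    proof
      have "set al \<inter> set Z' \<subseteq> {P ! i}" using al(4) Z'(2) unfolding i(2) by blast
      moreover have "set bt \<inter> set Z' \<subseteq> {last Z'}" using bB Z'(3) by blast
      ultimately show "set W \<inter> set Z' \<subseteq> {P ! i, last Z'}"
        unfolding W(4) Int_Un_distrib2 dis by blast
      show "{P ! i, last Z'} \<subseteq> set W \<inter> set Z'" using W(4) mem by simp
    qed
    then show ?thesis
      using W Z'(1) i(2) ne al(5) be(5) b(2) by (intro close[of W Z']) (simp_all, blast+)
  qed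
  show ?thesis
  proof (cases "hd X = P ! a")
    case True
    have "hd Y \<noteq> last Y"
    proof
      assume "hd Y = last Y"
      then have "last Y \<in> A \<inter> B" using YP(3,4) by auto
      then have "P ! j = P ! b" using AB(1) j(1) by auto
      then show False using j bp by (simp add: inj)
    qed
    moreover have "A \<inter> B \<subseteq> {last X}" unfolding XP(2) by (rule AB(1))
    ultimately show ?thesis
      using be XP YP j by (intro weave[OF XP(1) True XP(3,4) YP(1,3,4) dis _ be(1) HOL.refl]) simp_all
  next
    case False
    then have hY: "hd Y = P ! a" using heads by simp
    have hX: "hd X \<noteq> P ! a" by (rule False)
    have "hd X \<in> A" using XP(3) by blast
    have "a < b"
    proof (rule ccontr)
      assume "\<not> a < b"
      then have "P ! b \<in> A" "P ! b = P ! a" using \<open>a \<le> b\<close> by (auto simp: A_def)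
      moreover have "P ! b \<in> set X" using XP(1,2) is_pathD(8) by metis
      ultimately have "P ! a \<in> set X \<inter> A" by simp
      then show False unfolding XP(3) using hX by simp
    qed
    then have AB0: "A \<inter> B = {}" using AB by simp
    have "hd X \<noteq> last X" using \<open>hd X \<in> A\<close> XP(4) AB0 by auto
    moreover have "hd (rev be) = P ! j" "last (rev be) = P ! b" "set (rev be) = set be"
      using be by (auto simp: hd_rev last_rev is_path_def)
    moreover have "set Y \<inter> set X = {}" using dis by blast
    ultimately show ?thesis
      using AB0 XP(2) j(1)
      by (intro weave[OF YP(1) hY YP(3,4) XP(1,3,4) _ _ is_path_rev[OF be(1)]]) simp_all
  qed
qed

end

section \<open>Kopylov's argument for edge-maximal 2-connected graphs\<close>

text \<open>The vertices that survive when vertices of degree less than \<open>d\<close> are removed as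
  long as possible; as a union of sets it needs no order of removal.\<close>
definition core :: "('a \<Rightarrow> 'a \<Rightarrow> bool) \<Rightarrow> 'a set \<Rightarrow> nat \<Rightarrow> 'a set" where
  "core E V d = \<Union>{S. S \<subseteq> V \<and> (\<forall>v\<in>S. d \<le> deg E S v)}"

text \<open>For \<open>c \<le> s\<close> this is twice the number of edges of two cliques of orders
  \<open>c\<close> and \<open>s - c + 1\<close> that share one vertex.\<close>
definition woodall :: "nat \<Rightarrow> nat \<Rightarrow> nat" where
  "woodall c s = (if s \<le> c then s * (s - 1) else c * (c - 1) + (s - c) * (s - c + 1))"

lemma core_subset: "core E V d \<subseteq> V"
  by (auto simp: core_def)

lemma core_greatest: "S \<subseteq> V \<Longrightarrow> (\<And>v. v \<in> S \<Longrightarrow> d \<le> deg E S v) \<Longrightarrow> S \<subseteq> core E V d"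
  by (auto simp: core_def)

lemma core_deg:
  assumes "finite V" "v \<in> core E V d"
  shows "d \<le> deg E (core E V d) v"
proof -
  obtain S where S: "S \<subseteq> V" "\<forall>v\<in>S. d \<le> deg E S v" "v \<in> S" using assms(2) by (auto simp: core_def)
  then have "S \<subseteq> core E V d" by (intro core_greatest) auto
  then have "deg E S v \<le> deg E (core E V d) v"
    using finite_subset[OF core_subset assms(1)] by (intro deg_mono) auto
  then show ?thesis using S by force
qed

context sgraph
begin

lemma low_degree_outside_core:
  assumes "core E V (Suc t) \<subseteq> S" "S \<subseteq> V" "S \<noteq> core E V (Suc t)" "finite V"
  shows "\<exists>v\<in>S - core E V (Suc t). deg E S v \<le> t"
proof (rule ccontr)
  let ?C = "core E V (Suc t)"
  assume a: "\<not> ?thesis"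
  have "Suc t \<le> deg E S v" if "v \<in> S" for v
  proof (cases "v \<in> ?C")
    case True
    have "finite S" using assms finite_subset by blast
    then show ?thesis using core_deg[OF assms(4) True] deg_mono[OF _ assms(1), of E v] by simp
  next
    case False
    then show ?thesis using a that by force
  qed
  then have "S \<subseteq> ?C" using assms by (intro core_greatest) auto
  then show False using assms by auto
qed

text \<open>Outside the core, vertices can be removed one by one, each with at most \<open>t\<close>
  edges.\<close>
lemma degsum_le_core:
  assumes "finite V"
  shows "degsum E V \<le> degsum E (core E V (Suc t)) + 2 * t * (card V - card (core E V (Suc t)))"
proof -
  let ?C = "core E V (Suc t)"
  have "degsum E S \<le> degsum E ?C + 2 * t * (card S - card ?C)" if "?C \<subseteq> S" "S \<subseteq> V" for S
    using that
  proof (induction "card S" arbitrary: S rule: less_induct)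
    case less
    have fS: "finite S" using less.prems assms finite_subset by blast
    show ?case
    proof (cases "S = ?C")
      case False
      then obtain v where v: "v \<in> S - ?C" "deg E S v \<le> t"
        using low_degree_outside_core less.prems assms by blast
      then have "card (S - {v}) < card S" using fS by (intro card_Diff1_less) auto
      moreover have "?C \<subseteq> S - {v}" "S - {v} \<subseteq> V" using v less.prems by auto
      ultimately have ih: "degsum E (S - {v}) \<le> degsum E ?C + 2 * t * (card (S - {v}) - card ?C)"
        by (rule less.hyps)
      have "card ?C \<le> card (S - {v})" using v less.prems fS by (intro card_mono) auto
      moreover have "card S = Suc (card (S - {v}))" using v fS by (metis DiffD1 card.remove)
      ultimately have "2 * t * (card S - card ?C) = 2 * t * (card (S - {v}) - card ?C) + 2 * t"
        by (simp add: Suc_diff_le)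
      then show ?thesis using ih v degsum_remove[OF fS, of v] by simp
    qed simp
  qed
  from this[OF core_subset order.refl] show ?thesis .
qed

text \<open>The last \<open>t\<close> vertices to be removed have fewer than \<open>t\<close> neighbours
  among each other, which saves the quadratic term.\<close>
lemma degsum_le_empty_core:
  assumes "finite V" "core E V (Suc t) = {}" "t \<le> card V"
  shows "degsum E V + t * (t + 1) \<le> 2 * t * card V"
proof -
  have "degsum E S + t * (t + 1) \<le> 2 * t * card S" if "t \<le> card S" "S \<subseteq> V" for S
    using that
  proof (induction "card S" arbitrary: S rule: less_induct)
    case less
    have fS: "finite S" using less.prems assms finite_subset by blast
    show ?case
    proof (cases "card S = t")
      case True
      have "degsum E S + t * (t + 1) \<le> t * (t - 1) + t * (t + 1)" using degsum_le[OF fS] True by simp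
      also have "\<dots> = 2 * t * t" by (cases t) (auto simp: algebra_simps)
      finally show ?thesis using True by simp
    next
      case False
      then have "S \<noteq> {}" using less.prems by auto
      then obtain v where v: "v \<in> S" "deg E S v \<le> t"
        using low_degree_outside_core[of V t S] less.prems assms by auto
      then have c: "card S = Suc (card (S - {v}))" using fS by (metis card.remove)
      have "degsum E (S - {v}) + t * (t + 1) \<le> 2 * t * card (S - {v})"
        using False less.prems c by (intro less.hyps) auto
      moreover have "2 * t * card S = 2 * t * card (S - {v}) + 2 * t"
        by (subst c) (simp only: mult_Suc_right add.commute)
      moreover have "degsum E S = degsum E (S - {v}) + 2 * deg E S v"
        using degsum_remove[OF fS v(1)] .
      ultimately show ?thesis using v(2) by linarith
    qed
  qed
  from this[OF assms(3) order.refl] show ?thesis .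
qed

text \<open>Take a longest path among those with non-adjacent ends, the first in \<open>S\<close> and
  the last in \<open>T\<close>. A neighbour in \<open>S\<close> of its first end that lies off the path
  would either extend it or close a cycle that is long enough; so all these neighbours lie on the path,
  and likewise at the other end. So \<open>cycle_from_path_ends\<close> applies with the degrees in
  \<open>S\<close> and \<open>T\<close>.\<close>
lemma long_cycle_from_cores:
  assumes fin: "finite V" and tc: "twoconn E V"
    and join: "\<And>x y. x \<in> V \<Longrightarrow> y \<in> V \<Longrightarrow> x \<noteq> y \<Longrightarrow> \<not> E x y \<Longrightarrow>
      \<exists>P. is_path E V P \<and> hd P = x \<and> last P = y \<and> c < length P"
    and c: "2 \<le> c"
    and S: "S \<subseteq> V" "\<And>v. v \<in> S \<Longrightarrow> d \<le> deg E S v"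
    and T: "T \<subseteq> V" "\<And>v. v \<in> T \<Longrightarrow> d' \<le> deg E T v"
    and xy: "x \<in> S" "y \<in> T" "x \<noteq> y" "\<not> E x y" and dd: "c < d + d'"
  shows "\<exists>t>c. has_cycle E V t"
proof (rule ccontr)
  assume none: "\<not> ?thesis"
  define good where "good P \<longleftrightarrow> is_path E V P \<and> hd P \<in> S \<and> last P \<in> T \<and> hd P \<noteq> last P \<and> \<not> E (hd P) (last P)" for P
  have "x \<in> V" "y \<in> V" using xy S T by auto
  then obtain P0 where P0: "is_path E V P0" "hd P0 = x" "last P0 = y" "c < length P0"
    using join xy by blast
  have "good P0" using P0 xy by (auto simp: good_def)
  moreover have "length P \<le> card V" if "good P" for P
    using that fin is_path_card_le by (auto simp: good_def)
  ultimately obtain P where P: "good P" and max: "\<And>Q. good Q \<Longrightarrow> length Q \<le> length P"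
    using ex_longest_list[of good P0 "card V"] by blast
  have lP: "c < length P" using max[OF \<open>good P0\<close>] P0 by simp
  have gP: "is_path E V P" "hd P \<in> S" "last P \<in> T" "hd P \<noteq> last P" "\<not> E (hd P) (last P)"
    using P by (auto simp: good_def)
  have PN: "P \<noteq> []" using gP by (auto simp: is_path_def)
  have closed: False if "is_path E V Q" "length Q = Suc (length P)" "E (last Q) (hd Q)" for Q
  proof -
    have "is_cycle E V Q" using that lP c by (simp add: is_cycle_def)
    then have "has_cycle E V (Suc (length P))" using that(2) unfolding has_cycle_def by blast
    then show False using none lP by auto
  qed
  have 1: "nb E S (hd P) \<subseteq> set P"
  proof
    fix z assume z: "z \<in> nb E S (hd P)"
    show "z \<in> set P"
    proof (rule ccontr)
      assume nz: "z \<notin> set P"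
      have p: "is_path E V (z # P)" using gP z nz S by (intro is_path_Cons) (auto intro: sym)
      have "\<not> good (z # P)" using max by fastforce
      then have "E z (last P)" using p gP z nz PN by (auto simp: good_def)
      then show False using closed[OF p] PN by (simp add: sym_iff)
    qed
  qed
  have 2: "nb E T (last P) \<subseteq> set P"
  proof
    fix z assume z: "z \<in> nb E T (last P)"
    show "z \<in> set P"
    proof (rule ccontr)
      assume nz: "z \<notin> set P"
      have p: "is_path E V (P @ [z])" using gP z nz T by (intro is_path_snoc) auto
      have "\<not> good (P @ [z])" using max by fastforce
      then have "E (hd P) z" using p gP z nz PN by (auto simp: good_def)
      then show False using closed[OF p] PN by (simp add: sym_iff)
    qed
  qed
  have "nb E S (hd P) \<subseteq> nb E (set P) (hd P)" "nb E T (last P) \<subseteq> nb E (set P) (last P)"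
    using 1 2 by auto
  then have "deg E S (hd P) \<le> deg E (set P) (hd P)" "deg E T (last P) \<le> deg E (set P) (last P)"
    unfolding deg_def by (auto intro!: card_mono)
  then have "c < deg E (set P) (hd P) + deg E (set P) (last P)" using S(2) T(2) gP dd by fastforce
  moreover have "3 \<le> length P" using lP c by simp
  ultimately show False using cycle_from_path_ends[OF tc gP(1) _ gP(5)] none lP
    by (meson less_le_trans)
qed

lemma clique_hamiltonian:
  assumes "finite H" "3 \<le> card H" "\<And>x y. x \<in> H \<Longrightarrow> y \<in> H \<Longrightarrow> x \<noteq> y \<Longrightarrow> E x y"
  shows "has_cycle E H (card H)"
proof -
  obtain xs where xs: "set xs = H" "distinct xs" using finite_distinct_list assms(1) by blast
  have l: "length xs = card H" using xs distinct_card by fastforce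
  have "successively E ys" if "set ys \<subseteq> H" "distinct ys" for ys
    using that by (induction ys rule: induct_list012) (auto intro: assms(3))
  then have "is_path E H xs" using xs l assms(2) by (auto simp: is_path_def)
  moreover have "last xs \<noteq> hd xs" using xs l assms(2)
    by (cases xs; cases "tl xs") (auto split: if_splits)
  then have "E (last xs) (hd xs)" using xs hd_in_set[of xs] last_in_set[of xs] \<open>is_path E H xs\<close>
    by (intro assms(3)) (auto simp: is_path_def)
  ultimately have "is_cycle E H xs" using l assms(2) by (simp add: is_cycle_def)
  then show ?thesis using l unfolding has_cycle_def by blast
qed

text \<open>Kopylov's count. The hypothesis on joining paths is edge-maximality. With \<open>t = c div
  2\<close>, the core \<open>H\<close> of degree \<open>t + 1\<close> is empty, which bounds the degree
  sum at once, or a clique of some order \<open>r\<close>, since two non-adjacent vertices of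
  \<open>H\<close> would give a cycle longer than \<open>c\<close>. For the same reason no vertex
  outside \<open>H\<close> survives in the larger core of degree \<open>c + 2 - r\<close>. So the edges
  are those of the clique and at most \<open>c + 1 - r\<close> for every other vertex.\<close>
lemma woodall_twoconn:
  assumes fin: "finite V" and tc: "twoconn E V"
    and join: "\<And>x y. x \<in> V \<Longrightarrow> y \<in> V \<Longrightarrow> x \<noteq> y \<Longrightarrow> \<not> E x y \<Longrightarrow>
      \<exists>P. is_path E V P \<and> hd P = x \<and> last P = y \<and> c < length P"
    and c: "2 \<le> c" "c < card V"
    and none: "\<And>t. has_cycle E V t \<Longrightarrow> t \<le> c"
  shows "degsum E V \<le> c * (c - 1) + (card V - c) * (card V - c + 1)"
proof -
  define t where "t = c div 2"
  define s where "s = card V"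
  define q where "q = s - c"
  define H where "H = core E V (Suc t)"
  have HV: "H \<subseteq> V" and fH: "finite H" 
    using core_subset[of E V "Suc t"] finite_subset[OF core_subset fin, of E "Suc t"]
    unfolding H_def by auto
  have ct: "c = 2 * t \<or> c = 2 * t + 1" "1 \<le> t" using c by (auto simp: t_def)
  have s: "s = c + q" "0 < q" using c by (auto simp: q_def s_def)
  have lc: False
    if "S \<subseteq> V" "\<And>v. v \<in> S \<Longrightarrow> d \<le> deg E S v" "T \<subseteq> V" "\<And>v. v \<in> T \<Longrightarrow> d' \<le> deg E T v"
      "x \<in> S" "y \<in> T" "x \<noteq> y" "\<not> E x y" "c < d + d'" for S T d d' x y
  proof -
    have "\<exists>t>c. has_cycle E V t"
      by (rule long_cycle_from_cores[OF fin tc _ c(1) that]) (rule join)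
    then show False using none by fastforce
  qed
  have goal: "int (degsum E V) \<le> int c * (int c - 1) + int q * (int q + 1) \<Longrightarrow> ?thesis"
  proof -
    assume "int (degsum E V) \<le> int c * (int c - 1) + int q * (int q + 1)"
    also have "int c - 1 = int (c - 1)" using c by simp
    also have "int c * int (c - 1) + int q * (int q + 1) = int (c * (c - 1) + q * (q + 1))"
      by (simp only: of_nat_add of_nat_mult of_nat_1)
    finally show ?thesis unfolding q_def s_def of_nat_le_iff .
  qed
  (* Both counts fall short of the bound by d * d - d up to nonnegative terms, with d an integer. *)
  have sq: "0 \<le> d * d - d" for d :: int
    by (cases "d \<le> 0") (auto intro: mult_nonpos_nonpos simp: mult_le_cancel_left1)
  show ?thesis
  proof (cases "H = {}")
    case True
    have "degsum E V + t * (t + 1) \<le> 2 * t * s"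
      using degsum_le_empty_core[OF fin, of t] True ct s c unfolding H_def s_def t_def by auto
    then have "int (degsum E V + t * (t + 1)) \<le> int (2 * t * s)" by (simp only: of_nat_le_iff)
    then have 1: "int (degsum E V) \<le> 2 * int t * (int c + int q) - int t * (int t + 1)"
      using s by (simp add: algebra_simps)
    show ?thesis
    proof (rule goal)
      show "int (degsum E V) \<le> int c * (int c - 1) + int q * (int q + 1)"
        using ct(1)
      proof
        assume "c = 2 * t"
        then have "int c = 2 * int t" by simp
        then show ?thesis using 1 sq[of "int t - int q"] by (simp add: algebra_simps)
      next
        assume "c = 2 * t + 1"
        then have "int c = 2 * int t + 1" by simp
        then show ?thesis using 1 sq[of "int t - int q"] by (simp add: algebra_simps)
      qed
    qed
  next
    case False
    have Hdeg: "Suc t \<le> deg E H v" if "v \<in> H" for v using core_deg[OF fin] that unfolding H_def by blast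
    have clique: "E x y" if "x \<in> H" "y \<in> H" "x \<noteq> y" for x y
    proof (rule ccontr)
      assume nxy: "\<not> E x y"
      show False
        by (rule lc[OF HV Hdeg HV Hdeg that nxy]) (use ct(1) in auto)
    qed
    define r where "r = card H"
    obtain v0 where "v0 \<in> H" using False by auto
    have "t + 2 \<le> r" using Hdeg[OF \<open>v0 \<in> H\<close>] deg_less_card[OF fH \<open>v0 \<in> H\<close>] by (simp add: r_def)
    then have "has_cycle E V r"
      using clique_hamiltonian[OF fH _ clique] ct HV unfolding r_def by (intro has_cycle_mono[OF _ HV]) auto
    then have "r \<le> c" by (rule none)
    have degH: "deg E H v = r - 1" if "v \<in> H" for v
    proof -
      have "E v u \<longleftrightarrow> u \<noteq> v" if "u \<in> H" for u using clique[OF \<open>v \<in> H\<close> that] irrefl by blast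
      then have "nb E H v = H - {v}" by auto
      then show ?thesis using that fH by (simp add: deg_def r_def)
    qed
    define H' where "H' = core E V (Suc (c + 1 - r))"
    have "H \<subseteq> H'" unfolding H'_def
    proof (rule core_greatest[OF HV])
      fix v assume "v \<in> H"
      then show "Suc (c + 1 - r) \<le> deg E H v" using Hdeg[of v] \<open>t + 2 \<le> r\<close> ct \<open>r \<le> c\<close> by auto
    qed
    have "H' = H"
    proof (rule ccontr)
      assume "H' \<noteq> H"
      then obtain x where x: "x \<in> H'" "x \<notin> H" using \<open>H \<subseteq> H'\<close> by auto
      have H'V: "H' \<subseteq> V" unfolding H'_def by (rule core_subset)
      have "\<exists>y\<in>H. \<not> E x y"
      proof (rule ccontr)
        assume "\<not> ?thesis"
        then have adj: "nb E (insert x H) x = H" using irrefl by auto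
        have "insert x H \<subseteq> H" unfolding H_def
        proof (rule core_greatest)
          show "insert x (core E V (Suc t)) \<subseteq> V" using x H'V HV by (auto simp: H_def)
          fix v assume v: "v \<in> insert x (core E V (Suc t))"
          show "Suc t \<le> deg E (insert x (core E V (Suc t))) v"
          proof (cases "v = x")
            case True
            then show ?thesis using adj \<open>t + 2 \<le> r\<close> by (simp add: deg_def H_def r_def)
          next
            case False
            then have "v \<in> H" using v by (simp add: H_def)
            then have "Suc t \<le> deg E H v" by (rule Hdeg)
            also have "\<dots> \<le> deg E (insert x H) v" using fH by (intro deg_mono) auto
            finally show ?thesis by (simp add: H_def)
          qed
        qed
        then show False using x by auto
      qed
      then obtain y where y: "y \<in> H" "\<not> E x y" by blast
      show False
      proof (rule lc[OF H'V _ HV _ x(1) y(1) _ y(2)])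
        show "Suc (c + 1 - r) \<le> deg E H' v" if "v \<in> H'" for v
          using core_deg[OF fin] that unfolding H'_def by blast
        show "r - 1 \<le> deg E H v" if "v \<in> H" for v using degH that by simp
        show "c < Suc (c + 1 - r) + (r - 1)" using \<open>r \<le> c\<close> \<open>t + 2 \<le> r\<close> by simp
        show "x \<noteq> y" using x y by auto
      qed
    qed
    define u where "u = c - r"
    have u: "c = r + u" using \<open>r \<le> c\<close> by (simp add: u_def)
    have "degsum E V \<le> degsum E H + 2 * (c + 1 - r) * (s - r)"
      using degsum_le_core[OF fin, of "c + 1 - r", folded H'_def, unfolded \<open>H' = H\<close>, folded r_def s_def] .
    also have "degsum E H \<le> r * (r - 1)" using degsum_le[OF fH] by (simp add: r_def)
    finally have "degsum E V \<le> r * (r - 1) + 2 * (u + 1) * (u + q)" using u s by simp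
    then have "int (degsum E V) \<le> int (r * (r - 1) + 2 * (u + 1) * (u + q))" by (simp only: of_nat_le_iff)
    moreover have "int (r - 1) = int r - 1" using \<open>t + 2 \<le> r\<close> by simp
    ultimately have 1: "int (degsum E V) \<le> int r * (int r - 1) + 2 * (int u + 1) * (int u + int q)"
      by (simp only: of_nat_add of_nat_mult of_nat_numeral of_nat_1)
    have "u + 3 \<le> r" using u ct \<open>t + 2 \<le> r\<close> by auto
    then have "int u * (int u + 3) \<le> int u * int r" by (intro mult_left_mono) auto
    then have 2: "int u * int u + 3 * int u \<le> int u * int r" by (simp add: algebra_simps)
    have "int c = int r + int u" using u by simp
    then show ?thesis using 1 2 sq[of "int q - int u"] by (intro goal) (simp add: algebra_simps)
  qed
qed

end

section \<open>Woodall's bound for graphs without long cycles\<close>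

text \<open>Two graphs that share one vertex and satisfy the bound satisfy it together; this is
  convexity of the square.\<close>
lemma woodall_superadditive:
  assumes "1 \<le> c"
  shows "woodall c (a + 1) + woodall c (b + 1) \<le> woodall c (a + b + 1)"
proof -
  have small: "woodall c (a + 1) = a * a + a" if "a < c" for a
    using that by (auto simp: woodall_def algebra_simps)
  have large: "woodall c (a + 1) = c * (c - 1) + p * p + p" if "a = p + (c - 1)" "1 \<le> p" for a p
    using that assms by (cases p) (auto simp: woodall_def algebra_simps)
  have sl: "woodall c (a + 1) + woodall c (b + 1) \<le> woodall c (a + b + 1)" if "c \<le> a" "b < c" for a b
  proof -
    define p where "p = a + 1 - c"
    have p: "a = p + (c - 1)" "a + b = (p + b) + (c - 1)" "1 \<le> p" using that assms by (auto simp: p_def)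
    show ?thesis unfolding small[OF that(2)] large[OF p(1,3)] using large[OF p(2)] p(3)
      by (simp add: algebra_simps)
  qed
  consider "a < c" "b < c" "a + b < c" | "a < c" "b < c" "c \<le> a + b" | "c \<le> a" "b < c" | "a < c" "c \<le> b"
    | "c \<le> a" "c \<le> b" by linarith
  then show ?thesis
  proof cases
    case 1
    then show ?thesis using small[of a] small[of b] small[of "a + b"] by (simp add: algebra_simps)
  next
    case 2
    (* The difference of the two sides is 2 * u * w. *)
    define u where "u = c - 1 - a"
    define w where "w = c - 1 - b"
    define z where "z = a + b + 1 - c"
    have z: "a = z + w" "b = z + u" "c = z + u + w + 1" "a + b = z + (c - 1)" "1 \<le> z"
      using 2 by (auto simp: u_def w_def z_def)
    show ?thesis unfolding small[OF 2(1)] small[OF 2(2)] large[OF z(4,5)]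
      unfolding z(1-3) by (simp add: algebra_simps)
  next
    case 3 then show ?thesis by (rule sl)
  next
    case 4 then show ?thesis using sl[of b a] by (simp add: add.commute)
  next
    case 5
    define p where "p = a + 1 - c"
    define q where "q = b + 1 - c"
    define d where "d = c - 1"
    have p: "a = p + (c - 1)" "b = q + (c - 1)" "a + b = (p + q + (c - 1)) + (c - 1)" "1 \<le> p" "1 \<le> q" "1 \<le> p + q + (c - 1)"
      "c = d + 1" using 5 assms by (auto simp: p_def q_def d_def)
    show ?thesis unfolding large[OF p(1,4)] large[OF p(2,5)] large[OF p(3,6)]
      unfolding p(7) by (simp add: algebra_simps)
  qed
qed

lemma woodall_eq: "c \<le> s \<Longrightarrow> woodall c s = c * (c - 1) + (s - c) * (s - c + 1)"
  by (auto simp: woodall_def)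

lemma successively_nthI: "(\<And>i. Suc i < length xs \<Longrightarrow> P (xs ! i) (xs ! Suc i)) \<Longrightarrow> successively P xs"
proof (induction xs rule: induct_list012)
  case (3 x y zs)
  have "P x y" using 3(3)[of 0] by simp
  moreover have "successively P (y # zs)" using 3(3)[of "Suc _"] by (intro 3(2)) auto
  ultimately show ?case by simp
qed auto

lemma rotate_hd_last:
  assumes "Suc i < length xs"
  shows "hd (rotate (Suc i) xs) = xs ! Suc i" "last (rotate (Suc i) xs) = xs ! i"
proof -
  have r: "rotate (Suc i) xs = drop (Suc i) xs @ take (Suc i) xs"
    using assms by (simp add: rotate_drop_take del: rotate_Suc)
  show "hd (rotate (Suc i) xs) = xs ! Suc i"
    unfolding r using assms by (simp add: hd_drop_conv_nth)
  have "take (Suc i) xs \<noteq> []" using assms by auto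
  then show "last (rotate (Suc i) xs) = xs ! i"
    unfolding r using assms by (simp add: last_take)
qed

context sgraph
begin

text \<open>Rotated so that the new edge closes it, the cycle is a path of \<open>E\<close> between the
  ends of this edge.\<close>
lemma cycle_through_new_edge:
  assumes cyc: "is_cycle F V xs" and F: "\<And>u v. F u v \<longleftrightarrow> E u v \<or> {u, v} = {x, y}"
    and no: "\<not> is_cycle E V xs"
  shows "\<exists>P. is_path E V P \<and> hd P = x \<and> last P = y \<and> length P = length xs"
proof -
  have "\<exists>ys. is_cycle F V ys \<and> length ys = length xs \<and> \<not> E (last ys) (hd ys)"
  proof (cases "E (last xs) (hd xs)")
    case False then show ?thesis using cyc by auto
  next
    case True
    then have "\<not> successively E xs" using cyc no by (auto simp: is_cycle_def is_path_def)
    then obtain i where i: "Suc i < length xs" "\<not> E (xs ! i) (xs ! Suc i)" using successively_nthI by blast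
    have "is_cycle F V (rotate (Suc i) xs)" using cyc by (rule is_cycle_rotate)
    moreover have "\<not> E (last (rotate (Suc i) xs)) (hd (rotate (Suc i) xs))"
      using i rotate_hd_last[OF i(1)] by simp
    ultimately show ?thesis by (metis length_rotate)
  qed
  then obtain ys where ys: "is_cycle F V ys" "length ys = length xs" "\<not> E (last ys) (hd ys)" by blast
  then have e: "{last ys, hd ys} = {x, y}" using F by (auto simp: is_cycle_def)
  have p: "is_path F V ys" "3 \<le> length ys" using ys by (auto simp: is_cycle_def)
  then have d: "distinct ys" "ys \<noteq> []" by (auto simp: is_path_def)
  have "E (ys ! i) (ys ! Suc i)" if "Suc i < length ys" for i
  proof (rule ccontr)
    assume n: "\<not> E (ys ! i) (ys ! Suc i)"
    have "{ys ! i, ys ! Suc i} = {ys ! (length ys - 1), ys ! 0}"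
      using is_path_nth[OF p(1) that] F n e d by (simp add: last_conv_nth hd_conv_nth)
    then show False using d that p(2) by (auto simp: doubleton_eq_iff nth_eq_iff_index_eq)
  qed
  then have "is_path E V ys" using p d successively_nthI[of ys E] by (auto simp: is_path_def)
  moreover from this have "is_path E V (rev ys)" by (rule is_path_rev)
  ultimately show ?thesis using e d ys(2)
    by (metis doubleton_eq_iff hd_rev last_rev length_rev)
qed

text \<open>Adding edges only makes the bound on the number of edges harder to satisfy, so it is enough
  to treat graphs in which every further edge creates a long cycle.\<close>
lemma edge_maximal_extension:
  assumes fin: "finite V" and none: "\<And>t. has_cycle E V t \<Longrightarrow> t \<le> c"
  obtains F where "sgraph F" "\<And>x y. E x y \<Longrightarrow> F x y" "\<And>t. has_cycle F V t \<Longrightarrow> t \<le> c"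
    "\<And>x y. x \<in> V \<Longrightarrow> y \<in> V \<Longrightarrow> x \<noteq> y \<Longrightarrow> \<not> F x y \<Longrightarrow>
      \<exists>P. is_path F V P \<and> hd P = x \<and> last P = y \<and> c < length P"
proof -
  define good where "good F \<longleftrightarrow> sgraph F \<and> (\<forall>x y. E x y \<longrightarrow> F x y) \<and> (\<forall>t. has_cycle F V t \<longrightarrow> t \<le> c)" for F
  have "good E" using none sgraph_axioms by (auto simp: good_def)
  moreover have "degsum F V < Suc (card V * (card V - 1))" if "good F" for F
    using sgraph.degsum_le[of F V] that fin by (auto simp: good_def less_Suc_eq_le)
  ultimately obtain F where F: "good F" and max: "\<And>F'. good F' \<Longrightarrow> degsum F' V \<le> degsum F V"
    using ex_has_greatest_nat[of good E "\<lambda>F. degsum F V"] by (metis (no_types, lifting))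
  interpret F: sgraph F using F by (simp add: good_def)
  show ?thesis
  proof (rule that[OF F.sgraph_axioms])
    show "E x y \<Longrightarrow> F x y" "has_cycle F V t \<Longrightarrow> t \<le> c" for x y t using F by (auto simp: good_def)
    fix x y assume xy: "x \<in> V" "y \<in> V" "x \<noteq> y" "\<not> F x y"
    define F' where "F' u v \<longleftrightarrow> F u v \<or> {u, v} = {x, y}" for u v
    have sg: "sgraph F'"
      using xy F.sym F.irrefl by unfold_locales (auto simp: F'_def doubleton_eq_iff)
    have "degsum F V < degsum F' V" unfolding degsum_def
    proof (rule sum_strict_mono_ex1[OF fin])
      show "\<forall>v\<in>V. deg F V v \<le> deg F' V v"
        unfolding deg_def using fin by (auto intro!: card_mono simp: F'_def)
      have "nb F V x \<subset> nb F' V x" using xy by (auto simp: F'_def)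
      then show "\<exists>v\<in>V. deg F V v < deg F' V v"
        unfolding deg_def using fin xy by (intro bexI[of _ x] psubset_card_mono) auto
    qed
    then have "\<not> good F'" using max by fastforce
    then obtain t where "has_cycle F' V t" "\<not> t \<le> c" using sg F by (auto simp: good_def F'_def)
    then obtain xs where xs: "is_cycle F' V xs" "c < length xs" by (auto simp: has_cycle_def)
    moreover have "\<not> is_cycle F V xs" using F xs by (auto simp: good_def has_cycle_def)
    ultimately have "\<exists>P. is_path F V P \<and> hd P = x \<and> last P = y \<and> length P = length xs"
      by (intro F.cycle_through_new_edge[OF _ F'_def])
    then show "\<exists>P. is_path F V P \<and> hd P = x \<and> last P = y \<and> c < length P" using xs by auto
  qed
qed

lemma conn_mono_edges: "conn E S \<Longrightarrow> (\<And>x y. E x y \<Longrightarrow> F x y) \<Longrightarrow> conn F S"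
proof -
  assume c: "conn E S" and EF: "\<And>x y. E x y \<Longrightarrow> F x y"
  have "separated E A B" if "separated F A B" for A B
    using that EF unfolding separated_def by metis
  then show "conn F S" using c unfolding conn_def by metis
qed

lemma degsum_at_cut_vertex:
  assumes fin: "finite V" and v: "v \<in> V" and AB: "A \<union> B = V - {v}" "separated E A B"
  shows "degsum E V = degsum E (insert v A) + degsum E (insert v B)"
proof -
  have d: "A \<inter> B = {}" "v \<notin> A" "v \<notin> B" and noE: "\<And>a b. a \<in> A \<Longrightarrow> b \<in> B \<Longrightarrow> \<not> E a b"
    using AB by (auto simp: separated_def)
  have "finite (A \<union> B)" unfolding AB(1) using fin by simp
  then have fAB: "finite A" "finite B" by simp_all
  have V: "V = insert v (A \<union> B)" using AB v by auto
  have nA: "nb E V a = nb E (insert v A) a" if "a \<in> A" for a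
    using that noE unfolding V by auto
  have nB: "nb E V b = nb E (insert v B) b" if "b \<in> B" for b
  proof -
    have "\<not> E b a" if "a \<in> A" for a using noE[OF that \<open>b \<in> B\<close>] sym by blast
    then show ?thesis using that unfolding V by auto
  qed
  have nv: "nb E V v = nb E (insert v A) v \<union> nb E (insert v B) v"
    using irrefl unfolding V by auto
  have "nb E (insert v A) v \<inter> nb E (insert v B) v = {}" using d irrefl by auto
  then have "deg E V v = deg E (insert v A) v + deg E (insert v B) v"
    unfolding deg_def nv using fAB by (intro card_Un_disjoint) auto
  moreover have "degsum E V = deg E V v + ((\<Sum>a\<in>A. deg E V a) + (\<Sum>b\<in>B. deg E V b))"
    unfolding degsum_def by (subst (1) V) (use fAB d in \<open>simp add: sum.union_disjoint\<close>)
  moreover have "(\<Sum>a\<in>A. deg E V a) = (\<Sum>a\<in>A. deg E (insert v A) a)"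
    unfolding deg_def by (intro sum.cong) (auto simp: nA simp del: in_nb)
  moreover have "(\<Sum>b\<in>B. deg E V b) = (\<Sum>b\<in>B. deg E (insert v B) b)"
    unfolding deg_def by (intro sum.cong) (auto simp: nB simp del: in_nb)
  ultimately show ?thesis unfolding degsum_def using fAB d by simp
qed

end

text \<open>A graph with a cut vertex is split there, which is harmless by superadditivity; a
  2-connected graph is first made edge-maximal.\<close>
theorem woodall_bound:
  assumes "sgraph E" "finite V" "2 \<le> c" "\<And>t. has_cycle E V t \<Longrightarrow> t \<le> c"
  shows "degsum E V \<le> woodall c (card V)"
  using assms(2,4)
proof (induction "card V" arbitrary: V rule: less_induct)
  case less
  interpret sgraph E by (rule assms(1))
  show ?case
  proof (cases "card V \<le> c")
    case True
    then show ?thesis using degsum_le[OF less.prems(1)] by (simp add: woodall_def)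
  next
    case False
    show ?thesis
    proof (cases "twoconn E V")
      case True
      obtain F where F: "sgraph F" "\<And>x y. E x y \<Longrightarrow> F x y" "\<And>t. has_cycle F V t \<Longrightarrow> t \<le> c"
        "\<And>x y. x \<in> V \<Longrightarrow> y \<in> V \<Longrightarrow> x \<noteq> y \<Longrightarrow> \<not> F x y \<Longrightarrow>
          \<exists>P. is_path F V P \<and> hd P = x \<and> last P = y \<and> c < length P"
        using edge_maximal_extension[OF less.prems] by metis
      have "twoconn F V" using True F(2) conn_mono_edges unfolding twoconn_def by blast
      then have "degsum F V \<le> c * (c - 1) + (card V - c) * (card V - c + 1)"
        using False F assms(3) less.prems(1) by (intro sgraph.woodall_twoconn) auto
      also have "\<dots> = woodall c (card V)" using False by (simp add: woodall_eq)
      finally have "degsum F V \<le> woodall c (card V)" .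
      moreover have "degsum E V \<le> degsum F V"
        unfolding degsum_def deg_def using less.prems(1) F(2) by (auto intro!: sum_mono card_mono)
      ultimately show ?thesis by simp
    next
      case False
      then obtain v where v: "v \<in> V" "\<not> conn E (V - {v})" by (auto simp: twoconn_def)
      from conn_sep[OF v(2)]
      obtain A B where AB: "A \<union> B = V - {v}" "separated E A B" "A \<noteq> {}" "B \<noteq> {}"
        by (elim exE conjE)
      have d: "A \<inter> B = {}" "v \<notin> A" "v \<notin> B" using AB by (auto simp: separated_def)
      have "finite (A \<union> B)" unfolding AB(1) using less.prems(1) by simp
      then have fAB: "finite A" "finite B" by simp_all
      have cA: "card (insert v A) = card A + 1" "card (insert v B) = card B + 1" using fAB d by auto
      have V: "V = insert v (A \<union> B)" using AB v by auto
      have cV: "card V = card A + card B + 1" unfolding V using fAB d by (simp add: card_Un_disjoint)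
      have pos: "0 < card A" "0 < card B" using fAB AB by (auto simp: card_gt_0_iff)
      have "degsum E (insert v A) \<le> woodall c (card A + 1)"
        unfolding cA[symmetric]
      proof (rule less.hyps)
        show "card (insert v A) < card V" using cA cV pos by linarith
        show "finite (insert v A)" using fAB by simp
        have "insert v A \<subseteq> V" unfolding V by auto
        then show "t \<le> c" if "has_cycle E (insert v A) t" for t
          using less.prems(2) has_cycle_mono[OF that] by simp
      qed
      moreover have "degsum E (insert v B) \<le> woodall c (card B + 1)"
        unfolding cA[symmetric]
      proof (rule less.hyps)
        show "card (insert v B) < card V" using cA cV pos by linarith
        show "finite (insert v B)" using fAB by simp
        have "insert v B \<subseteq> V" unfolding V by auto
        then show "t \<le> c" if "has_cycle E (insert v B) t" for t
          using less.prems(2) has_cycle_mono[OF that] by simp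
      qed
      moreover have "woodall c (card A + 1) + woodall c (card B + 1) \<le> woodall c (card V)"
        unfolding cV using assms(3) by (intro woodall_superadditive) simp
      ultimately show ?thesis
        using degsum_at_cut_vertex[OF less.prems(1) v(1) AB(1,2)] by simp
    qed
  qed
qed

section \<open>From a long cycle to all shorter cycles\<close>

context sgraph
begin

text \<open>Bondy's argument. A chord from the first vertex to position \<open>j\<close> and a chord
  from the last vertex to position \<open>f j\<close> complete the edge between the two vertices to a
  cycle of length \<open>t\<close>: it runs through the positions from \<open>j\<close> to \<open>f
  j\<close> if the first chord ends before the second, and through the two outer segments otherwise. If
  there is no such cycle, the two sets of chords are disjoint after this shift, and the two degrees sum
  to at most the length of the cycle.\<close>
lemma pancyclic_by_heavy_edge:
  assumes cyc: "is_cycle E V xs"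
    and heavy: "length xs < deg E (set xs) (hd xs) + deg E (set xs) (last xs)"
    and t: "3 \<le> t" "t \<le> length xs"
  shows "has_cycle E V t"
proof (rule ccontr)
  assume no: "\<not> has_cycle E V t"
  define c where "c = length xs"
  have p: "is_path E V xs" and c3: "3 \<le> c" and close: "E (last xs) (hd xs)"
    using cyc by (auto simp: is_cycle_def c_def)
  have d: "distinct xs" "xs \<noteq> []" using p by (auto simp: is_path_def)
  have hl: "hd xs = xs ! 0" "last xs = xs ! (c - 1)" using d by (auto simp: hd_conv_nth last_conv_nth c_def)
  have inj: "xs ! k = xs ! k' \<longleftrightarrow> k = k'" if "k < c" "k' < c" for k k'
    using d that by (auto simp: nth_eq_iff_index_eq c_def)
  have "t \<noteq> c" using no cyc by (auto simp: has_cycle_def c_def)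
  then have tc: "t < c" using t by (simp add: c_def)
  define N0 where "N0 = {j. j < c \<and> E (hd xs) (xs ! j)}"
  define N1 where "N1 = {j. j < c \<and> E (last xs) (xs ! j)}"
  have fin: "finite N0" "finite N1" by (auto simp: N0_def N1_def)
  (* The last position is left out: f would send it to t - 2, which is already the image of position 1. *)
  define M where "M = N0 - {c - 1}"
  define f where "f j = (if j + t \<le> c + 1 then j + t - 3 else j + t - c - 1)" for j
  have M: "1 \<le> j" "j \<le> c - 2" "E (hd xs) (xs ! j)" "j < c" if "j \<in> M" for j
  proof -
    have "j \<noteq> 0" using that irrefl hl by (auto simp: M_def N0_def intro: gr0I)
    then show "1 \<le> j" "j \<le> c - 2" "E (hd xs) (xs ! j)" "j < c" using that by (auto simp: M_def N0_def)
  qed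
  have "f j \<notin> N1" if "j \<in> M" for j
  proof
    assume f: "f j \<in> N1"
    show False
    proof (cases "j + t \<le> c + 1")
      case True
      define j' where "j' = j + t - 3"
      have j': "f j = j'" "j \<le> j'" "j' \<le> c - 2" "1 \<le> j'"
        using True t M[OF that] by (auto simp: f_def j'_def)
      then have j'c: "j' < c" using c3 by simp
      define Q where "Q = drop j (take (Suc j') xs)"
      have Q: "is_path E V Q" "hd Q = xs ! j" "last Q = xs ! j'" "length Q = Suc j' - j" "set Q = (!) xs ` {j..j'}"
        using path_slice[OF p j'(2)] j'c unfolding Q_def c_def by auto
      have "is_path E V (Q @ [last xs])"
      proof (rule is_path_snoc[OF Q(1)])
        show "last xs \<in> V" using p by (rule is_pathD)
        show "last xs \<notin> set Q" using Q(5) j' c3 by (auto simp: hl inj)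
        show "E (last Q) (last xs)" using f j' Q(3) sym by (auto simp: N1_def)
      qed
      then have "is_path E V (hd xs # Q @ [last xs])"
      proof (rule is_path_Cons)
        show "hd xs \<in> V" using p by (rule is_pathD)
        show "hd xs \<notin> set (Q @ [last xs])" using Q(5) j' c3 M(1)[OF that] by (auto simp: hl inj)
        show "E (hd xs) (hd (Q @ [last xs]))" using M(3)[OF that] Q(1,2) by (auto simp: is_path_def)
      qed
      moreover have "length (hd xs # Q @ [last xs]) = t" using Q(4) t by (simp add: j'_def)
      ultimately have "has_cycle E V t"
        using close t unfolding has_cycle_def is_cycle_def
        by (intro exI[of _ "hd xs # Q @ [last xs]"]) auto
      then show False using no by simp
    next
      case False
      define j' where "j' = j + t - c - 1"
      have j': "f j = j'" "j' < j" "j' < c" using False t tc M[OF that] by (auto simp: f_def j'_def)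
      define C where "C = take (Suc j') xs @ rev (drop j xs)"
      have jl: "j < length xs" "E (last xs) (xs ! j')" using f j' M(4)[OF that] by (auto simp: c_def N1_def)
      note C = path_flip[OF p j'(2) jl, folded C_def c_def]
      have "length C = t" unfolding C(4) using j' M(4)[OF that] False tc by (simp add: j'_def)
      moreover have "E (last C) (hd C)" using C(2,3) M(3)[OF that] by (auto intro: sym)
      ultimately show False using no t C(1) by (auto simp: has_cycle_def is_cycle_def)
    qed
  qed
  then have "f ` M \<inter> N1 = {}" by auto
  moreover have "inj_on f M"
  proof (rule inj_onI)
    fix x y assume "x \<in> M" "y \<in> M" "f x = f y"
    then show "x = y" using M(1,2)[of x] M(1,2)[of y] t tc c3 by (auto simp: f_def split: if_splits)
  qed
  then have "card (f ` M) = card M" by (rule card_image)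
  moreover have "finite M" using fin by (simp add: M_def)
  ultimately have "card M + card N1 = card (f ` M \<union> N1)" using fin by (simp add: card_Un_disjoint)
  also have "\<dots> \<le> card {0..<c - 1}"
  proof (rule card_mono)
    have "f j < c - 1" if "j \<in> M" for j
      using M(1,2)[OF that] t tc c3 by (auto simp: f_def)
    moreover have "j < c - 1" if "j \<in> N1" for j
    proof -
      have "j \<noteq> c - 1" using that irrefl hl by (auto simp: N1_def)
      then show ?thesis using that by (auto simp: N1_def)
    qed
    ultimately show "f ` M \<union> N1 \<subseteq> {0..<c - 1}" by auto
  qed simp
  finally have "card M + card N1 \<le> c - 1" by simp
  moreover have "card N0 \<le> card M + 1" unfolding M_def
    using fin card_Suc_Diff1[of N0 "c - 1"] by (cases "c - 1 \<in> N0") auto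
  moreover have "deg E (set xs) (hd xs) = card N0" "deg E (set xs) (last xs) = card N1"
    using d by (auto simp: deg_eq_card_indices N0_def N1_def c_def)
  ultimately show False using heavy c3 unfolding c_def by linarith
qed

text \<open>The degree sums of the edges of the cycle average to twice the average degree.\<close>
lemma heavy_edge_on_cycle:
  assumes cyc: "is_cycle E V xs" and dense: "length xs * length xs < 2 * degsum E (set xs)"
  shows "\<exists>k. length xs < deg E (set xs) (hd (rotate k xs)) + deg E (set xs) (last (rotate k xs))"
proof (rule ccontr)
  assume no: "\<not> ?thesis"
  define g where "g i = deg E (set xs) (xs ! i)" for i
  have d: "distinct xs" "xs \<noteq> []" using cyc by (auto simp: is_cycle_def is_path_def)
  obtain m where m: "length xs = Suc m" using d by (cases xs) auto
  have "g (Suc i) + g i \<le> Suc m" if "i < m" for i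
  proof -
    have "deg E (set xs) (hd (rotate (Suc i) xs)) + deg E (set xs) (last (rotate (Suc i) xs)) \<le> length xs"
      using no by (meson not_le)
    then show ?thesis using rotate_hd_last[of i xs] that m by (simp add: g_def)
  qed
  then have "(\<Sum>i<m. g (Suc i) + g i) \<le> (\<Sum>i<m. Suc m)" by (intro sum_mono) auto
  moreover have "g 0 + g m \<le> Suc m"
  proof -
    have "deg E (set xs) (hd (rotate 0 xs)) + deg E (set xs) (last (rotate 0 xs)) \<le> length xs"
      using no by (meson not_le)
    then show ?thesis using d m by (simp add: g_def hd_conv_nth last_conv_nth)
  qed
  moreover have "(\<Sum>i<Suc m. g i) = g 0 + (\<Sum>i<m. g (Suc i))" by (rule sum.lessThan_Suc_shift)
  moreover have "(\<Sum>i<Suc m. g i) = (\<Sum>i<m. g i) + g m" by simp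
  moreover have "degsum E (set xs) = (\<Sum>i<Suc m. g i)"
    unfolding degsum_def using d m by (simp add: sum.distinct_set_conv_list sum_list_sum_nth g_def atLeast0LessThan)
  ultimately have "2 * degsum E (set xs) \<le> Suc m * Suc m" by (simp add: sum.distrib)
  then show False using dense m by simp
qed

lemma pancyclic_if_hamiltonian_dense:
  assumes cyc: "is_cycle E V xs" and dense: "length xs * length xs < 2 * degsum E (set xs)"
    and t: "3 \<le> t" "t \<le> length xs"
  shows "has_cycle E V t"
proof -
  obtain k where k: "length xs < deg E (set xs) (hd (rotate k xs)) + deg E (set xs) (last (rotate k xs))"
    using heavy_edge_on_cycle[OF cyc dense] by blast
  show ?thesis
    by (rule pancyclic_by_heavy_edge[OF is_cycle_rotate[OF cyc, of k]]) (use k t in auto)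
qed

text \<open>Replacing the arc between positions \<open>j\<close> and \<open>i\<close> by the path must
  not lengthen the cycle. The index is taken modulo the length so that \<open>i\<close> may be the
  position after the last one.\<close>
lemma insert_path_into_cycle:
  assumes cyc: "is_cycle E V ys" and P: "is_path E (V - set ys) P"
    and ij: "j < i" "i \<le> length ys"
    and adj: "E (hd P) (ys ! j)" "E (last P) (ys ! (i mod length ys))"
    and longest: "\<And>t. has_cycle E V t \<Longrightarrow> t \<le> length ys"
  shows "j + 1 + length P \<le> i"
proof -
  have ys: "is_path E V ys" "3 \<le> length ys" "E (last ys) (hd ys)" using cyc by (auto simp: is_cycle_def)
  then have d: "distinct ys" "ys \<noteq> []" by (auto simp: is_path_def)
  have P': "is_path E V P" "set P \<inter> set ys = {}" "P \<noteq> []" using P by (auto simp: is_path_def)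
  define C0 where "C0 = take (Suc j) ys @ P"
  have C0: "is_path E V C0" unfolding C0_def
  proof (rule is_path_append)
    show "is_path E V (take (Suc j) ys)" using ys by (intro is_path_take) auto
    show "E (last (take (Suc j) ys)) (hd P)" using ij adj sym by (auto simp: last_take)
    show "set (take (Suc j) ys) \<inter> set P = {}" using P'(2) set_take_subset[of "Suc j" ys] by blast
  qed (rule P')
  have hd0: "hd C0 = hd ys" using d by (simp add: C0_def)
  have lC0: "length C0 = Suc j + length P" using ij by (simp add: C0_def)
  have P1: "1 \<le> length P" using P' by (cases P) auto
  have "has_cycle E V (length C0 + (length ys - i))" if l3: "3 \<le> length C0 + (length ys - i)"
  proof (cases "i = length ys")
    case True
    then have "E (last C0) (hd C0)" using adj(2) P' d hd0 by (simp add: C0_def hd_conv_nth)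
    then have "is_cycle E V C0" using True C0 l3 by (simp add: is_cycle_def)
    then show ?thesis unfolding has_cycle_def using True by (intro exI[of _ C0]) simp
  next
    case False
    then have i: "i < length ys" using ij by simp
    define D where "D = drop i ys"
    have D: "is_path E V D" "hd D = ys ! i" "last D = last ys" "length D = length ys - i" "1 \<le> length D"
      using ys(1) i by (auto simp: D_def hd_drop_conv_nth intro!: is_path_drop)
    have "is_path E V (C0 @ D)"
    proof (rule is_path_append[OF C0 D(1)])
      show "E (last C0) (hd D)" using adj(2) i P' D by (simp add: C0_def)
      have "set (take (Suc j) ys) \<inter> set D = {}"
        unfolding D_def using d ij by (intro set_take_disj_set_drop_if_distinct) auto
      moreover have "set P \<inter> set D = {}" using P'(2) set_drop_subset[of i ys] unfolding D_def by blast
      ultimately show "set C0 \<inter> set D = {}" unfolding C0_def by auto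
    qed
    moreover have "E (last (C0 @ D)) (hd (C0 @ D))"
      using D ys hd0 C0 by (auto simp: is_path_def)
    moreover have "3 \<le> length (C0 @ D)" using D(5) P1 lC0 by simp
    ultimately have "is_cycle E V (C0 @ D)" by (simp add: is_cycle_def)
    then show ?thesis unfolding has_cycle_def using D(4) by (intro exI[of _ "C0 @ D"]) simp
  qed
  then have "length C0 + (length ys - i) \<le> length ys" if "3 \<le> length C0 + (length ys - i)"
    using longest that by blast
  then show ?thesis using ij lC0 P1 ys(2) by linarith
qed

text \<open>On the cycle, the neighbours of the first vertex of \<open>P\<close> and their successors
  are disjoint. Between some neighbour of the first vertex and the next neighbour of the last vertex
  there is in addition an arc that the whole path \<open>P\<close> could replace; it is at least as long
  as \<open>P\<close> and, apart from its first vertex, not counted yet.\<close>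
lemma attachments_to_longest_cycle:
  assumes cyc: "is_cycle E V xs" and P: "is_path E (V - set xs) P"
    and A: "1 \<le> deg E (set xs) (hd P)" and B: "2 \<le> deg E (set xs) (last P)"
    and longest: "\<And>t. has_cycle E V t \<Longrightarrow> t \<le> length xs"
  shows "2 * deg E (set xs) (hd P) + length P \<le> length xs + 1"
proof -
  define c where "c = length xs"
  have c3: "3 \<le> c" using cyc by (simp add: is_cycle_def c_def)
  have "nb E (set xs) (hd P) \<noteq> {}" using A by (auto simp: deg_def)
  then obtain k where k: "k < c" "E (hd P) (xs ! k)" by (auto simp: in_set_conv_nth c_def)
  define ys where "ys = rotate k xs"
  have ys: "is_cycle E V ys" "set ys = set xs" "length ys = c"
    using is_cycle_rotate[OF cyc] by (auto simp: ys_def c_def)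
  have d: "distinct ys" using ys(1) by (auto simp: is_cycle_def is_path_def)
  have y0: "E (hd P) (ys ! 0)"
  proof -
    have "xs \<noteq> []" using c3 by (auto simp: c_def)
    then have "hd ys = xs ! k" using k by (simp add: ys_def hd_rotate_conv_nth c_def)
    moreover have "hd ys = ys ! 0" using \<open>xs \<noteq> []\<close> by (simp add: ys_def hd_conv_nth)
    ultimately show ?thesis using k by simp
  qed
  define IA where "IA = {l. l < c \<and> E (hd P) (ys ! l)}"
  define IB where "IB = {l. l < c \<and> E (last P) (ys ! l)}"
  have cA: "deg E (set xs) (hd P) = card IA" and cB: "deg E (set xs) (last P) = card IB"
    using d ys by (auto simp: deg_eq_card_indices IA_def IB_def ys(2)[symmetric])
  have fA: "finite IA" by (simp add: IA_def)
  have lg: "t \<le> length ys" if "has_cycle E V t" for t using longest[OF that] ys by (simp add: c_def)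
  have P': "is_path E (V - set ys) P" using P ys by simp
  have single: "is_path E (V - set ys) [hd P]" using P' by (auto dest: is_pathD)
  have gap1: "Suc l < c \<and> Suc l \<notin> IA" if "l \<in> IA" for l
  proof -
    have l: "l < c" "E (hd P) (ys ! l)" using that by (auto simp: IA_def)
    have nE: "\<not> E (hd P) (ys ! (Suc l mod length ys))"
    proof
      assume "E (hd P) (ys ! (Suc l mod length ys))"
      then have "l + 1 + length [hd P] \<le> Suc l"
        using l ys(3) by (intro insert_path_into_cycle[OF ys(1) single _ _ _ _ lg]) auto
      then show False by simp
    qed
    moreover have "Suc l \<noteq> c" using nE y0 ys(3) by auto
    ultimately show ?thesis using l ys(3) by (auto simp: IA_def)
  qed
  obtain i0 where i0: "i0 \<in> IB" "1 \<le> i0"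
  proof (rule ccontr)
    assume "\<not> thesis"
    then have "IB \<subseteq> {0}" using that by force
    then have "card IB \<le> 1" using card_mono[of "{0::nat}" IB] by simp
    then show False using B cB by simp
  qed
  define i where "i = (LEAST i. i \<in> IB \<and> 1 \<le> i)"
  have i: "i \<in> IB" "1 \<le> i" using LeastI[of "\<lambda>i. i \<in> IB \<and> 1 \<le> i" i0] i0 by (auto simp: i_def)
  (* From j to i the cycle passes from a neighbour of the first vertex of P to one of the last vertex. *)
  define J where "J = {l \<in> IA. l < i}"
  define j where "j = Max J"
  have "0 \<in> J" using y0 c3 i by (auto simp: IA_def J_def)
  then have J: "finite J" "J \<noteq> {}" using fA by (auto simp: J_def)
  have "j \<in> J" unfolding j_def using J by (rule Max_in)
  then have j: "j \<in> IA" "j < i" by (auto simp: J_def)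
  have jmax: "l \<le> j" if "l \<in> IA" "l < i" for l
    unfolding j_def by (rule Max_ge[OF J(1)]) (use that in \<open>simp add: J_def\<close>)
  have "j + 1 + length P \<le> i"
    using i j ys(3) by (intro insert_path_into_cycle[OF ys(1) P' _ _ _ _ lg]) (auto simp: IA_def IB_def)
  define G where "G = {j + 2..<i}"
  have "IA \<inter> Suc ` IA = {}" using gap1 by auto
  moreover have "(IA \<union> Suc ` IA) \<inter> G = {}"
  proof (rule equals0I)
    fix l assume l: "l \<in> (IA \<union> Suc ` IA) \<inter> G"
    then consider "l \<in> IA" | l' where "l = Suc l'" "l' \<in> IA" by auto
    then show False
    proof cases
      case 1 then show False using jmax[of l] l by (auto simp: G_def)
    next
      case 2 then show False using jmax[of l'] l by (auto simp: G_def)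
    qed
  qed
  ultimately have "card (IA \<union> Suc ` IA \<union> G) = card IA + card (Suc ` IA) + card G"
    using fA by (simp add: card_Un_disjoint G_def)
  also have "\<dots> = 2 * card IA + (i - (j + 2))" by (simp add: card_image G_def)
  finally have e: "card (IA \<union> Suc ` IA \<union> G) = 2 * card IA + (i - (j + 2))" .
  have "i < c" using i by (simp add: IB_def)
  then have "IA \<union> Suc ` IA \<union> G \<subseteq> {..<c}" using gap1 by (auto simp: IA_def G_def)
  then have "card (IA \<union> Suc ` IA \<union> G) \<le> card {..<c}" by (intro card_mono) auto
  then have "2 * card IA + (i - (j + 2)) \<le> c" using e by simp
  then show ?thesis using \<open>j + 1 + length P \<le> i\<close> cA by (simp add: c_def)
qed

lemma deg_path_end_outside:
  assumes P: "is_path E D P"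
    and longest: "\<And>Q. is_path E D Q \<Longrightarrow> length Q \<le> length P"
  shows "deg E D (hd P) \<le> length P - 1"
proof -
  have "nb E D (hd P) \<subseteq> set P - {hd P}" using longest_path_end[OF P longest] irrefl by auto
  then have "deg E D (hd P) \<le> card (set P - {hd P})" unfolding deg_def by (intro card_mono) auto
  also have "\<dots> = length P - 1" using P by (auto simp: is_path_def distinct_card)
  finally show ?thesis .
qed

text \<open>Apply the count of attachments to a longest path off the cycle. Neighbours of its ends lie
  on the path or on the cycle, so large degrees mean many attachments, more than the cycle has room
  for.\<close>
lemma low_degree_off_longest_cycle:
  assumes fin: "finite V" and cyc: "is_cycle E V xs"
    and longest: "\<And>t. has_cycle E V t \<Longrightarrow> t \<le> length xs"
    and half: "card V < 2 * length xs" and ne: "set xs \<noteq> V"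
  shows "\<exists>w\<in>V - set xs. 2 * deg E V w < card V"
proof (rule ccontr)
  assume no: "\<not> ?thesis"
  define D where "D = V - set xs"
  have xs: "set xs \<subseteq> V" "distinct xs" using cyc by (auto simp: is_cycle_def is_path_def)
  have fD: "finite D" using fin by (simp add: D_def)
  have cD: "card D + length xs = card V"
  proof -
    have "card (set xs) \<le> card V" using xs fin by (intro card_mono) auto
    then show ?thesis using xs by (simp add: D_def card_Diff_subset distinct_card)
  qed
  obtain w where w: "w \<in> D" using ne xs by (auto simp: D_def)
  obtain P where P: "is_path E D P" and lP: "\<And>Q. is_path E D Q \<Longrightarrow> length Q \<le> length P"
    using ex_longest_path[OF fD w, of E] by blast
  have many: "card V + 2 \<le> 2 * deg E (set xs) (hd R) + 2 * length R"
    if R: "is_path E D R" "length R = length P" for R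
  proof -
    have "hd R \<in> D" using R by (auto dest: is_pathD)
    then have "card V \<le> 2 * deg E V (hd R)" using no by (auto simp: D_def not_less)
    moreover have "V = set xs \<union> D" using xs by (auto simp: D_def)
    then have "deg E V (hd R) = deg E (set xs) (hd R) + deg E D (hd R)"
      using fD deg_disjoint_Un[of "set xs" D E "hd R"] by (auto simp: D_def)
    moreover have "deg E D (hd R) \<le> length R - 1"
      by (rule deg_path_end_outside[OF R(1)]) (use lP R in simp)
    moreover have "1 \<le> length R" using R by (cases R) (auto simp: is_path_def)
    ultimately show ?thesis by linarith
  qed
  have lD: "length P \<le> card D" using P fD by (rule is_path_card_le)
  have lr: "hd (rev P) = last P" using P by (auto simp: is_path_def hd_rev)
  have 1: "card V + 2 \<le> 2 * deg E (set xs) (hd P) + 2 * length P" using many[OF P] by simp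
  have 2: "card V + 2 \<le> 2 * deg E (set xs) (last P) + 2 * length P"
    using many[OF is_path_rev[OF P]] lr by simp
  have "2 * deg E (set xs) (hd P) + length P \<le> length xs + 1"
  proof (rule attachments_to_longest_cycle[OF cyc _ _ _ longest])
    show "is_path E (V - set xs) P" using P by (simp add: D_def)
    show "1 \<le> deg E (set xs) (hd P)" using 1 lD cD half by linarith
    show "2 \<le> deg E (set xs) (last P)" using 2 lD cD half by linarith
  qed
  then show False using 1 lD cD by linarith
qed

lemma ex_longest_cycle:
  assumes "finite V" "has_cycle E V c"
  obtains xs where "is_cycle E V xs" "c \<le> length xs" "\<And>t. has_cycle E V t \<Longrightarrow> t \<le> length xs"
proof -
  obtain xs0 where xs0: "is_cycle E V xs0" "length xs0 = c" using assms by (auto simp: has_cycle_def)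
  have "length xs \<le> card V" if "is_cycle E V xs" for xs
    using that is_path_card_le assms(1) by (auto simp: is_cycle_def)
  then obtain xs where xs: "is_cycle E V xs" "\<And>ys. is_cycle E V ys \<Longrightarrow> length ys \<le> length xs"
    using ex_longest_list[of "is_cycle E V", OF xs0(1)] by metis
  have "t \<le> length xs" if "has_cycle E V t" for t using that xs(2) by (auto simp: has_cycle_def)
  then show ?thesis using that[of xs] xs(1) xs(2)[OF xs0(1)] xs0(2) by simp
qed

text \<open>A vertex off a longest cycle with degree less than half the order can be deleted without
  losing the surplus of edges; in the end a longest cycle is spanning.\<close>
lemma weakly_pancyclic:
  assumes "finite V" "card V * card V < 2 * degsum E V" "has_cycle E V c" "card V < 2 * c" "3 \<le> t" "t \<le> c"
  shows "has_cycle E V t"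
  using assms
proof (induction "card V" arbitrary: V c rule: less_induct)
  case less
  obtain xs where xs: "is_cycle E V xs" "c \<le> length xs" and longest: "\<And>t. has_cycle E V t \<Longrightarrow> t \<le> length xs"
    using ex_longest_cycle[OF less.prems(1,3)] by blast
  have d: "distinct xs" "set xs \<subseteq> V" using xs by (auto simp: is_cycle_def is_path_def)
  show ?case
  proof (cases "set xs = V")
    case True
    then have "length xs = card V" using d distinct_card by fastforce
    then show ?thesis using pancyclic_if_hamiltonian_dense[OF xs(1)] True less.prems xs(2) by simp
  next
    case False
    then obtain w where w: "w \<in> V" "w \<notin> set xs" "2 * deg E V w < card V"
      using low_degree_off_longest_cycle[OF less.prems(1) xs(1) longest] less.prems(4) xs(2) by fastforce
    define U where "U = V - {w}"
    have cU: "card V = Suc (card U)" using w less.prems(1) unfolding U_def by (metis card.remove)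
    have "is_cycle E U xs" using xs(1) w d by (auto simp: is_cycle_def is_path_def U_def)
    then have "has_cycle E U (length xs)" by (auto simp: has_cycle_def)
    moreover have "card U * card U < 2 * degsum E U"
    proof -
      have "degsum E V = degsum E U + 2 * deg E V w"
        using degsum_remove[OF less.prems(1) w(1)] by (simp add: U_def)
      then have "Suc (card U) * Suc (card U) < 2 * degsum E U + 2 * (2 * deg E V w)"
        using less.prems(2) cU by simp
      moreover have "Suc (card U) * Suc (card U) = card U * card U + 2 * card U + 1" by simp
      ultimately show ?thesis using w(3) cU by linarith
    qed
    moreover have "t \<le> length xs" "card U < 2 * length xs" using less.prems xs(2) cU by auto
    moreover have "card U < card V" "finite U" using cU less.prems(1) by (auto simp: U_def)
    ultimately have "has_cycle E U t"
      using less.hyps[of U "length xs"] less.prems(5) by blast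
    then show ?thesis by (rule has_cycle_mono) (auto simp: U_def)
  qed
qed

text \<open>The end of a longest path has all its neighbours on the path.\<close>
lemma cycle_longer_than_degree:
  assumes fin: "finite V" and ne: "V \<noteq> {}" and d: "\<And>v. v \<in> V \<Longrightarrow> d \<le> deg E V v" "2 \<le> d"
  shows "\<exists>c>d. has_cycle E V c"
proof -
  obtain w where "w \<in> V" using ne by auto
  then obtain P where P: "is_path E V P" and lP: "\<And>Q. is_path E V Q \<Longrightarrow> length Q \<le> length P"
    using ex_longest_path[OF fin, of w E] by blast
  have dP: "distinct P" "P \<noteq> []" "hd P \<in> V" using P by (auto dest: is_pathD)
  define I where "I = {i. i < length P \<and> E (hd P) (P ! i)}"
  have "nb E V (hd P) \<subseteq> set P" using P lP by (rule longest_path_end)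
  then have "nb E V (hd P) \<subseteq> nb E (set P) (hd P)" by auto
  then have "deg E V (hd P) \<le> deg E (set P) (hd P)" unfolding deg_def by (intro card_mono) auto
  then have dI: "d \<le> card I" using d(1)[OF dP(3)] dP(1) by (simp add: deg_eq_card_indices I_def)
  have fI: "finite I" by (simp add: I_def)
  define m where "m = Max I"
  have "I \<noteq> {}" using dI d(2) by auto
  then have m: "m \<in> I" "\<And>i. i \<in> I \<Longrightarrow> i \<le> m" using fI by (auto simp: m_def)
  have "0 \<notin> I" using irrefl dP by (auto simp: I_def hd_conv_nth)
  then have "I \<subseteq> {1..m}" using m(2) by (force simp: Suc_le_eq intro: gr0I)
  then have "card I \<le> m" using card_mono[of "{1..m}" I] by simp
  then have dm: "d \<le> m" using dI by simp
  have ml: "m < length P" "E (hd P) (P ! m)" using m(1) by (auto simp: I_def)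
  have "is_path E V (take (Suc m) P)" using P by (intro is_path_take) auto
  moreover have "E (last (take (Suc m) P)) (hd (take (Suc m) P))"
    using ml dP sym by (simp add: last_take)
  moreover have "length (take (Suc m) P) = Suc m" using ml by simp
  ultimately have "has_cycle E V (Suc m)"
    using dm d(2) unfolding has_cycle_def is_cycle_def by (intro exI[of _ "take (Suc m) P"]) auto
  then show ?thesis using dm by (intro exI[of _ "Suc m"]) auto
qed

text \<open>Dirac's theorem in Bondy's pancyclic form; that a longest cycle is spanning comes from
  \<open>low_degree_off_longest_cycle\<close>.\<close>
lemma pancyclic_if_degree_above_half:
  assumes fin: "finite V" and d: "\<And>v. v \<in> V \<Longrightarrow> card V < 2 * deg E V v"
    and t: "3 \<le> t" "t \<le> card V"
  shows "has_cycle E V t"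
proof -
  have ne: "V \<noteq> {}" using t by auto
  define h where "h = card V div 2 + 1"
  have h: "h \<le> deg E V v" if "v \<in> V" for v using d[OF that] by (simp add: h_def)
  have "2 \<le> h" using t by (simp add: h_def)
  then obtain c where c: "h < c" "has_cycle E V c" using cycle_longer_than_degree[OF fin ne h] by auto
  obtain xs where xs: "is_cycle E V xs" "c \<le> length xs" and longest: "\<And>t. has_cycle E V t \<Longrightarrow> t \<le> length xs"
    using ex_longest_cycle[OF fin c(2)] by blast
  have half: "card V < 2 * length xs" using c(1) xs(2) by (simp add: h_def)
  have "set xs = V"
    using low_degree_off_longest_cycle[OF fin xs(1) longest half] d by fastforce
  then have "length xs = card V" using xs(1) distinct_card by (fastforce simp: is_cycle_def is_path_def)
  moreover have "card V * card V < 2 * degsum E V"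
  proof -
    have "card V * card V = (\<Sum>v\<in>V. card V)" by simp
    also have "\<dots> < (\<Sum>v\<in>V. 2 * deg E V v)" using fin ne d by (intro sum_strict_mono) auto
    also have "\<dots> = 2 * degsum E V" by (simp add: degsum_def sum_distrib_left)
    finally show ?thesis .
  qed
  ultimately show ?thesis using pancyclic_if_hamiltonian_dense[OF xs(1)] \<open>set xs = V\<close> t by simp
qed

end

section \<open>Hitting sets and spreading neighbourhoods\<close>

definition bipartite :: "('a \<Rightarrow> 'a \<Rightarrow> bool) \<Rightarrow> 'a set \<Rightarrow> bool" where
  "bipartite E V \<longleftrightarrow> (\<exists>X Y. X \<union> Y = V \<and> X \<inter> Y = {} \<and>
     (\<forall>u\<in>X. \<forall>v\<in>X. \<not> E u v) \<and> (\<forall>u\<in>Y. \<forall>v\<in>Y. \<not> E u v))"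

text \<open>Greedy choice: some vertex hits at least the average share \<open>a / card V\<close> of the
  sets that are not hit so far.\<close>
lemma hitting_set:
  assumes fin: "finite V" "finite F" and ne: "V \<noteq> {}"
    and S: "\<And>p. p \<in> F \<Longrightarrow> S p \<subseteq> V" "\<And>p. p \<in> F \<Longrightarrow> a \<le> card (S p)"
  shows "\<exists>R\<subseteq>V. card R \<le> h \<and>
    card {p \<in> F. S p \<inter> R = {}} * card V ^ h \<le> card F * (card V - a) ^ h"
proof (induction h)
  case 0
  show ?case by (intro exI[of _ "{}"]) simp
next
  case (Suc h)
  define n where "n = card V"
  obtain R where R: "R \<subseteq> V" "card R \<le> h"
    "card {p \<in> F. S p \<inter> R = {}} * n ^ h \<le> card F * (n - a) ^ h"
    using Suc.IH unfolding n_def by blast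
  define U where "U = {p \<in> F. S p \<inter> R = {}}"
  have fU: "finite U" using fin by (simp add: U_def)
  define cnt where "cnt v = card {p \<in> U. v \<in> S p}" for v
  have "(\<Sum>v\<in>V. cnt v) = (\<Sum>v\<in>V. \<Sum>p\<in>U. if v \<in> S p then 1 else 0)"
    unfolding cnt_def using fU by (intro sum.cong refl) (simp add: sum.If_cases Int_def)
  also have "\<dots> = (\<Sum>p\<in>U. \<Sum>v\<in>V. if v \<in> S p then 1 else 0)" by (rule sum.swap)
  also have "\<dots> = (\<Sum>p\<in>U. card (S p))"
  proof (rule sum.cong[OF refl])
    fix p assume "p \<in> U"
    then have "V \<inter> {v. v \<in> S p} = S p" using S(1) by (auto simp: U_def)
    then show "(\<Sum>v\<in>V. if v \<in> S p then 1 else 0) = card (S p)" using fin by (simp add: sum.If_cases)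
  qed
  also have "\<dots> \<ge> (\<Sum>p\<in>U. a)" using S(2) by (intro sum_mono) (simp add: U_def)
  finally have tot: "card U * a \<le> (\<Sum>v\<in>V. cnt v)" by simp
  have "\<exists>v\<in>V. card U * a \<le> n * cnt v"
  proof (rule ccontr)
    assume "\<not> ?thesis"
    then have "(\<Sum>v\<in>V. n * cnt v) < (\<Sum>v\<in>V. card U * a)"
      using fin ne by (intro sum_strict_mono) auto
    then have "n * (\<Sum>v\<in>V. cnt v) < n * (card U * a)" by (simp add: sum_distrib_left n_def)
    then show False using tot by simp
  qed
  then obtain v where v: "v \<in> V" "card U * a \<le> n * cnt v" by blast
  define U' where "U' = {p \<in> F. S p \<inter> insert v R = {}}"
  have "U = U' \<union> {p \<in> U. v \<in> S p}" "U' \<inter> {p \<in> U. v \<in> S p} = {}" by (auto simp: U_def U'_def)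
  then have "card U = card U' + cnt v"
    using fU fin unfolding cnt_def by (metis card_Un_disjoint finite_Un)
  then have "n * card U' + n * cnt v = n * card U" by (simp add: algebra_simps)
  then have "card U' * n \<le> n * card U - card U * a" using v(2) by (simp add: mult.commute)
  then have 1: "card U' * n \<le> card U * (n - a)" by (simp add: algebra_simps)
  have "card U' * n ^ Suc h = (card U' * n) * n ^ h" by simp
  also have "\<dots> \<le> (card U * (n - a)) * n ^ h" using 1 by (rule mult_right_mono) simp
  also have "\<dots> = (card U * n ^ h) * (n - a)" by simp
  also have "\<dots> \<le> (card F * (n - a) ^ h) * (n - a)" using R(3) unfolding U_def by (rule mult_right_mono) simp
  also have "\<dots> = card F * (n - a) ^ Suc h" by simp
  finally have "card U' * n ^ Suc h \<le> card F * (n - a) ^ Suc h" .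
  moreover have "card (insert v R) \<le> Suc h" using R(2) card_insert_le_m1[of "Suc h" R v] by simp
  ultimately show ?case using R v unfolding U'_def n_def by (intro exI[of _ "insert v R"]) auto
qed

lemma linear_less_power: "14 \<le> k \<Longrightarrow> 600 * (k + 1) < (2::nat) ^ k"
proof (induction k rule: dec_induct)
  case base show ?case by simp
next
  case (step k)
  then show ?case by simp
qed

text \<open>Since \<open>0.88\<^sup>6 < 1/2\<close>, six greedy choices at least halve the number of
  sets that are not hit.\<close>
lemma small_hitting_set:
  assumes fin: "finite V" and n: "100000 \<le> card V"
    and S: "\<And>p. p \<in> V \<Longrightarrow> S p \<subseteq> V" "\<And>p. p \<in> V \<Longrightarrow> 12 * card V \<le> 100 * card (S p)"
  shows "\<exists>R\<subseteq>V. 100 * card R \<le> card V \<and> (\<forall>p\<in>V. S p \<inter> R \<noteq> {})"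
proof -
  define n where "n = card V"
  (* Six choices for each of q halvings use at most one per cent of the vertices. *)
  define q where "q = n div 600"
  define a where "a = (12 * n + 99) div 100"
  have a: "12 * n \<le> 100 * a" "\<And>p. p \<in> V \<Longrightarrow> a \<le> card (S p)"
    using S(2) unfolding a_def n_def by (auto, fastforce)
  have ne: "V \<noteq> {}" using n by auto
  have "\<exists>R\<subseteq>V. card R \<le> 6 * q \<and>
      card {p \<in> V. S p \<inter> R = {}} * n ^ (6 * q) \<le> n * (n - a) ^ (6 * q)"
    unfolding n_def by (rule hitting_set[OF fin fin ne S(1) a(2)])
  then obtain R where R: "R \<subseteq> V" "card R \<le> 6 * q"
    "card {p \<in> V. S p \<inter> R = {}} * n ^ (6 * q) \<le> n * (n - a) ^ (6 * q)" by (elim exE conjE)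
  have q: "166 \<le> q" "n < 600 * (q + 1)" using n unfolding q_def n_def by auto
  have "n < 2 ^ q" using q linear_less_power[of q] by simp
  have "100 * (n - a) \<le> 88 * n" using a(1) by linarith
  then have "(100 * (n - a)) ^ 6 \<le> (88 * n) ^ 6" by (rule power_mono) simp
  then have "2 * (100 ^ 6 * (n - a) ^ 6) \<le> 2 * (88 ^ 6 * n ^ 6)" 
    unfolding power_mult_distrib by (rule mult_left_mono) simp
  also have "\<dots> \<le> 100 ^ 6 * n ^ 6" by simp
  finally have "2 * (n - a) ^ 6 \<le> n ^ 6" by simp
  then have "(2 * (n - a) ^ 6) ^ q \<le> (n ^ 6) ^ q" by (rule power_mono) simp
  then have p: "2 ^ q * (n - a) ^ (6 * q) \<le> n ^ (6 * q)" by (simp add: power_mult power_mult_distrib)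
  have npos: "0 < n ^ (6 * q)" using n by (simp add: n_def)
  have lt: "n * (n - a) ^ (6 * q) < n ^ (6 * q)"
  proof (cases "(n - a) ^ (6 * q) = 0")
    case True then show ?thesis using npos by (metis mult_0_right)
  next
    case False
    then have "0 < (n - a) ^ (6 * q)" by (simp only: neq0_conv)
    then have "n * (n - a) ^ (6 * q) < 2 ^ q * (n - a) ^ (6 * q)"
      by (rule mult_strict_right_mono[OF \<open>n < 2 ^ q\<close>])
    from this p show ?thesis by (rule less_le_trans)
  qed
  have "card {p \<in> V. S p \<inter> R = {}} * n ^ (6 * q) < 1 * n ^ (6 * q)"
    using le_less_trans[OF R(3) lt] by (simp only: mult_1)
  then have "card {p \<in> V. S p \<inter> R = {}} < 1" by (simp only: mult_less_cancel2)
  then have "{p \<in> V. S p \<inter> R = {}} = {}" using fin by simp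
  moreover have "100 * card R \<le> n" using R(2) unfolding q_def by linarith
  ultimately show ?thesis using R(1) unfolding n_def by blast
qed

context sgraph
begin

lemma sum_deg_swap:
  assumes "finite A" "finite B"
  shows "(\<Sum>v\<in>A. deg E B v) = (\<Sum>u\<in>B. deg E A u)"
proof -
  have d: "deg E S v = (\<Sum>u\<in>S. if E v u then 1 else 0)" if "finite S" for S v
    using that by (simp add: deg_def nb_def sum.If_cases Int_def)
  have "(\<Sum>v\<in>A. deg E B v) = (\<Sum>v\<in>A. \<Sum>u\<in>B. if E v u then 1 else 0)" by (simp add: d assms)
  also have "\<dots> = (\<Sum>u\<in>B. \<Sum>v\<in>A. if E v u then 1 else 0)" by (rule sum.swap)
  also have "\<dots> = (\<Sum>u\<in>B. deg E A u)" by (simp add: d assms sym_iff)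
  finally show ?thesis .
qed

text \<open>Suppose that the neighbourhoods of any two vertices with a common neighbour have a union
  below \<open>0.64 n\<close>. As each has at least \<open>0.49 n\<close> elements, they overlap so much
  that having a common neighbour is transitive. Three classes do not fit into \<open>V\<close>. A single
  class would put all neighbourhoods close to one fixed set of fewer than \<open>0.64 n\<close>
  vertices, too few edges for the other vertices. With two classes, every vertex has its neighbours in a
  single class, and depending on whether this is its own class the graph is disconnected or
  bipartite.\<close>
lemma expanding_pair:
  assumes fin: "finite V" and ne: "V \<noteq> {}"
    and d: "\<And>v. v \<in> V \<Longrightarrow> 49 * card V \<le> 100 * deg E V v"
    and conn: "conn E V" and nbip: "\<not> bipartite E V"
  shows "\<exists>x\<in>V. \<exists>r\<in>nb E V x. \<exists>r'\<in>nb E V x. 64 * card V \<le> 100 * card (nb E V r \<union> nb E V r')"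
proof (rule ccontr)
  assume no: "\<not> ?thesis"
  have no': "100 * card (nb E V r \<union> nb E V r') < 64 * card V"
    if "x \<in> V" "r \<in> nb E V x" "r' \<in> nb E V x" for x r r'
  proof (rule ccontr)
    assume "\<not> ?thesis"
    then have "64 * card V \<le> 100 * card (nb E V r \<union> nb E V r')" by simp
    then show False using no that by blast
  qed
  define n where "n = card V"
  have n0: "0 < n" using fin ne by (simp add: n_def card_gt_0_iff)
  define N where "N v = nb E V v" for v
  have fN: "finite (N v)" and NV: "N v \<subseteq> V" for v using fin by (auto simp: N_def)
  have cN: "49 * n \<le> 100 * card (N v)" if "v \<in> V" for v using d[OF that] by (simp add: N_def deg_def n_def)
  define share where "share a b \<longleftrightarrow> N a \<inter> N b \<noteq> {}" for a b
  have small: "100 * card (N a \<union> N b) < 64 * n" if ab: "a \<in> V" "b \<in> V" "share a b" for a b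
  proof -
    obtain x where "x \<in> N a" "x \<in> N b" using ab(3) by (auto simp: share_def)
    then have "x \<in> V" "E x a" "E x b" by (auto simp: N_def intro: sym)
    then have "x \<in> V" "a \<in> nb E V x" "b \<in> nb E V x" using ab by auto
    then show ?thesis using no' unfolding N_def n_def by blast
  qed
  have share_sym: "share a b \<Longrightarrow> share b a" for a b by (auto simp: share_def)
  have trans: "share a c" if "a \<in> V" "b \<in> V" "c \<in> V" "share a b" "share b c" for a b c
  proof (rule ccontr)
    assume "\<not> share a c"
    then have "(N a \<inter> N b) \<inter> (N c \<inter> N b) = {}" by (auto simp: share_def)
    then have "card (N a \<inter> N b) + card (N c \<inter> N b) = card ((N a \<inter> N b) \<union> (N c \<inter> N b))"
      using fN by (simp add: card_Un_disjoint)
    also have "\<dots> \<le> card (N b)" using fN by (intro card_mono) auto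
    finally have "card (N a \<inter> N b) + card (N c \<inter> N b) \<le> card (N b)" .
    moreover have "card (N a) + card (N b) = card (N a \<union> N b) + card (N a \<inter> N b)"
      "card (N c) + card (N b) = card (N c \<union> N b) + card (N c \<inter> N b)"
      using fN by (auto intro: card_Un_Int)
    moreover have "100 * card (N a \<union> N b) < 64 * n" "100 * card (N c \<union> N b) < 64 * n"
      using small that share_sym by auto
    ultimately show False using cN[OF that(1)] cN[OF that(2)] cN[OF that(3)] by linarith
  qed
  have nempty: "N v \<noteq> {}" if "v \<in> V" for v using cN[OF that] n0 by auto
  have refl: "share v v" if "v \<in> V" for v using nempty[OF that] by (simp add: share_def)
  have "\<exists>a\<in>V. \<exists>b\<in>V. \<not> share a b"
  proof (rule ccontr)
    assume "\<not> ?thesis"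
    then have all: "share a b" if "a \<in> V" "b \<in> V" for a b using that by blast
    obtain p0 where p0: "p0 \<in> V" using ne by auto
    define D where "D = V - N p0"
    have fD: "finite D" using fin by (simp add: D_def)
    have "100 * card (N p0) < 64 * n" using small[OF p0 p0 refl[OF p0]] by simp
    moreover have "card D + card (N p0) = n"
      using fN NV fin unfolding D_def n_def by (simp add: card_Diff_subset card_mono)
    ultimately have D: "36 * n \<le> 100 * card D" by linarith
    have "100 * deg E D p \<le> 15 * n" if "p \<in> V" for p
    proof -
      have "nb E D p \<inter> N p0 = {}" "nb E D p \<union> N p0 = N p \<union> N p0" by (auto simp: D_def N_def)
      then have "deg E D p + card (N p0) = card (N p \<union> N p0)"
        unfolding deg_def using card_Un_disjoint[of "nb E D p" "N p0"] fN fD by simp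
      then show ?thesis using small[OF that p0 all[OF that p0]] cN[OF p0] by linarith
    qed
    then have "(\<Sum>p\<in>V. 100 * deg E D p) \<le> (\<Sum>p\<in>V. 15 * n)" by (intro sum_mono) auto
    then have up: "100 * (\<Sum>p\<in>V. deg E D p) \<le> n * (15 * n)" by (simp add: sum_distrib_left n_def)
    have "(\<Sum>v\<in>D. 49 * n) \<le> (\<Sum>v\<in>D. 100 * deg E V v)"
      using d by (intro sum_mono) (auto simp: D_def n_def)
    then have "card D * (49 * n) \<le> 100 * (\<Sum>v\<in>D. deg E V v)" by (simp add: sum_distrib_left)
    also have "\<dots> \<le> n * (15 * n)" unfolding sum_deg_swap[OF fD fin] by (rule up)
    finally have "(49 * card D) * n \<le> (15 * n) * n" by (simp only: ac_simps)
    then have "49 * card D \<le> 15 * n" using n0 by (simp only: mult_le_cancel2)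
    then show False using D n0 by linarith
  qed
  then obtain r1 r2 where r: "r1 \<in> V" "r2 \<in> V" "\<not> share r1 r2" by blast
  define V1 where "V1 = {v \<in> V. share v r1}"
  define V2 where "V2 = {v \<in> V. share v r2}"
  have V12: "V1 \<union> V2 = V"
  proof -
    have "share v r1 \<or> share v r2" if "v \<in> V" for v
    proof (rule ccontr)
      assume "\<not> ?thesis"
      then have "N v \<inter> N r1 = {}" "(N v \<union> N r1) \<inter> N r2 = {}" using r(3) by (auto simp: share_def)
      then have "card (N v \<union> N r1 \<union> N r2) = card (N v) + card (N r1) + card (N r2)"
        using fN by (simp add: card_Un_disjoint)
      moreover have "card (N v \<union> N r1 \<union> N r2) \<le> n" unfolding n_def using fin NV by (intro card_mono) auto
      ultimately show False using cN[OF that] cN[OF r(1)] cN[OF r(2)] n0 by linarith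
    qed
    then show ?thesis by (auto simp: V1_def V2_def)
  qed
  have disj: "V1 \<inter> V2 = {}"
  proof (rule equals0I)
    fix v assume "v \<in> V1 \<inter> V2"
    then have "v \<in> V" "share v r1" "share v r2" by (auto simp: V1_def V2_def)
    then show False using trans[of r1 v r2] share_sym[of v r1] r by blast
  qed
  have rV: "r1 \<in> V1" "r2 \<in> V2" using r refl by (auto simp: V1_def V2_def)
  have nbsame: "share a b" if "x \<in> V" "a \<in> V" "b \<in> V" "E x a" "E x b" for x a b
    using that sym[of x a] sym[of x b] by (auto simp: share_def N_def)
  have same1: "share a b" if "a \<in> V1" "b \<in> V1" for a b
    using that trans[of a r1 b] r share_sym[of b r1] by (auto simp: V1_def)
  have same2: "share a b" if "a \<in> V2" "b \<in> V2" for a b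
    using that trans[of a r2 b] r share_sym[of b r2] by (auto simp: V2_def)
  have closed: "b \<in> V1 \<longleftrightarrow> a \<in> V1" if "x \<in> V" "a \<in> V" "b \<in> V" "E x a" "E x b" for x a b
    using nbsame[OF that] nbsame[OF that(1,3,2,5,4)] trans[of a b r1] trans[of b a r1] r that
    by (auto simp: V1_def)
  (* A class that spans an edge is closed under adjacency. *)
  have sepcase: False if cls: "U \<union> U' = V" "U \<inter> U' = {}" "U' \<noteq> {}"
      and same: "\<And>a b. a \<in> U \<Longrightarrow> b \<in> U \<Longrightarrow> share a b"
      and cl: "\<And>x a b. x \<in> V \<Longrightarrow> a \<in> V \<Longrightarrow> b \<in> V \<Longrightarrow> E x a \<Longrightarrow> E x b \<Longrightarrow> b \<in> U \<longleftrightarrow> a \<in> U"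
      and xU: "x \<in> U" "y \<in> U" "E x y" for U U' x y
  proof -
    have "\<not> E v w" if vU: "v \<in> U" and wU: "w \<in> U'" for v w
    proof
      assume vw: "E v w"
      obtain z where z: "z \<in> V" "E x z" "E v z" using same[OF xU(1) vU] by (auto simp: share_def N_def)
      have inV: "x \<in> V" "y \<in> V" "v \<in> V" "w \<in> V" using xU vU wU cls by auto
      have "z \<in> U" using cl[OF inV(1,2) z(1) xU(3) z(2)] xU by simp
      then have "w \<in> U" using cl[OF inV(3) z(1) inV(4) z(3) vw] by simp
      then show False using wU cls by auto
    qed
    then have "separated E U U'" using cls by (auto simp: separated_def)
    then have "U = {} \<or> U' = {}" using conn cls(1) unfolding conn_def by simp
    then show False using cls(3) xU(1) by blast
  qed
  have ind1: "\<not> E x y" if "x \<in> V1" "y \<in> V1" for x y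
  proof
    assume xy: "E x y"
    show False
      by (rule sepcase[OF V12 disj _ same1 closed that xy]) (use rV in auto)
  qed
  have closed2: "b \<in> V2 \<longleftrightarrow> a \<in> V2" if "x \<in> V" "a \<in> V" "b \<in> V" "E x a" "E x b" for x a b
    using closed[OF that] that V12 disj by blast
  have ind2: "\<not> E x y" if "x \<in> V2" "y \<in> V2" for x y
  proof
    assume xy: "E x y"
    show False
      by (rule sepcase[OF _ _ _ same2 closed2 that xy]) (use rV V12 disj in auto)
  qed
  have "bipartite E V"
    unfolding bipartite_def using ind1 ind2 V12 disj by (intro exI[of _ V1] exI[of _ V2]) simp
  then show False using nbip by simp
qed

section \<open>Closing a long path through reserved vertices\<close>

text \<open>Posa's rotations: every successor of a neighbour of the last vertex is the end of another
  longest path with the same start and the same vertices.\<close>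
lemma posa_endpoints:
  assumes P: "is_path E W P"
    and longest: "\<And>Q. is_path E W Q \<Longrightarrow> hd Q = hd P \<Longrightarrow> length Q \<le> length P"
  shows "\<exists>S\<subseteq>set P. deg E W (last P) \<le> card S \<and> (\<forall>s\<in>S. nb E W s \<subseteq> set P)"
proof -
  have end_nb: "nb E W (last Q) \<subseteq> set Q" if Q: "is_path E W Q" "hd Q = hd P" "length Q = length P" for Q
  proof
    fix z assume z: "z \<in> nb E W (last Q)"
    show "z \<in> set Q"
    proof (rule ccontr)
      assume "z \<notin> set Q"
      then have "is_path E W (Q @ [z])" using z Q by (intro is_path_snoc) auto
      moreover have "hd (Q @ [z]) = hd P" using Q by (auto simp: is_path_def)
      ultimately show False using longest[of "Q @ [z]"] Q by simp
    qed
  qed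
  have d: "distinct P" "P \<noteq> []" using P by (auto simp: is_path_def)
  define I where "I = {i. i < length P \<and> E (last P) (P ! i)}"
  have I: "Suc i < length P" if iI: "i \<in> I" for i
  proof -
    have i: "i < length P" "E (last P) (P ! i)" using iI unfolding I_def by blast+
    have "last P = P ! (length P - 1)" using d by (simp add: last_conv_nth)
    then have "i \<noteq> length P - 1" using i irrefl by metis
    then show ?thesis using i(1) by linarith
  qed
  define S where "S = (\<lambda>i. P ! Suc i) ` I"
  have "inj_on (\<lambda>i. P ! Suc i) I" using I d by (auto simp: inj_on_def nth_eq_iff_index_eq)
  then have "card S = card I" unfolding S_def by (rule card_image)
  also have "\<dots> = deg E (set P) (last P)" using d by (simp add: deg_eq_card_indices I_def)
  also have "\<dots> \<ge> deg E W (last P)"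
    unfolding deg_def using end_nb[OF P] by (intro card_mono) auto
  finally have "deg E W (last P) \<le> card S" .
  moreover have "S \<subseteq> set P" using I by (auto simp: S_def)
  moreover have "nb E W s \<subseteq> set P" if s: "s \<in> S" for s
  proof -
    obtain i where i: "i \<in> I" "s = P ! Suc i" using s by (auto simp: S_def)
    define Q where "Q = take (Suc i) P @ rev (drop (Suc i) P)"
    have il: "Suc i < length P" using I[OF i(1)] .
    have "E (last P) (P ! i)" using i(1) by (simp add: I_def)
    note Q = path_flip[OF P lessI il this, folded Q_def]
    have "length Q = length P" using Q(4) il by simp
    then have "nb E W (last Q) \<subseteq> set Q" using Q(1,2) by (intro end_nb)
    moreover have "last Q = s" using Q(3) i(2) by simp
    moreover have "set Q = set P" unfolding Q_def by (metis append_take_drop_id set_append set_rev)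
    ultimately show ?thesis by simp
  qed
  ultimately show ?thesis by blast
qed

text \<open>Let \<open>T\<close> be the set of neighbours of \<open>r\<close> and \<open>r'\<close>.
  Every vertex has \<open>0.13 n\<close> neighbours in \<open>T\<close>, so a set \<open>R2\<close> of
  at most \<open>0.01 n\<close> vertices meets all these neighbourhoods. Reserve \<open>R2\<close>,
  \<open>r\<close> and \<open>r'\<close> and take a longest path from \<open>x\<close> in the rest. Each
  of its initial segments is closed to a cycle by two further vertices, one in \<open>R2\<close> and one
  of \<open>r\<close>, \<open>r'\<close>. If the path is shorter than \<open>0.51 n\<close>, Posa's
  rotations yield a set \<open>Z\<close> of almost half of all vertices with no neighbours off the path;
  then the reserved vertices and the rest of the path form a small cut. A triangle exists because
  \<open>T\<close> is too large to miss the neighbourhood of \<open>x\<close>.\<close>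
lemma cycles_from_expanding_pair:
  assumes fin: "finite V" and n: "100000 \<le> card V"
    and d: "\<And>v. v \<in> V \<Longrightarrow> 49 * card V \<le> 100 * deg E V v"
    and robust: "\<And>R. R \<subseteq> V \<Longrightarrow> 100 * card R \<le> 5 * card V \<Longrightarrow> conn E (V - R)"
    and x: "x \<in> V" and r: "r \<in> nb E V x" "r' \<in> nb E V x"
    and exp: "64 * card V \<le> 100 * card (nb E V r \<union> nb E V r')"
    and t: "3 \<le> t" "100 * t \<le> 51 * card V"
  shows "has_cycle E V t"
proof -
  define n where "n = card V"
  define T where "T = nb E V r \<union> nb E V r'"
  have fT: "finite T" "T \<subseteq> V" using fin by (auto simp: T_def)
  have cT: "64 * n \<le> 100 * card T" using exp by (simp add: T_def n_def)
  have rV: "r \<in> V" "r' \<in> V" "E x r" "E x r'" "r \<noteq> x" "r' \<noteq> x" using r irrefl by auto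
  have meet: "13 * n \<le> 100 * card (nb E V p \<inter> T)" if "p \<in> V" for p
  proof -
    have "card (nb E V p) + card T = card (nb E V p \<union> T) + card (nb E V p \<inter> T)"
      using fT fin by (intro card_Un_Int) auto
    moreover have "card (nb E V p \<union> T) \<le> n"
      unfolding n_def using fT fin by (intro card_mono) auto
    ultimately show ?thesis using d[OF that] cT unfolding deg_def n_def by linarith
  qed
  show ?thesis
  proof (cases "t = 3")
    case True
    have "nb E V x \<inter> T \<noteq> {}" using meet[OF x] n by (auto simp: n_def)
    then obtain z where "z \<in> nb E V x" "z \<in> T" by blast
    then have z: "z \<in> V" "E x z" "E r z \<or> E r' z" unfolding T_def by simp_all
    then obtain \<rho> where \<rho>: "\<rho> \<in> V" "E x \<rho>" "E \<rho> z" using rV by blast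
    have "x \<noteq> z" "x \<noteq> \<rho>" "\<rho> \<noteq> z" using z(2) \<rho>(2,3) irrefl by metis+
    then have "is_cycle E V [x, \<rho>, z]" using x z \<rho> sym[OF z(2)] by (auto simp: is_cycle_def is_path_def)
    then show ?thesis using True unfolding has_cycle_def by (intro exI[of _ "[x, \<rho>, z]"]) simp
  next
    case False
    (* Without x, r and r' the vertex found in R2 is distinct from the other vertices of the cycle. *)
    define S where "S p = (nb E V p \<inter> T) - {x, r, r'}" for p
    have S1: "S p \<subseteq> V" if "p \<in> V" for p by (auto simp: S_def)
    have S2: "12 * card V \<le> 100 * card (S p)" if "p \<in> V" for p
    proof -
      have "card (nb E V p \<inter> T) - card {x, r, r'} \<le> card (S p)"
        unfolding S_def by (rule diff_card_le_card_Diff) simp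
      moreover have "card {x, r, r'} \<le> 3" by (rule order.trans[OF card_insert_le_m1[of 3]]) (auto simp: card_insert_if)
      ultimately show ?thesis using meet[OF that] n unfolding n_def by linarith
    qed
    obtain R2 where R2: "R2 \<subseteq> V" "100 * card R2 \<le> n" "\<And>p. p \<in> V \<Longrightarrow> S p \<inter> R2 \<noteq> {}"
      using small_hitting_set[OF fin n, of S] S1 S2 unfolding n_def by blast
    define R where "R = (R2 \<union> {r, r'}) - {x}"
    have fR2: "finite R2" using R2(1) fin by (rule finite_subset)
    have RV: "R \<subseteq> V" "finite R" using R2(1) rV fR2 by (auto simp: R_def)
    have cR: "card R \<le> card R2 + 2"
    proof -
      have "card R \<le> card (R2 \<union> {r, r'})" unfolding R_def using fR2 by (intro card_mono) auto
      also have "\<dots> \<le> card R2 + card {r, r'}" by (rule card_Un_le)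
      also have "card {r, r'} \<le> 2" by (simp add: card_insert_if)
      finally show ?thesis by simp
    qed
    define W where "W = V - R"
    have W: "finite W" "x \<in> W" "W \<subseteq> V" using fin x by (auto simp: W_def R_def)
    define good where "good P \<longleftrightarrow> is_path E W P \<and> hd P = x" for P
    have "good [x]" using W by (simp add: good_def)
    moreover have "length P \<le> card W" if "good P" for P
      using that W(1) is_path_card_le by (auto simp: good_def)
    ultimately obtain P where P: "good P" and max: "\<And>Q. good Q \<Longrightarrow> length Q \<le> length P"
      using ex_longest_list[of good "[x]" "card W"] by blast
    have gP: "is_path E W P" "hd P = x" using P by (auto simp: good_def)
    have long: "51 * n \<le> 100 * length P"
    proof (rule ccontr)
      assume short: "\<not> ?thesis"
      obtain Z where Z: "Z \<subseteq> set P" "deg E W (last P) \<le> card Z" "\<forall>s\<in>Z. nb E W s \<subseteq> set P"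
        using posa_endpoints[OF gP(1)] max gP(2) unfolding good_def by blast
      have PW: "set P \<subseteq> W" "distinct P" "last P \<in> W" using gP by (auto dest: is_pathD)
      have "deg E V (last P) \<le> deg E W (last P) + card R"
        unfolding W_def using fin RV by (intro deg_le_diff)
      moreover have "last P \<in> V" using PW W by blast
      then have "49 * n \<le> 100 * deg E V (last P)" using d n_def by simp
      ultimately have cZ: "475 * n \<le> 1000 * card Z"
        using cR R2(2) Z(2) n unfolding n_def by linarith
      define R' where "R' = R \<union> (set P - Z)"
      have "card (set P - Z) = length P - card Z"
        using Z(1) PW by (simp add: card_Diff_subset finite_subset distinct_card)
      then have "card R' \<le> card R + (length P - card Z)"
        unfolding R'_def by (metis card_Un_le)
      then have "100 * card R' \<le> 5 * n"
        using cR R2(2) cZ short n unfolding n_def by linarith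
      moreover have "R' \<subseteq> V" using RV PW W by (auto simp: R'_def)
      ultimately have "conn E (V - R')" unfolding n_def by (intro robust)
      moreover have "Z \<union> (W - set P) = V - R'" using Z PW by (auto simp: R'_def W_def)
      moreover have "separated E Z (W - set P)"
      proof -
        have "b \<in> set P" if "a \<in> Z" "b \<in> W" "E a b" for a b
          using Z(3) that in_nb[of b E W a] by blast
        then show ?thesis using Z(1) unfolding separated_def by blast
      qed
      ultimately have "Z = {} \<or> W - set P = {}" by (rule connD)
      moreover have "Z \<noteq> {}" using cZ n by (auto simp: n_def)
      ultimately have "W - set P = {}" by simp
      then have "card W \<le> card (set P)" by (intro card_mono) auto
      also have "\<dots> = length P" by (rule distinct_card[OF PW(2)])
      finally have "card W \<le> length P" .
      moreover have "card W = n - card R" unfolding W_def n_def by (rule card_Diff_subset[OF RV(2,1)])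
      ultimately show False using short cR R2(2) n unfolding n_def by linarith
    qed
    define Q where "Q = take (t - 2) P"
    have "100 * t \<le> 100 * length P" using t(2) long unfolding n_def by (rule order.trans)
    then have tl: "2 \<le> t - 2" "t - 2 \<le> length P" using t(1) False by simp_all
    have Q: "is_path E W Q" "length Q = t - 2" "hd Q = x"
      using gP tl by (auto simp: Q_def intro: is_path_take)
    have "last Q \<in> W" using Q by (auto dest: is_pathD)
    then obtain w where w: "w \<in> S (last Q)" "w \<in> R2" using R2(3) W by blast
    then have w': "w \<in> V" "E (last Q) w" "w \<in> T" "w \<notin> {x, r, r'}" by (auto simp: S_def)
    then obtain \<rho> where \<rho>: "\<rho> \<in> {r, r'}" "E w \<rho>" using sym by (auto simp: T_def)
    have \<rho>': "\<rho> \<in> V" "E x \<rho>" "\<rho> \<in> R" "\<rho> \<noteq> w" using \<rho> rV w' by (auto simp: R_def)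
    have wR: "w \<in> R" using w w' by (auto simp: R_def)
    have QR: "set Q \<inter> R = {}" using Q(1) by (auto simp: is_path_def W_def)
    have QV: "is_path E V Q" using Q(1) W(3) by (rule is_path_mono)
    have "is_path E V (Q @ [w])" using QV w' wR QR by (intro is_path_snoc) auto
    then have "is_path E V ((Q @ [w]) @ [\<rho>])"
    proof (rule is_path_snoc)
      show "\<rho> \<notin> set (Q @ [w])" using \<rho>'(3,4) QR by auto
      show "E (last (Q @ [w])) \<rho>" using \<rho>(2) by simp
    qed (rule \<rho>'(1))
    moreover have "hd ((Q @ [w]) @ [\<rho>]) = x" using Q(3) is_pathD(1)[OF Q(1)] by simp
    moreover have "length ((Q @ [w]) @ [\<rho>]) = t" using Q(2) tl by simp
    ultimately have "is_cycle E V ((Q @ [w]) @ [\<rho>]) \<and> length ((Q @ [w]) @ [\<rho>]) = t"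
      using t(1) sym[OF \<rho>'(2)] by (simp add: is_cycle_def)
    then show ?thesis unfolding has_cycle_def by blast
  qed
qed

section \<open>Two dense halves\<close>

text \<open>A path grows greedily; its last step is a common neighbour of the current end and
  \<open>v\<close>.\<close>
lemma exact_path:
  assumes h: "\<And>u v. u \<in> K \<Longrightarrow> v \<in> K \<Longrightarrow> h \<le> card (nb E K u \<inter> nb E K v)"
    and uv: "u \<in> K" "v \<in> K" "u \<noteq> v" and i: "3 \<le> i" "i \<le> h"
  shows "\<exists>P. is_path E K P \<and> hd P = u \<and> last P = v \<and> length P = i"
proof -
  have step: "\<exists>w\<in>nb E K a \<inter> nb E K b. w \<notin> set Q" if "a \<in> K" "b \<in> K" "length Q < h" for a b Q
  proof (rule ccontr)
    assume "\<not> ?thesis"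
    then have "nb E K a \<inter> nb E K b \<subseteq> set Q" by blast
    then have "card (nb E K a \<inter> nb E K b) \<le> card (set Q)" by (intro card_mono) auto
    also have "\<dots> \<le> length Q" by (rule card_length)
    finally show False using h[OF that(1,2)] that(3) by simp
  qed
  have greedy: "\<exists>Q. is_path E K Q \<and> hd Q = u \<and> v \<notin> set Q \<and> length Q = Suc j" if "Suc j < h" for j
    using that
  proof (induction j)
    case 0
    show ?case using uv by (intro exI[of _ "[u]"]) simp
  next
    case (Suc j)
    then obtain Q where Q: "is_path E K Q" "hd Q = u" "v \<notin> set Q" "length Q = Suc j" by auto
    have lK: "last Q \<in> K" using Q(1) by (rule is_pathD)
    obtain w where w: "w \<in> nb E K (last Q) \<inter> nb E K (last Q)" "w \<notin> set (v # Q)"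
      using step[OF lK lK, of "v # Q"] Q(4) Suc.prems by auto
    have "is_path E K (Q @ [w])" using Q(1) w by (intro is_path_snoc) auto
    moreover have "hd (Q @ [w]) = u" using Q(2) is_pathD(1)[OF Q(1)] by simp
    ultimately show ?case using Q w by (intro exI[of _ "Q @ [w]"]) auto
  qed
  obtain j where j: "i = Suc j + 2" using i(1) by (metis add_2_eq_Suc' le_Suc_ex numeral_3_eq_3 add_Suc_right add_Suc plus_nat.add_0 Suc_1 add.commute)
  obtain Q where Q: "is_path E K Q" "hd Q = u" "v \<notin> set Q" "length Q = Suc j"
    using greedy[of j] j i by auto
  have lK: "last Q \<in> K" using Q(1) by (rule is_pathD)
  obtain w where w: "w \<in> nb E K (last Q) \<inter> nb E K v" "w \<notin> set Q"
    using step[OF lK uv(2), of Q] Q(4) j i by auto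
  have wv: "w \<noteq> v" using w irrefl by auto
  have "is_path E K (Q @ [w])" using Q(1) w by (intro is_path_snoc) auto
  then have "is_path E K ((Q @ [w]) @ [v])"
  proof (rule is_path_snoc)
    show "v \<notin> set (Q @ [w])" using Q(3) wv by simp
    show "E (last (Q @ [w])) v" using w by (auto intro: sym)
  qed (rule uv(2))
  moreover have "hd ((Q @ [w]) @ [v]) = u" using Q(2) is_pathD(1)[OF Q(1)] by simp
  moreover have "length ((Q @ [w]) @ [v]) = i" using Q(4) j by simp
  ultimately show ?thesis by (intro exI[of _ "(Q @ [w]) @ [v]"]) simp
qed

text \<open>The ends need not lie in the well-connected set \<open>K\<close>; they are first joined to
  two distinct vertices of it.\<close>
lemma exact_path_around_core:
  assumes fin: "finite A" and K: "K \<subseteq> A"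
    and h: "\<And>u v. u \<in> K \<Longrightarrow> v \<in> K \<Longrightarrow> h \<le> card (nb E K u \<inter> nb E K v)"
    and att: "\<And>a. a \<in> A \<Longrightarrow> 4 \<le> deg E K a"
    and ab: "a \<in> A" "b \<in> A" "a \<noteq> b" and i: "5 \<le> i" "i \<le> h"
  shows "\<exists>P. is_path E A P \<and> hd P = a \<and> last P = b \<and> length P = i"
proof -
  define L where "L = K - {a, b}"
  have cab: "card {a, b} = 2" using ab by simp
  have hL: "h - 2 \<le> card (nb E L u \<inter> nb E L v)" if "u \<in> L" "v \<in> L" for u v
  proof -
    have "nb E L u \<inter> nb E L v = (nb E K u \<inter> nb E K v) - {a, b}" by (auto simp: L_def)
    moreover have "card (nb E K u \<inter> nb E K v) - card {a, b} \<le> card ((nb E K u \<inter> nb E K v) - {a, b})"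
      by (rule diff_card_le_card_Diff) simp
    ultimately show ?thesis using h[of u v] that cab by (auto simp: L_def)
  qed
  have attL: "2 \<le> card (nb E L v)" if "v \<in> A" for v
  proof -
    have "nb E L v = nb E K v - {a, b}" by (auto simp: L_def)
    moreover have "card (nb E K v) - card {a, b} \<le> card (nb E K v - {a, b})"
      by (rule diff_card_le_card_Diff) simp
    ultimately show ?thesis using att[OF that] cab by (simp add: deg_def)
  qed
  have "nb E L a \<noteq> {}" using attL[OF ab(1)] by auto
  then obtain u where u: "u \<in> nb E L a" by blast
  have "\<not> nb E L b \<subseteq> {u}"
  proof
    assume "nb E L b \<subseteq> {u}"
    then have "card (nb E L b) \<le> card {u}" by (intro card_mono) auto
    then show False using attL[OF ab(2)] by simp
  qed
  then obtain v where v: "v \<in> nb E L b" "v \<noteq> u" by blast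
  have uvL: "u \<in> L" "v \<in> L" "E a u" "E v b" using u v by (auto intro: sym)
  have i2: "3 \<le> i - 2" "i - 2 \<le> h - 2" using i by simp_all
  have "\<exists>P. is_path E L P \<and> hd P = u \<and> last P = v \<and> length P = i - 2"
    by (rule exact_path[OF _ uvL(1,2) v(2)[symmetric] i2]) (rule hL)
  then obtain P where P: "is_path E L P" "hd P = u" "last P = v" "length P = i - 2"
    by (elim exE conjE)
  have LA: "L \<subseteq> A" using K by (auto simp: L_def)
  have PA: "is_path E A P" using P(1) LA by (rule is_path_mono)
  have PL: "set P \<subseteq> L" using P(1) by (rule is_pathD)
  have "is_path E A (a # P)" using PA ab uvL P(2) PL by (intro is_path_Cons) (auto simp: L_def)
  then have "is_path E A ((a # P) @ [b])"
  proof (rule is_path_snoc)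
    show "b \<notin> set (a # P)" using PL ab by (auto simp: L_def)
    show "E (last (a # P)) b" using uvL(4) P(3) is_pathD(1)[OF P(1)] by simp
  qed (rule ab(2))
  moreover have "length ((a # P) @ [b]) = i" using P(4) i by simp
  ultimately show ?thesis by (intro exI[of _ "(a # P) @ [b]"]) simp
qed

lemma conn_crossing_edge:
  assumes "conn E S" "A \<union> B = S" "A \<inter> B = {}" "A \<noteq> {}" "B \<noteq> {}"
  shows "\<exists>a\<in>A. \<exists>b\<in>B. E a b"
proof (rule ccontr)
  assume "\<not> ?thesis"
  then have "separated E A B" using assms(3) by (auto simp: separated_def)
  then show False using connD[OF assms(1,2)] assms(4,5) by blast
qed

text \<open>If all edges between \<open>A\<close> and \<open>B\<close> shared a vertex, it would be a
  cut vertex.\<close>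
lemma two_disjoint_crossing_edges:
  assumes cn: "conn E V" and tc: "twoconn E V" and AB: "A \<union> B = V" "A \<inter> B = {}"
    and two: "\<And>a. A \<noteq> {a}" "\<And>b. B \<noteq> {b}" "A \<noteq> {}" "B \<noteq> {}"
  shows "\<exists>a1\<in>A. \<exists>a2\<in>A. \<exists>b1\<in>B. \<exists>b2\<in>B. a1 \<noteq> a2 \<and> b1 \<noteq> b2 \<and> E a1 b1 \<and> E a2 b2"
proof -
  obtain a1 b1 where 1: "a1 \<in> A" "b1 \<in> B" "E a1 b1"
    using conn_crossing_edge[OF cn AB two(3,4)] by blast
  have "conn E (V - {a1})" using tc 1 AB by (auto simp: twoconn_def)
  moreover have "(A - {a1}) \<union> B = V - {a1}" "(A - {a1}) \<inter> B = {}" using AB 1 by auto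
  moreover have "A - {a1} \<noteq> {}" using two(1)[of a1] 1 by auto
  ultimately obtain a2 b2 where 2: "a2 \<in> A - {a1}" "b2 \<in> B" "E a2 b2"
    using conn_crossing_edge two(4) by metis
  have "conn E (V - {b1})" using tc 1 AB by (auto simp: twoconn_def)
  moreover have "A \<union> (B - {b1}) = V - {b1}" "A \<inter> (B - {b1}) = {}" using AB 1 by auto
  moreover have "B - {b1} \<noteq> {}" using two(2)[of b1] 1 by auto
  ultimately obtain a3 b3 where 3: "a3 \<in> A" "b3 \<in> B - {b1}" "E a3 b3"
    using conn_crossing_edge two(3) by metis
  show ?thesis
  proof (cases "b2 = b1")
    case False then show ?thesis using 1 2 by blast
  next
    case True
    show ?thesis
    proof (cases "a3 = a1")
      case False
      have "a1 \<noteq> a3 \<and> b1 \<noteq> b3 \<and> E a1 b1 \<and> E a3 b3" using 1 3 False by auto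
      then show ?thesis using 1 3 by blast
    next
      case a3: True
      have "a2 \<noteq> a1 \<and> b1 \<noteq> b3 \<and> E a2 b1 \<and> E a1 b3" using 1 2 3 True a3 by auto
      then show ?thesis using 1 2 3 by blast
    qed
  qed
qed

text \<open>A cut \<open>R\<close> of at most \<open>0.05 n\<close> vertices leaves two parts of order
  between \<open>0.44 n\<close> and \<open>0.56 n\<close> in which any two vertices have \<open>0.32
  n\<close> common neighbours. So short cycles lie in one part. For longer ones, each vertex of
  \<open>R\<close> joins the part where it has more neighbours, and two disjoint edges between the parts
  are completed by paths of prescribed orders, about \<open>0.2 n\<close> vertices on one side and the
  rest on the other.\<close>
lemma cycles_across_small_cut:
  assumes fin: "finite V" and n: "100000 \<le> card V"
    and d: "\<And>v. v \<in> V \<Longrightarrow> 49 * card V \<le> 100 * deg E V v"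
    and cn: "conn E V" and tc: "twoconn E V"
    and R: "R \<subseteq> V" "100 * card R \<le> 5 * card V" "\<not> conn E (V - R)"
    and t: "3 \<le> t" "100 * t \<le> 51 * card V"
  shows "has_cycle E V t"
proof -
  define n where "n = card V"
  have fR: "finite R" using R(1) fin by (rule finite_subset)
  from conn_sep[OF R(3)] obtain K L where KL: "K \<union> L = V - R" "separated E K L" "K \<noteq> {}" "L \<noteq> {}"
    by (elim exE conjE)
  have dKL: "K \<inter> L = {}" using KL(2) by (simp add: separated_def)
  have fKL: "finite K" "finite L"
  proof -
    have "finite (K \<union> L)" unfolding KL(1) using fin by simp
    then show "finite K" "finite L" by simp_all
  qed
  have degVR: "deg E V v \<le> deg E K v + deg E L v + card R" for v
  proof -
    have "deg E V v \<le> deg E (V - R) v + card R" using fin fR by (rule deg_le_diff)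
    also have "deg E (V - R) v = deg E K v + deg E L v"
      unfolding KL(1)[symmetric] using fKL dKL by (rule deg_disjoint_Un)
    finally show ?thesis .
  qed
  have KV: "K \<subseteq> V" "L \<subseteq> V" using KL(1) by auto
  have half: "44 * n \<le> 100 * deg E X v \<and> 44 * n \<le> 100 * card X"
    if X: "X \<union> Y = V - R" "separated E X Y" "finite X" "X \<subseteq> V" "v \<in> X"
      and dv: "deg E V v \<le> deg E X v + deg E Y v + card R" for X Y v
  proof -
    have "nb E Y v = {}" using X(2,5) by (auto simp: separated_def)
    then have "deg E Y v = 0" by (simp add: deg_def)
    moreover have "49 * n \<le> 100 * deg E V v" using d X(4,5) by (auto simp: n_def)
    ultimately have 1: "44 * n \<le> 100 * deg E X v" using dv R(2) unfolding n_def by linarith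
    moreover have "deg E X v \<le> card X" using X(3) by (rule deg_le_card)
    ultimately show ?thesis by linarith
  qed
  have halfK: "44 * n \<le> 100 * deg E K v \<and> 44 * n \<le> 100 * card K" if "v \<in> K" for v
    by (rule half[OF KL(1,2) fKL(1) KV(1) that degVR])
  have halfL: "44 * n \<le> 100 * deg E L v \<and> 44 * n \<le> 100 * card L" if "v \<in> L" for v
    by (rule half[OF _ separated_sym[OF KL(2)] fKL(2) KV(2) that])
      (use KL(1) degVR[of v] in auto)
  have cK: "44 * n \<le> 100 * card K" "44 * n \<le> 100 * card L" using halfK halfL KL(3,4) by blast+
  have cKL: "card K + card L \<le> n"
  proof -
    have "card K + card L = card (K \<union> L)" using fKL dKL by (simp add: card_Un_disjoint)
    also have "\<dots> \<le> n" unfolding n_def using KV fin by (intro card_mono) auto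
    finally show ?thesis .
  qed
  define h where "h = 32 * n div 100"
  have common: "h \<le> card (nb E X u \<inter> nb E X v)"
    if "44 * n \<le> 100 * deg E X u" "44 * n \<le> 100 * deg E X v" "100 * card X \<le> 56 * n" "finite X" for X u v
  proof -
    have "card (nb E X u) + card (nb E X v) = card (nb E X u \<union> nb E X v) + card (nb E X u \<inter> nb E X v)"
      using that(4) by (intro card_Un_Int) auto
    moreover have "card (nb E X u \<union> nb E X v) \<le> card X" using that(4) by (intro card_mono) auto
    ultimately have "32 * n \<le> 100 * card (nb E X u \<inter> nb E X v)" using that(1-3) unfolding deg_def by linarith
    then show ?thesis unfolding h_def by linarith
  qed
  have c56: "100 * card K \<le> 56 * n" "100 * card L \<le> 56 * n" using cK cKL by linarith+
  have comK: "h \<le> card (nb E K u \<inter> nb E K v)" if "u \<in> K" "v \<in> K" for u v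
    using common[of K u v] halfK[OF that(1)] halfK[OF that(2)] c56 fKL by blast
  have comL: "h \<le> card (nb E L u \<inter> nb E L v)" if "u \<in> L" "v \<in> L" for u v
    using common[of L u v] halfL[OF that(1)] halfL[OF that(2)] c56 fKL by blast
  show ?thesis
  proof (cases "t \<le> h")
    case True
    obtain u where u: "u \<in> K" using KL(3) by blast
    have "0 < deg E K u" using halfK[OF u] n unfolding n_def by linarith
    then have "nb E K u \<noteq> {}" by (auto simp: deg_def)
    then obtain v where v: "v \<in> K" "E u v" by auto
    then have uv: "u \<noteq> v" using irrefl by metis
    have "\<exists>P. is_path E K P \<and> hd P = u \<and> last P = v \<and> length P = t"
      by (rule exact_path[OF _ u v(1) uv t(1) True]) (rule comK)
    then obtain P where P: "is_path E K P" "hd P = u" "last P = v" "length P = t"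
      by (elim exE conjE)
    then have "is_cycle E K P" using t(1) sym[OF v(2)] by (simp add: is_cycle_def)
    then have "has_cycle E K t" using P(4) unfolding has_cycle_def by blast
    then show ?thesis using KV(1) by (rule has_cycle_mono)
  next
    case False
    define A where "A = K \<union> {r \<in> R. deg E L r \<le> deg E K r}"
    define B where "B = L \<union> {r \<in> R. deg E K r < deg E L r}"
    have AB: "A \<union> B = V" "A \<inter> B = {}" using KL(1) dKL R(1) by (auto simp: A_def B_def)
    have fAB: "finite A" "finite B" using fKL fR by (auto simp: A_def B_def)
    have attA: "4 \<le> deg E K a" if "a \<in> A" for a
    proof (cases "a \<in> K")
      case True then show ?thesis using halfK[OF True] n unfolding n_def by linarith
    next
      case False
      then have "deg E L a \<le> deg E K a" "a \<in> V" using that R(1) by (auto simp: A_def)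
      then show ?thesis using degVR[of a] d[of a] R(2) n by linarith
    qed
    have attB: "4 \<le> deg E L b" if "b \<in> B" for b
    proof (cases "b \<in> L")
      case True then show ?thesis using halfL[OF True] n unfolding n_def by linarith
    next
      case False
      then have "deg E K b < deg E L b" "b \<in> V" using that R(1) by (auto simp: B_def)
      then show ?thesis using degVR[of b] d[of b] R(2) n by linarith
    qed
    have KA: "K \<subseteq> A" "L \<subseteq> B" by (auto simp: A_def B_def)
    have big: "2 \<le> card K" "2 \<le> card L" using cK n unfolding n_def by linarith+
    have notsing: "X \<noteq> {a}" if "2 \<le> card Y" "Y \<subseteq> X" "finite X" for X Y :: "'a set" and a
    proof
      assume "X = {a}"
      then show False using card_mono[OF that(3,2)] that(1) by simp
    qed
    have neAB: "A \<noteq> {}" "B \<noteq> {}" using KL(3,4) KA by auto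
    have "\<exists>a1\<in>A. \<exists>a2\<in>A. \<exists>b1\<in>B. \<exists>b2\<in>B. a1 \<noteq> a2 \<and> b1 \<noteq> b2 \<and> E a1 b1 \<and> E a2 b2"
      using cn tc AB notsing[OF big(1) KA(1) fAB(1)] notsing[OF big(2) KA(2) fAB(2)] neAB
      by (rule two_disjoint_crossing_edges)
    then obtain a1 a2 b1 b2 where e: "a1 \<in> A" "a2 \<in> A" "b1 \<in> B" "b2 \<in> B"
      "a1 \<noteq> a2" "b1 \<noteq> b2" "E a1 b1" "E a2 b2"
      by (elim bexE conjE)
    define i where "i = 20 * n div 100"
    define j where "j = t - i"
    have h32: "32 * n \<le> 100 * h + 99" unfolding h_def by linarith
    have i20: "20 * n \<le> 100 * i + 99" "100 * i \<le> 20 * n" unfolding i_def by linarith+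
    have i: "5 \<le> i" "i \<le> h" using i20 h32 n unfolding n_def by linarith+
    have "i \<le> t" using i False by linarith
    have j: "5 \<le> j" "j \<le> h" using False h32 i20 t(2) n unfolding j_def n_def by linarith+
    have "\<exists>P. is_path E A P \<and> hd P = a1 \<and> last P = a2 \<and> length P = i"
      by (rule exact_path_around_core[OF fAB(1) KA(1) _ _ e(1,2,5) i]) (rule comK attA; assumption)+
    then obtain P where P: "is_path E A P" "hd P = a1" "last P = a2" "length P = i"
      by (elim exE conjE)
    have "\<exists>P. is_path E B P \<and> hd P = b2 \<and> last P = b1 \<and> length P = j"
      by (rule exact_path_around_core[OF fAB(2) KA(2) _ _ e(4,3) e(6)[symmetric] j])
        (rule comL attB; assumption)+
    then obtain Q where Q: "is_path E B Q" "hd Q = b2" "last Q = b1" "length Q = j"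
      by (elim exE conjE)
    have sub: "A \<subseteq> V" "B \<subseteq> V" using AB(1) by auto
    have "is_path E V (P @ Q)"
    proof (rule is_path_append)
      show "is_path E V P" using P(1) sub(1) by (rule is_path_mono)
      show "is_path E V Q" using Q(1) sub(2) by (rule is_path_mono)
      show "E (last P) (hd Q)" using P(3) Q(2) e(8) by simp
      show "set P \<inter> set Q = {}" using is_pathD(3)[OF P(1)] is_pathD(3)[OF Q(1)] AB(2) by blast
    qed
    moreover have "hd (P @ Q) = a1" "last (P @ Q) = b1"
      using P(2) Q(3) is_pathD(1)[OF P(1)] is_pathD(1)[OF Q(1)] by simp_all
    moreover have "length (P @ Q) = t" using P(4) Q(4) \<open>i \<le> t\<close> by (simp add: j_def)
    ultimately have "is_cycle E V (P @ Q) \<and> length (P @ Q) = t"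
      using t(1) sym[OF e(7)] by (simp add: is_cycle_def)
    then show ?thesis unfolding has_cycle_def by blast
  qed
qed

theorem cycles_of_dense_two_connected:
  assumes fin: "finite V" and n: "100000 \<le> card V"
    and d: "\<And>v. v \<in> V \<Longrightarrow> 49 * card V \<le> 100 * deg E V v"
    and cn: "conn E V" and tc: "twoconn E V" and nb: "\<not> bipartite E V"
    and t: "3 \<le> t" "100 * t \<le> 51 * card V"
  shows "has_cycle E V t"
proof (cases "\<exists>R\<subseteq>V. 100 * card R \<le> 5 * card V \<and> \<not> conn E (V - R)")
  case True
  then obtain R where R: "R \<subseteq> V" "100 * card R \<le> 5 * card V" "\<not> conn E (V - R)" by blast
  show ?thesis by (rule cycles_across_small_cut[OF fin n _ cn tc R t]) (rule d)
next
  case False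
  then have robust: "conn E (V - R)" if "R \<subseteq> V" "100 * card R \<le> 5 * card V" for R using that by blast
  have "V \<noteq> {}" using n by auto
  then have "\<exists>x\<in>V. \<exists>r\<in>nb E V x. \<exists>r'\<in>nb E V x. 64 * card V \<le> 100 * card (nb E V r \<union> nb E V r')"
    by (rule expanding_pair[OF fin _ _ cn nb]) (rule d)
  then obtain x r r' where x: "x \<in> V" "r \<in> nb E V x" "r' \<in> nb E V x"
    "64 * card V \<le> 100 * card (nb E V r \<union> nb E V r')" by (elim bexE)
  show ?thesis
    by (rule cycles_from_expanding_pair[OF fin n _ _ x t]) (rule d robust; assumption)+
qed

end

section \<open>Graphs given by edge sets and the deletion of small degrees\<close>

definition adj :: "'v ugraph \<Rightarrow> 'v \<Rightarrow> 'v \<Rightarrow> bool" where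
  "adj G u v \<longleftrightarrow> {u, v} \<in> uedges G"

lemma simple_graph_edge:
  assumes "simple_graph G" "e \<in> uedges G"
  shows "\<exists>u v. e = {u, v} \<and> u \<noteq> v \<and> u \<in> uverts G \<and> v \<in> uverts G"
proof -
  have "e \<in> [uverts G]\<^bsup>2\<^esup>" using assms by (auto simp: simple_graph_def)
  then show ?thesis by (rule nsets2_E) blast
qed

lemma sgraph_adj:
  assumes "simple_graph G"
  shows "sgraph (adj G)"
proof
  show "adj G y x" if "adj G x y" for x y using that by (simp add: adj_def insert_commute)
  show "\<not> adj G x x" for x
    using simple_graph_edge[OF assms, of "{x, x}"] by (auto simp: adj_def doubleton_eq_iff)
qed

lemma vdegree_delete_verts:
  assumes "simple_graph G" "v \<in> uverts G - S"
  shows "vdegree (delete_verts G S) v = deg (adj G) (uverts G - S) v"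
proof -
  have "{e \<in> uedges (delete_verts G S). v \<in> e} = (\<lambda>u. {v, u}) ` nb (adj G) (uverts G - S) v"
  proof (intro equalityI subsetI)
    fix e assume e: "e \<in> {e \<in> uedges (delete_verts G S). v \<in> e}"
    then have "e \<in> uedges G" "e \<inter> S = {}" "v \<in> e" by (auto simp: delete_verts_def)
    moreover obtain x y where "e = {x, y}" "x \<in> uverts G" "y \<in> uverts G"
      using simple_graph_edge[OF assms(1) \<open>e \<in> uedges G\<close>] by blast
    ultimately obtain u where "e = {v, u}" "u \<in> uverts G - S" "adj G v u"
      by (auto simp: adj_def insert_commute)
    then show "e \<in> (\<lambda>u. {v, u}) ` nb (adj G) (uverts G - S) v" by auto
  next
    fix e assume "e \<in> (\<lambda>u. {v, u}) ` nb (adj G) (uverts G - S) v"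
    then show "e \<in> {e \<in> uedges (delete_verts G S). v \<in> e}"
      using assms(2) by (auto simp: delete_verts_def adj_def)
  qed
  moreover have "inj_on (\<lambda>u. {v, u}) X" for X by (auto simp: inj_on_def doubleton_eq_iff)
  ultimately show ?thesis unfolding vdegree_def deg_def by (simp add: card_image)
qed

lemma degsum_eq_twice_edges:
  assumes "simple_graph G"
  shows "degsum (adj G) (uverts G) = 2 * card (uedges G)"
proof -
  have fV: "finite (uverts G)" using assms by (simp add: simple_graph_def)
  have "uedges G \<subseteq> Pow (uverts G)" using simple_graph_edge[OF assms] by blast
  then have fE: "finite (uedges G)" using fV by (meson finite_Pow_iff finite_subset)
  have "deg (adj G) (uverts G) v = (\<Sum>e\<in>uedges G. if v \<in> e then 1 else 0)" if "v \<in> uverts G" for v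
  proof -
    have "deg (adj G) (uverts G) v = card {e \<in> uedges G. v \<in> e}"
      using vdegree_delete_verts[OF assms, of v "{}"] that by (simp add: vdegree_def delete_verts_def)
    then show ?thesis using fE by (simp add: sum.If_cases Int_def)
  qed
  then have "degsum (adj G) (uverts G) = (\<Sum>v\<in>uverts G. \<Sum>e\<in>uedges G. if v \<in> e then 1 else 0)"
    unfolding degsum_def by (rule sum.cong[OF refl])
  also have "\<dots> = (\<Sum>e\<in>uedges G. \<Sum>v\<in>uverts G. if v \<in> e then 1 else 0)" by (rule sum.swap)
  also have "\<dots> = (\<Sum>e\<in>uedges G. 2)"
  proof (rule sum.cong[OF refl])
    fix e assume "e \<in> uedges G"
    then obtain x y where e: "e = {x, y}" "x \<noteq> y" "x \<in> uverts G" "y \<in> uverts G"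
      using simple_graph_edge[OF assms] by blast
    then have "uverts G \<inter> {v. v \<in> e} = {x, y}" by auto
    then show "(\<Sum>v\<in>uverts G. if v \<in> e then 1 else 0) = (2::nat)" using fV e(2) by (simp add: sum.If_cases)
  qed
  finally show ?thesis by simp
qed

lemma contains_cycleI:
  assumes G: "simple_graph G" and c: "has_cycle (adj G) S t" and S: "S \<subseteq> uverts G"
  shows "contains_cycle G t"
proof -
  interpret sgraph "adj G" using G by (rule sgraph_adj)
  obtain xs where xs: "is_path (adj G) S xs" "adj G (last xs) (hd xs)" "length xs = t" "3 \<le> t"
    using c by (auto simp: has_cycle_def is_cycle_def)
  have d: "distinct xs" "xs \<noteq> []" "set xs \<subseteq> uverts G" using xs(1) S by (auto simp: is_path_def)
  have step: "adj G (xs ! i) (xs ! (Suc i mod t))" if "i < t" for i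
  proof (cases "Suc i < t")
    case True
    then show ?thesis using is_path_nth[OF xs(1), of i] xs(3) by simp
  next
    case False
    then have "Suc i = t" "i = t - 1" using that by auto
    then show ?thesis using xs d by (simp add: last_conv_nth hd_conv_nth)
  qed
  define H where "H = \<lparr>uverts = set xs, uedges = {{xs ! i, xs ! (Suc i mod t)} | i. i < t}\<rparr>"
  have "usubgraph H G"
  proof -
    have "{xs ! i, xs ! (Suc i mod t)} \<in> [set xs]\<^bsup>2\<^esup>" if "i < t" for i
    proof -
      have "Suc i mod t < t" using xs(4) by simp
      moreover have "xs ! i \<noteq> xs ! (Suc i mod t)" using step[OF that] irrefl by metis
      ultimately show ?thesis using that xs(3) by simp
    qed
    then have "simple_graph H" by (auto simp: simple_graph_def H_def)
    moreover have "uedges H \<subseteq> uedges G" using step by (auto simp: H_def adj_def)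
    ultimately show ?thesis using d by (simp add: usubgraph_def H_def)
  qed
  moreover have "graph_iso (cycle_graph t) H"
    unfolding graph_iso_def
  proof (intro exI[of _ "(!) xs"] conjI)
    show "bij_betw ((!) xs) (uverts (cycle_graph t)) (uverts H)"
      using bij_betw_nth[OF d(1), of "{..<t}" "set xs"] xs(3) by (simp add: cycle_graph_def H_def)
    have "uedges H = (\<lambda>i. {xs ! i, xs ! (Suc i mod t)}) ` {..<t}" by (auto simp: H_def)
    also have "\<dots> = (\<lambda>e. (!) xs ` e) ` ((\<lambda>i. {i, Suc i mod t}) ` {..<t})" by (simp add: image_image)
    also have "(\<lambda>i. {i, Suc i mod t}) ` {..<t} = uedges (cycle_graph t)" by (auto simp: cycle_graph_def)
    finally show "uedges H = (\<lambda>e. (!) xs ` e) ` uedges (cycle_graph t)" .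
  qed
  ultimately show ?thesis unfolding contains_cycle_def by blast
qed

lemma min_degree_ge:
  assumes G: "simple_graph G" and ne: "uverts G - S \<noteq> {}"
    and d: "\<And>v. v \<in> uverts G - S \<Longrightarrow> x \<le> real (deg (adj G) (uverts G - S) v)"
  shows "x \<le> real (min_degree (delete_verts G S))"
proof -
  have V: "uverts (delete_verts G S) = uverts G - S" by (simp add: delete_verts_def)
  have "finite (uverts G - S)" using G by (simp add: simple_graph_def)
  then have "min_degree (delete_verts G S) \<in> vdegree (delete_verts G S) ` (uverts G - S)"
    unfolding min_degree_def V using ne by (intro Min_in) auto
  then obtain v where "v \<in> uverts G - S" "min_degree (delete_verts G S) = vdegree (delete_verts G S) v" by blast
  then show ?thesis using d[of v] vdegree_delete_verts[OF G, of v S] by simp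
qed

lemma edge_delete_verts:
  assumes G: "simple_graph G" and e: "e \<in> uedges (delete_verts G S)"
  shows "\<exists>u v. e = {u, v} \<and> u \<noteq> v \<and> u \<in> uverts G - S \<and> v \<in> uverts G - S \<and> adj G u v"
proof -
  have "e \<in> uedges G" "e \<inter> S = {}" using e by (auto simp: delete_verts_def)
  then show ?thesis using simple_graph_edge[OF G, of e] by (auto simp: adj_def)
qed

context sgraph
begin

text \<open>Each deleted vertex has degree below \<open>0.49 n\<close> and takes less than \<open>0.98
  n\<close> from the degree sum. The deletion stops after \<open>K\<close> vertices at the
  latest.\<close>
lemma peel_low_degrees:
  assumes "finite V" "K \<le> card V"
  shows "\<exists>S\<subseteq>V. 100 * degsum E V \<le> 100 * degsum E S + 98 * n * (card V - card S) \<and>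
    (card S + K = card V \<or> card V < card S + K \<and> (\<forall>v\<in>S. 49 * n \<le> 100 * deg E S v))"
  using assms(2)
proof (induction K)
  case 0
  show ?case by (intro exI[of _ V]) simp
next
  case (Suc K)
  then obtain S where S: "S \<subseteq> V" "100 * degsum E V \<le> 100 * degsum E S + 98 * n * (card V - card S)"
    "card S + K = card V \<or> card V < card S + K \<and> (\<forall>v\<in>S. 49 * n \<le> 100 * deg E S v)" by auto
  have fS: "finite S" using S(1) assms(1) by (rule finite_subset)
  show ?case
  proof (cases "\<forall>v\<in>S. 49 * n \<le> 100 * deg E S v")
    case True
    then show ?thesis using S by (intro exI[of _ S]) auto
  next
    case False
    then obtain v where v: "v \<in> S" "100 * deg E S v < 49 * n" by (auto simp: not_le)
    have cS: "card S + K = card V" using S(3) False by blast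
    have c1: "card S = Suc (card (S - {v}))" using v fS by (metis card.remove)
    have "card V - card (S - {v}) = Suc (card V - card S)" using cS c1 by simp
    moreover have "degsum E S = degsum E (S - {v}) + 2 * deg E S v" using fS v(1) by (rule degsum_remove)
    ultimately have "100 * degsum E V \<le> 100 * degsum E (S - {v}) + 98 * n * (card V - card (S - {v}))"
      using S(2) v(2) by simp
    moreover have "card (S - {v}) + Suc K = card V" using cS c1 by simp
    ultimately show ?thesis using S(1) by (intro exI[of _ "S - {v}"]) auto
  qed
qed

lemma cycles_of_excess_edges:
  assumes fin: "finite V" and c: "2 \<le> c" "c \<le> card V" "card V < 2 * (c + 1)"
    and W: "woodall c (card V) < degsum E V" and sq: "card V * card V < 2 * degsum E V"
    and t: "3 \<le> t" "t \<le> c + 1"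
  shows "has_cycle E V t"
proof -
  have "\<exists>t'. has_cycle E V t' \<and> c < t'"
  proof (rule ccontr)
    assume "\<not> ?thesis"
    then have "degsum E V \<le> woodall c (card V)"
      by (intro woodall_bound[OF sgraph_axioms fin c(1)]) (auto simp: not_less)
    then show False using W by simp
  qed
  then obtain t' where "has_cycle E V t'" "c + 1 \<le> t'" by auto
  then show ?thesis using weakly_pancyclic[OF fin sq, of t' t] c(3) t by simp
qed

lemma degsum_bipartite_le:
  assumes "finite X" "finite Y" "X \<inter> Y = {}"
    and "\<forall>u\<in>X. \<forall>v\<in>X. \<not> E u v" "\<forall>u\<in>Y. \<forall>v\<in>Y. \<not> E u v"
  shows "degsum E (X \<union> Y) \<le> 2 * (card X * card Y)"
proof -
  have "deg E (X \<union> Y) u \<le> card Y" if "u \<in> X" for u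
    unfolding deg_def using that assms by (intro card_mono) auto
  then have "(\<Sum>u\<in>X. deg E (X \<union> Y) u) \<le> card X * card Y"
    using sum_bounded_above[of X "deg E (X \<union> Y)" "card Y"] by simp
  moreover have "deg E (X \<union> Y) u \<le> card X" if "u \<in> Y" for u
    unfolding deg_def using that assms by (intro card_mono) auto
  then have "(\<Sum>u\<in>Y. deg E (X \<union> Y) u) \<le> card Y * card X"
    using sum_bounded_above[of Y "deg E (X \<union> Y)" "card X"] by simp
  ultimately show ?thesis unfolding degsum_def using assms(1-3) by (simp add: sum.union_disjoint mult.commute)
qed

end

section \<open>The dichotomy\<close>

text \<open>Here \<open>K\<close> is the number of deleted vertices. With \<open>c = n / 2 + y\<close>,
  the bound of Woodall is at most \<open>n\<^sup>2 / 2 - n K + y\<^sup>2 + (y + K)\<^sup>2\<close>. The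
  squares add up to about \<open>20 \<alpha> n\<^sup>2\<close> at most, since \<open>y \<le> \<alpha>
  n\<close>, \<open>K \<le> 2000 \<alpha> n\<close> and \<open>\<alpha> < 5 / 10\<^sup>6\<close>,
  whereas deleting degrees below \<open>0.49 n\<close> leaves a margin of \<open>n K / 50\<close>,
  almost \<open>40 \<alpha> n\<^sup>2\<close>.\<close>
lemma excess_arithmetic:
  fixes n a b K c :: real
  assumes a: "0 < a" "a < 5 / 10 ^ 6" "b \<le> a / 25" and n: "1 \<le> a * n"
    and K: "1999 * a * n \<le> K" "K \<le> 2000 * a * n"
    and c: "c \<le> n / 2 + a * n" "n / 2 + a * n - 1 \<le> c"
  shows "c * (c - 1) + (n - K - c) * (n - K - c + 1) < (1 / 2 - 2 * b) * n\<^sup>2 - 98 / 100 * n * K"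
    and "(n - K)\<^sup>2 < 2 * ((1 / 2 - 2 * b) * n\<^sup>2 - 98 / 100 * n * K)"
proof -
  define p where "p = a * n"
  define y where "y = c - n / 2"
  have n0: "0 < n" using n a by (smt (verit) zero_less_mult_pos)
  have p: "1 \<le> p" "p \<le> 5 / 10 ^ 6 * n" using n a n0 by (auto simp: p_def)
  have Kp: "1999 * p \<le> K" "K \<le> 2000 * p" using K by (auto simp: p_def)
  have y: "0 \<le> y" "y \<le> p" using c p by (auto simp: y_def p_def)
  have pp: "p * p \<le> 5 / 10 ^ 6 * (n * p)" using mult_right_mono[OF p(2), of p] p by simp
  have np: "0 < n * p" using n0 p by simp
  have nK: "1999 * (n * p) \<le> n * K" using mult_left_mono[OF Kp(1), of n] n0 by simp
  have bn: "b * n\<^sup>2 \<le> n * p / 25"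
  proof -
    have "b * n\<^sup>2 \<le> a / 25 * n\<^sup>2" using a by (intro mult_right_mono) auto
    then show ?thesis by (simp add: p_def power2_eq_square mult_ac)
  qed
  have y2: "y * y \<le> p * p" using y by (intro mult_mono) auto
  have yK: "(y + K) * (y + K) \<le> (2001 * p) * (2001 * p)" using y Kp p by (intro mult_mono) auto
  have K2: "K * K \<le> (2000 * p) * (2000 * p)" using Kp p by (intro mult_mono) auto
  have "c * (c - 1) + (n - K - c) * (n - K - c + 1) =
      n\<^sup>2 / 2 + y * y + (y + K) * (y + K) - n * K - 2 * y - K"
    unfolding y_def by (simp add: power2_eq_square field_simps)
  moreover have "y * y + (y + K) * (y + K) + 2 * (b * n\<^sup>2) < 2 / 100 * (n * K)"
    using y2 yK pp bn nK np by (simp add: field_simps)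
  ultimately show "c * (c - 1) + (n - K - c) * (n - K - c + 1) < (1 / 2 - 2 * b) * n\<^sup>2 - 98 / 100 * n * K"
    using y Kp p by (simp add: algebra_simps)
  have "K * K + 4 * (b * n\<^sup>2) < 4 / 100 * (n * K)"
    using K2 pp bn nK np by (simp add: field_simps)
  then show "(n - K)\<^sup>2 < 2 * ((1 / 2 - 2 * b) * n\<^sup>2 - 98 / 100 * n * K)"
    by (simp add: power2_eq_square algebra_simps)
qed

text \<open>The tolerance in the sizes of the parts is of order \<open>\<surd>\<alpha>\<close>, hence
  much larger than the \<open>2000 \<alpha> n\<close> vertices that may be lost; \<open>447\<close> is
  just below \<open>1 / \<surd>(5 / 10\<^sup>6)\<close>.\<close>
lemma sqrt_dominates:
  fixes a b :: real
  assumes "0 < a" "a < 5 / 10 ^ 6" "0 \<le> b"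
  shows "447 * a \<le> sqrt (a + b)"
proof (rule real_le_rsqrt)
  have "(447 * a)\<^sup>2 = 199809 * a * a" by (simp add: power2_eq_square)
  also have "\<dots> \<le> 1 * a" using assms by (intro mult_right_mono) auto
  finally show "(447 * a)\<^sup>2 \<le> a + b" using assms by simp
qed

text \<open>The product of the orders of the two sides is at least the number of edges, and \<open>(y -
  x)\<^sup>2 = (x + y)\<^sup>2 - 4 x y\<close>. The loss of \<open>0.98 n k\<close> through
  \<open>k\<close> deleted vertices is outweighed by the smaller order \<open>n - k\<close>.\<close>
lemma balanced_by_edges:
  fixes n k x y s b :: real
  assumes xy: "x + y = n - k" "(1 / 2 - 2 * b) * n\<^sup>2 - 98 / 100 * n * k \<le> 2 * (x * y)"
    and k: "0 \<le> k" "k \<le> n / 100" and s: "0 \<le> s" "b \<le> s\<^sup>2" and n: "0 \<le> n"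
  shows "y - x \<le> 2 * (s * n)"
proof (rule power2_le_imp_le)
  define D where "D = (1 / 2 - 2 * b) * n\<^sup>2 - 98 / 100 * n * k"
  define m where "m = n - k"
  have "(y - x)\<^sup>2 = (x + y)\<^sup>2 - 4 * (x * y)" by (simp add: power2_eq_square algebra_simps)
  then have "(y - x)\<^sup>2 = m\<^sup>2 - 4 * (x * y)" unfolding xy(1) m_def .
  moreover have "D \<le> 2 * (x * y)" unfolding D_def by (rule xy(2))
  ultimately have "(y - x)\<^sup>2 \<le> m\<^sup>2 - 2 * D" by linarith
  also have "m\<^sup>2 - 2 * D = 4 * (b * n\<^sup>2) + k * k - 4 / 100 * (n * k)"
    unfolding D_def m_def
    by (simp add: power2_eq_square algebra_simps)
  also have "\<dots> \<le> 4 * (b * n\<^sup>2)"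
  proof -
    have "k * k \<le> (n / 100) * k" using k by (intro mult_right_mono) auto
    moreover have "0 \<le> n * k" using n k by simp
    ultimately show ?thesis by simp
  qed
  also have "\<dots> \<le> 4 * (s\<^sup>2 * n\<^sup>2)" using s by (simp add: mult_right_mono)
  also have "\<dots> = (2 * (s * n))\<^sup>2" by (simp add: power_mult_distrib)
  finally show "(y - x)\<^sup>2 \<le> (2 * (s * n))\<^sup>2" .
  show "0 \<le> 2 * (s * n)" using s n by simp
qed

lemma ex_ordered_by_card:
  assumes "Q X Y" "\<And>X Y. Q X Y \<Longrightarrow> Q Y X"
  shows "\<exists>X Y. Q X Y \<and> card X \<le> card Y"
  using assms by (meson nat_le_linear)

theorem theorem13:
  fixes \<alpha> \<beta> :: real and n :: nat and G :: "'v ugraph"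
  assumes "0 < \<alpha>" and "\<alpha> < 5 / 10 ^ 6"
    and "0 \<le> \<beta>" and "\<beta> \<le> \<alpha> / 25"
    and "real n \<ge> 1 / \<alpha>"
    and "simple_graph G" and "card (uverts G) = n"
    and "real (card (uedges G)) > (1 / 4 - \<beta>) * (real n)\<^sup>2"
  shows "(\<forall>t::nat. 3 \<le> t \<and> int t \<le> \<lceil>(1 / 2 + \<alpha>) * real n\<rceil> \<longrightarrow> contains_cycle G t) \<or>
    (\<exists>V\<^sub>0 V\<^sub>1 V\<^sub>2.
        uverts G = V\<^sub>0 \<union> V\<^sub>1 \<union> V\<^sub>2 \<and>
        V\<^sub>0 \<inter> V\<^sub>1 = {} \<and> V\<^sub>0 \<inter> V\<^sub>2 = {} \<and> V\<^sub>1 \<inter> V\<^sub>2 = {} \<and>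
        real (card V\<^sub>0) < 2000 * \<alpha> * real n \<and>
        (1 / 2 - 10 * sqrt (\<alpha> + \<beta>)) * real n < real (card V\<^sub>1) \<and>
        card V\<^sub>1 \<le> card V\<^sub>2 \<and>
        real (card V\<^sub>2) < (1 / 2 + 10 * sqrt (\<alpha> + \<beta>)) * real n \<and>
        real (min_degree (delete_verts G V\<^sub>0)) \<ge> 2 * real n / 5 \<and>
        (uedges (delete_verts G V\<^sub>0) \<subseteq> [V\<^sub>1]\<^bsup>2\<^esup> \<union> [V\<^sub>2]\<^bsup>2\<^esup> \<or>
         uedges (delete_verts G V\<^sub>0) \<subseteq> cross_edges V\<^sub>1 V\<^sub>2))"
    (is "?all_cycles \<or> ?partition")
proof -
  let ?V = "uverts G" and ?E = "adj G"
  note G = assms(6)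
  interpret sgraph ?E using G by (rule sgraph_adj)
  have fV: "finite ?V" using G by (simp add: simple_graph_def)
  note a = assms(1,2)
  have an: "1 \<le> \<alpha> * real n" using assms(5) a by (simp add: field_simps)
  have n: "200000 < real n"
  proof -
    have "200000 < 1 / \<alpha>" using a by (simp add: field_simps)
    then show ?thesis using assms(5) by linarith
  qed
  have an_le: "200000 * (\<alpha> * real n) \<le> real n"
  proof -
    have "200000 * \<alpha> \<le> 1" using a by simp
    then show ?thesis using mult_right_mono[of "200000 * \<alpha>" 1 "real n"] by simp
  qed
  define L where "L = nat \<lceil>(1 / 2 + \<alpha>) * real n\<rceil>"
  have "0 \<le> (1 / 2 + \<alpha>) * real n" using a n by simp
  then have iL: "int L = \<lceil>(1 / 2 + \<alpha>) * real n\<rceil>" by (simp add: L_def)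
  have L: "real n / 2 + \<alpha> * real n \<le> real L" "real L < real n / 2 + \<alpha> * real n + 1"
  proof -
    have "(1 / 2 + \<alpha>) * real n \<le> real_of_int \<lceil>(1 / 2 + \<alpha>) * real n\<rceil>"
      "real_of_int \<lceil>(1 / 2 + \<alpha>) * real n\<rceil> < (1 / 2 + \<alpha>) * real n + 1" by linarith+
    then show "real n / 2 + \<alpha> * real n \<le> real L" "real L < real n / 2 + \<alpha> * real n + 1"
      unfolding iL[symmetric] by (simp_all add: algebra_simps)
  qed
  have cyclesI: ?all_cycles if "S \<subseteq> ?V" "\<And>t. 3 \<le> t \<Longrightarrow> t \<le> L \<Longrightarrow> has_cycle ?E S t" for S
  proof (intro allI impI)
    fix t assume "3 \<le> t \<and> int t \<le> \<lceil>(1 / 2 + \<alpha>) * real n\<rceil>"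
    then have "3 \<le> t" "t \<le> L" using iL by linarith+
    then show "contains_cycle G t" using contains_cycleI[OF G _ that(1)] that(2) by blast
  qed
  (* Since alpha * n is at least 1, the factor 1999 leaves room for a cut vertex among the 2000 alpha n. *)
  define K where "K = nat \<lceil>1999 * \<alpha> * real n\<rceil>"
  have "0 \<le> 1999 * \<alpha> * real n" using a by simp
  then have iK: "int K = \<lceil>1999 * \<alpha> * real n\<rceil>" by (simp add: K_def)
  have K: "1999 * (\<alpha> * real n) \<le> real K" "real K < 1999 * (\<alpha> * real n) + 1"
  proof -
    have "1999 * \<alpha> * real n \<le> real_of_int \<lceil>1999 * \<alpha> * real n\<rceil>"
      "real_of_int \<lceil>1999 * \<alpha> * real n\<rceil> < 1999 * \<alpha> * real n + 1" by linarith+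
    then show "1999 * (\<alpha> * real n) \<le> real K" "real K < 1999 * (\<alpha> * real n) + 1"
      unfolding iK[symmetric] by (simp_all add: algebra_simps)
  qed
  have "real K \<le> real n" using K an an_le n by linarith
  then have Kn: "K \<le> card ?V" using assms(7) by simp
  obtain S where S: "S \<subseteq> ?V"
    "100 * degsum ?E ?V \<le> 100 * degsum ?E S + 98 * n * (card ?V - card S)"
    "card S + K = card ?V \<or> card ?V < card S + K \<and> (\<forall>v\<in>S. 49 * n \<le> 100 * deg ?E S v)"
    using peel_low_degrees[OF fV Kn, of n] by (elim exE conjE)
  have fS: "finite S" using S(1) fV by (rule finite_subset)
  define k where "k = n - card S"
  have "card S \<le> n" using S(1) fV assms(7) card_mono by blast
  then have k: "card S + k = n" by (simp add: k_def)
  then have rk: "real (card S) = real n - real k" by linarith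
  have dense: "(1 / 2 - 2 * \<beta>) * (real n)\<^sup>2 - 98 / 100 * real n * real k < real (degsum ?E S)"
  proof -
    have "real (100 * degsum ?E ?V) \<le> real (100 * degsum ?E S + 98 * n * k)"
      using S(2) unfolding assms(7) k_def of_nat_le_iff .
    then have "real (degsum ?E ?V) \<le> real (degsum ?E S) + 98 / 100 * real n * real k" by simp
    moreover have "real (degsum ?E ?V) = 2 * real (card (uedges G))"
      using degsum_eq_twice_edges[OF G] by simp
    ultimately show ?thesis using assms(8) by (simp add: algebra_simps)
  qed
  show ?thesis
  proof (cases "card S + K = n")
    case True
    then have "k = K" using k by simp
    define c where "c = L - 1"
    have cr: "real c = real L - 1" using L an n by (simp add: c_def of_nat_diff)
    have K2: "1999 * \<alpha> * real n \<le> real K" "real K \<le> 2000 * \<alpha> * real n" using K an by (simp_all add: algebra_simps)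
    have c2: "real c \<le> real n / 2 + \<alpha> * real n" "real n / 2 + \<alpha> * real n - 1 \<le> real c" using L cr by linarith+
    note ex = excess_arithmetic[OF a assms(4) an K2 c2]
    have cS: "c \<le> card S" using c2 K an an_le n rk \<open>k = K\<close> by linarith
    have c2n: "2 \<le> c" using cr L an n by linarith
    have "real (c - 1) = real c - 1" using c2n by (simp add: of_nat_diff)
    moreover have "real (card S - c) = real (card S) - real c" using cS by (rule of_nat_diff)
    ultimately have "real (woodall c (card S)) =
        real c * (real c - 1) + (real (card S) - real c) * (real (card S) - real c + 1)"
      unfolding woodall_eq[OF cS] by (simp only: of_nat_add of_nat_mult of_nat_1)
    also have "\<dots> < real (degsum ?E S)"
      unfolding rk \<open>k = K\<close> by (rule less_trans[OF ex(1) dense[unfolded \<open>k = K\<close>]])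
    finally have W: "woodall c (card S) < degsum ?E S" by (simp only: of_nat_less_iff)
    have "2 * ((1 / 2 - 2 * \<beta>) * (real n)\<^sup>2 - 98 / 100 * real n * real K) < 2 * real (degsum ?E S)"
      by (rule mult_strict_left_mono[OF dense[unfolded \<open>k = K\<close>]]) simp
    from less_trans[OF ex(2) this] have "real (card S * card S) < real (2 * degsum ?E S)"
      unfolding of_nat_mult of_nat_numeral rk \<open>k = K\<close> power2_eq_square .
    then have sq: "card S * card S < 2 * degsum ?E S" by (simp only: of_nat_less_iff)
    have "real n \<le> 2 * real c" using c2(2) an by linarith
    then have "n \<le> 2 * c" by linarith
    then have half: "card S < 2 * (c + 1)" using \<open>card S \<le> n\<close> by simp
    have cyc: "has_cycle ?E S t" if "3 \<le> t" "t \<le> L" for t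
    proof -
      have "t \<le> c + 1" using that(2) unfolding c_def by simp
      from cycles_of_excess_edges[OF fS c2n cS half W sq that(1) this] show ?thesis .
    qed
    show ?thesis by (rule disjI1, rule cyclesI[OF S(1)]) (rule cyc)
  next
    case False
    then have mind: "49 * n \<le> 100 * deg ?E S v" if "v \<in> S" for v using S(3) assms(7) that by blast
    have "k < K" using S(3) False assms(7) k by auto
    then have kr: "real k + 1 \<le> real K" by linarith
    then have k2: "real k < 1999 * (\<alpha> * real n)" using K by linarith
    have k100: "real k \<le> real n / 100" using k2 an_le by linarith
    define s where "s = sqrt (\<alpha> + \<beta>)"
    have s: "447 * \<alpha> \<le> s" "0 \<le> s" "s\<^sup>2 = \<alpha> + \<beta>"
      using sqrt_dominates[OF a assms(3)] a assms(3) by (auto simp: s_def)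
    have sn: "447 * (\<alpha> * real n) \<le> s * real n" using mult_right_mono[OF s(1), of "real n"] by simp
    have partI: ?partition
      if P: "X \<union> Y = ?V - R" "X \<inter> Y = {}" "R \<subseteq> ?V" "real (card R) < 2000 * \<alpha> * real n"
        "card X \<le> card Y" "real n / 2 - 10 * (s * real n) < real (card X)"
        "real (card Y) < real n / 2 + 10 * (s * real n)" "X \<noteq> {}"
        "\<And>v. v \<in> X \<union> Y \<Longrightarrow> 2 * real n / 5 \<le> real (deg ?E (X \<union> Y) v)"
        "uedges (delete_verts G R) \<subseteq> [X]\<^bsup>2\<^esup> \<union> [Y]\<^bsup>2\<^esup> \<or> uedges (delete_verts G R) \<subseteq> cross_edges X Y"
      for X Y R
    proof (intro exI conjI)
      show "?V = R \<union> X \<union> Y" "R \<inter> X = {}" "R \<inter> Y = {}" using P(1,3) by auto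
      show "2 * real n / 5 \<le> real (min_degree (delete_verts G R))"
        by (rule min_degree_ge[OF G]) (use P(1,8,9) in auto)
      show "(1 / 2 - 10 * sqrt (\<alpha> + \<beta>)) * real n < real (card X)"
        "real (card Y) < (1 / 2 + 10 * sqrt (\<alpha> + \<beta>)) * real n"
        using P(6,7) by (simp_all add: s_def[symmetric] algebra_simps)
    qed (use P in auto)
    show ?thesis
    proof (cases "\<exists>R\<subseteq>S. card R \<le> 1 \<and> \<not> conn ?E (S - R)")
      case True
      then obtain R where R: "R \<subseteq> S" "card R \<le> 1" "\<not> conn ?E (S - R)" by blast
      have "\<exists>X Y. (X \<union> Y = S - R \<and> separated ?E X Y \<and> X \<noteq> {} \<and> Y \<noteq> {}) \<and> card X \<le> card Y"
      proof -
        from conn_sep[OF R(3)] obtain X Y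
          where XY: "X \<union> Y = S - R \<and> separated ?E X Y \<and> X \<noteq> {} \<and> Y \<noteq> {}" by (elim exE)
        show ?thesis
          by (rule ex_ordered_by_card[where Q = "\<lambda>X Y. X \<union> Y = S - R \<and> separated ?E X Y \<and> X \<noteq> {} \<and> Y \<noteq> {}",
                OF XY]) (auto intro: separated_sym)
      qed
      then obtain X Y where XY: "X \<union> Y = S - R" "separated ?E X Y" "X \<noteq> {}" "Y \<noteq> {}" "card X \<le> card Y"
        by (elim exE conjE)
      have dXY: "X \<inter> Y = {}" using XY(2) by (simp add: separated_def)
      have fR: "finite R" using R(1) fS by (rule finite_subset)
      have "finite (X \<union> Y)" unfolding XY(1) using fS by simp
      then have fXY: "finite X" "finite Y" by simp_all
      have degSR: "49 * n \<le> 100 * deg ?E (X \<union> Y) v + 100" if "v \<in> S" for v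
      proof -
        have "deg ?E S v \<le> deg ?E (S - R) v + card R" using fS fR by (rule deg_le_diff)
        then show ?thesis using mind[OF that] R(2) unfolding XY(1) by linarith
      qed
      have sub: "X \<subseteq> S" "Y \<subseteq> S" using XY(1) by auto
      have inside: "49 * n \<le> 100 * deg ?E Z v + 100" if "Z \<union> Z' = X \<union> Y" "separated ?E Z Z'" "v \<in> Z" for Z Z' v
      proof -
        have "nb ?E (Z \<union> Z') v = nb ?E Z v" using that(2,3) by (auto simp: separated_def)
        then have "deg ?E (X \<union> Y) v = deg ?E Z v" unfolding that(1)[symmetric] deg_def by simp
        moreover have "v \<in> S" using that(1,3) sub by blast
        ultimately show ?thesis using degSR[of v] by simp
      qed
      have dX: "49 * n \<le> 100 * deg ?E X v + 100" if "v \<in> X" for v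
        using inside[OF refl XY(2) that] .
      have dY: "49 * n \<le> 100 * deg ?E Y v + 100" if "v \<in> Y" for v
        by (rule inside[OF Un_commute separated_sym[OF XY(2)] that])
      have big: "49 * n \<le> 100 * card X"
      proof -
        obtain v where v: "v \<in> X" using XY(3) by blast
        show ?thesis using dX[OF v] deg_less_card[OF fXY(1) v] by linarith
      qed
      have sum: "card X + card Y + card R = card S"
      proof -
        have "card X + card Y = card (S - R)" using card_Un_disjoint[OF fXY dXY] XY(1) by simp
        also have "\<dots> = card S - card R" using fR R(1) by (rule card_Diff_subset)
        finally show ?thesis using card_mono[OF fS R(1)] by simp
      qed
      show ?thesis
      proof (cases "L \<le> card Y")
        case True
        have half: "card Y < 2 * deg ?E Y v" if "v \<in> Y" for v
          using dY[OF that] big sum k n by linarith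
        have cyc: "has_cycle ?E S t" if "3 \<le> t" "t \<le> L" for t
        proof -
          have "has_cycle ?E Y t"
            by (rule pancyclic_if_degree_above_half[OF fXY(2) half that(1)]) (use that(2) True in auto)
          then show ?thesis using sub(2) by (rule has_cycle_mono)
        qed
        show ?thesis by (rule disjI1, rule cyclesI[OF S(1)]) (rule cyc)
      next
        case False
        define R' where "R' = ?V - (X \<union> Y)"
        have XYV: "X \<union> Y \<subseteq> ?V" using sub S(1) by blast
        have VR': "X \<union> Y = ?V - R'" using XYV by (auto simp: R'_def)
        have cR': "real (card R') = real n - real (card X) - real (card Y)"
        proof -
          have "card R' = n - card (X \<union> Y)"
            unfolding R'_def assms(7)[symmetric] using XYV fXY by (intro card_Diff_subset) auto
          moreover have "card (X \<union> Y) = card X + card Y" by (rule card_Un_disjoint[OF fXY dXY])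
          moreover have "card X + card Y \<le> n" using sum k by linarith
          ultimately show ?thesis by simp
        qed
        have Yup: "real (card Y) < real n / 2 + \<alpha> * real n"
          using False L by linarith
        have sumr: "real n - real k - 1 \<le> real (card X) + real (card Y)" using sum k R(2) by linarith
        have ?partition
        proof (rule partI[OF VR' dXY _ _ XY(5) _ _ XY(3)])
          show "R' \<subseteq> ?V" by (auto simp: R'_def)
          have "real (card R') < 2000 * (\<alpha> * real n)" using cR' sumr k2 an by linarith
          then show "real (card R') < 2000 * \<alpha> * real n" by simp
          show "real n / 2 - 10 * (s * real n) < real (card X)" using sumr Yup k2 an sn by linarith
          show "real (card Y) < real n / 2 + 10 * (s * real n)" using Yup an sn by linarith
          show "2 * real n / 5 \<le> real (deg ?E (X \<union> Y) v)" if "v \<in> X \<union> Y" for v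
          proof -
            have "v \<in> S" using that sub by blast
            then have "49 * n \<le> 100 * deg ?E (X \<union> Y) v + 100" by (rule degSR)
            then have "49 * real n \<le> 100 * real (deg ?E (X \<union> Y) v) + 100" by linarith
            then show ?thesis using n by linarith
          qed
          have "uedges (delete_verts G R') \<subseteq> [X]\<^bsup>2\<^esup> \<union> [Y]\<^bsup>2\<^esup>"
          proof
            fix e assume "e \<in> uedges (delete_verts G R')"
            from edge_delete_verts[OF G this] obtain u v where e: "e = {u, v}" "u \<noteq> v"
              "u \<in> X \<union> Y" "v \<in> X \<union> Y" "?E u v" unfolding VR' by (elim exE conjE)
            have "\<not> (u \<in> X \<and> v \<in> Y)" "\<not> (u \<in> Y \<and> v \<in> X)"
              using XY(2) separated_sym[OF XY(2)] e(5) unfolding separated_def by blast+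
            then show "e \<in> [X]\<^bsup>2\<^esup> \<union> [Y]\<^bsup>2\<^esup>" using e by auto
          qed
          then show "uedges (delete_verts G R') \<subseteq> [X]\<^bsup>2\<^esup> \<union> [Y]\<^bsup>2\<^esup> \<or>
            uedges (delete_verts G R') \<subseteq> cross_edges X Y" by blast
        qed
        then show ?thesis by (rule disjI2)
      qed
    next
      case nocut: False
      have cn: "conn ?E S" using nocut by (metis Diff_empty card.empty empty_subsetI zero_le)
      have tc: "twoconn ?E S" unfolding twoconn_def
      proof
        fix v assume v: "v \<in> S"
        then have "{v} \<subseteq> S" "card {v} \<le> 1" by auto
        then show "conn ?E (S - {v})" using nocut by blast
      qed
      show ?thesis
      proof (cases "bipartite ?E S")
        case False
        have "99 * real n \<le> 100 * real (card S)" using rk k100 by linarith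
        then have cS: "99 * n \<le> 100 * card S" by linarith
        have n5: "100000 \<le> card S" using cS n by linarith
        have d: "49 * card S \<le> 100 * deg ?E S v" if "v \<in> S" for v using mind[OF that] k by linarith
        have cyc: "has_cycle ?E S t" if "3 \<le> t" "t \<le> L" for t
        proof (rule cycles_of_dense_two_connected[OF fS n5 _ cn tc False that(1)])
          have "real t \<le> real L" using that(2) by simp
          moreover have "real (card S) \<ge> real n - 1 / 100 * real n"
            using rk k100 by linarith
          ultimately have "100 * real t \<le> 51 * real (card S)" using L an_le n by linarith
          then show "100 * t \<le> 51 * card S" by linarith
        qed (rule d)
        show ?thesis by (rule disjI1, rule cyclesI[OF S(1)]) (rule cyc)
      next
        case True
        then have "\<exists>X Y. (X \<union> Y = S \<and> X \<inter> Y = {} \<and> (\<forall>u\<in>X. \<forall>v\<in>X. \<not> ?E u v) \<and>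
          (\<forall>u\<in>Y. \<forall>v\<in>Y. \<not> ?E u v)) \<and> card X \<le> card Y"
          unfolding bipartite_def
          by (elim exE) (rule ex_ordered_by_card[where Q = "\<lambda>X Y. X \<union> Y = S \<and> X \<inter> Y = {} \<and>
            (\<forall>u\<in>X. \<forall>v\<in>X. \<not> ?E u v) \<and> (\<forall>u\<in>Y. \<forall>v\<in>Y. \<not> ?E u v)"], auto)
        then obtain X Y where XY: "X \<union> Y = S" "X \<inter> Y = {}"
          "\<forall>u\<in>X. \<forall>v\<in>X. \<not> ?E u v" "\<forall>u\<in>Y. \<forall>v\<in>Y. \<not> ?E u v" "card X \<le> card Y"
          by (elim exE conjE)
        have "finite (X \<union> Y)" unfolding XY(1) by (rule fS)
        then have fXY: "finite X" "finite Y" by simp_all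
        have sum: "card X + card Y = card S" using card_Un_disjoint[OF fXY XY(2)] XY(1) by simp
        then have sumr: "real (card X) + real (card Y) = real n - real k" using rk by linarith
        have "degsum ?E S \<le> 2 * (card X * card Y)"
          using degsum_bipartite_le[OF fXY XY(2,3,4)] unfolding XY(1) .
        then have "real (degsum ?E S) \<le> real (2 * (card X * card Y))" by (simp only: of_nat_le_iff)
        then have ed: "(1 / 2 - 2 * \<beta>) * (real n)\<^sup>2 - 98 / 100 * real n * real k \<le> 2 * (real (card X) * real (card Y))"
          using dense by simp
        have bal: "real (card Y) - real (card X) \<le> 2 * (s * real n)"
          by (rule balanced_by_edges[OF sumr ed _ k100 s(2)]) (use s(3) a in auto)
        define R where "R = ?V - S"
        have VR: "X \<union> Y = ?V - R" using XY(1) S(1) by (auto simp: R_def)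
        have cR: "card R = k"
          unfolding R_def k_def assms(7)[symmetric] by (rule card_Diff_subset[OF fS S(1)])
        have ?partition
        proof (rule partI[OF VR XY(2) _ _ XY(5)])
          show "R \<subseteq> ?V" by (auto simp: R_def)
          have "real (card R) < 2000 * (\<alpha> * real n)" using cR k2 an by linarith
          then show "real (card R) < 2000 * \<alpha> * real n" by simp
          show low: "real n / 2 - 10 * (s * real n) < real (card X)" using sumr bal k2 an sn by linarith
          show "real (card Y) < real n / 2 + 10 * (s * real n)" using sumr bal an sn by linarith
          show "2 * real n / 5 \<le> real (deg ?E (X \<union> Y) v)" if "v \<in> X \<union> Y" for v
          proof -
            have "49 * n \<le> 100 * deg ?E (X \<union> Y) v" using mind[of v] that unfolding XY(1) by simp
            then have "49 * real n \<le> 100 * real (deg ?E (X \<union> Y) v)" by linarith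
            then show ?thesis by linarith
          qed
          show "X \<noteq> {}"
          proof
            assume "X = {}"
            then have "S = Y" using XY(1) by simp
            then have "\<forall>v\<in>S. nb ?E S v = {}" using XY(4) by auto
            then have "\<forall>v\<in>S. deg ?E S v = 0" by (simp add: deg_def)
            moreover have "S \<noteq> {}" using rk k100 n by auto
            ultimately show False using mind n by fastforce
          qed
          have "uedges (delete_verts G R) \<subseteq> cross_edges X Y"
          proof
            fix e assume "e \<in> uedges (delete_verts G R)"
            from edge_delete_verts[OF G this] obtain u v where e: "e = {u, v}" "u \<noteq> v"
              "u \<in> X \<union> Y" "v \<in> X \<union> Y" "?E u v" unfolding VR by (elim exE conjE)
            then consider "u \<in> X" "v \<in> Y" | "v \<in> X" "u \<in> Y" using XY(3,4) by blast
            then show "e \<in> cross_edges X Y"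
            proof cases
              case 1
              then show ?thesis unfolding cross_edges_def e(1) by blast
            next
              case 2
              have "e = {v, u}" unfolding e(1) by (rule insert_commute)
              then show ?thesis using 2 unfolding cross_edges_def by blast
            qed
          qed
          then show "uedges (delete_verts G R) \<subseteq> [X]\<^bsup>2\<^esup> \<union> [Y]\<^bsup>2\<^esup> \<or>
            uedges (delete_verts G R) \<subseteq> cross_edges X Y" by blast
        qed
        then show ?thesis by (rule disjI2)
      qed
    qed
  qed
qed

end
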